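(* Let $\Phi:T\times\mathbb{R}^n\times\mathbb{R}^q\rightrightarrows\mathbb{R}^m$ be a set-valued normal integrand, let $G:\mathbb{R}^n\times\mathbb{R}^q\rightrightarrows\mathbb{R}^m$ be a closed-graph multifunction, and let $S:\mathbb{R}^n\rightrightarrows\mathbb{R}^q$ be $$S(x):=\{z\in\mathbb{R}^q:\ 0\in\mathrm{E}_\Phi(x,z)+G(x,z)\}.$$ Let $(\bar x,\bar z)\in\operatorname{gph}S$, and assume that $\operatorname{gph}S$ is normally regular at $(\bar x,\bar z)$; that there exists $\rho>0$ such that $\Phi_t(x,z)$ is convex for all $(x,z)\in\mathbb{B}_\rho(\bar x,\bar z)$ and all $t\in T$, and $\Phi_t(\bar x,\bar z)=\{\bar{\mathsf y}(t)\}$ is single-valued for all $t\in T$; and that $\Phi$ is integrably Lipschitz-like around $(\bar x,\bar z,\bar{\mathsf y})$. Let $\bar y\in-G(\bar x,\bar z)\cap\mathrm{E}_\Phi(\bar x,\bar z)$, and suppose that the adjoint generalized equation $$0\in\int_T D^*\Phi_t(\bar x,\bar z)(y^* )\,\mu(dt)+D^*G(\bar x,\bar z,-\bar y)(y^* )$$ admits only the trivial solution $y^*=0$. Then for every $z^*\in\mathbb{R}^q$ and $x^*\in D^*S(\bar x,\bar z)(z^* )$ there exists $y^*\in\mathbb{R}^m$ such that $$\begin{pmatrix}x^*\\-z^*\end{pmatrix}\in\int_T D^*\Phi_t(\bar x,\bar z)(y^* )\,\mu(dt)+D^*G(\bar x,\bar z,-\bar y)(y^* ).$$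
   Context: $(T,\mathcal{A},\mu)$ is a complete finite measure space. $\mathbb{B}$ is the closed unit ball and $\mathbb{B}_r(u)$ the closed ball of radius $r$ centered at $u$. Set-valued normal integrand: each $\Phi_t:=\Phi(t,\cdot,\cdot)$ has closed graph and $\operatorname{gph}\Phi\in\mathcal{A}\otimes\mathcal{B}(\mathbb{R}^n\times\mathbb{R}^q\times\mathbb{R}^m)$. $\mathrm{E}_\Phi(x,z):=\int_T\Phi_t(x,z)\,\mu(dt)$; integrals of multifunctions are Aumann integrals (sets of integrals of integrable a.e. selections). Normal cones: for $C\subseteq\mathbb{R}^d$ and $x\in C$, $\hat N(x;C):=\{x^*:\limsup_{u\to x,\,u\in C}\langle x^*,u-x\rangle/\|u-x\|\le0\}$ (empty if $x\notin C$), and $N(x;C)$ is the set of all limits of sequences $x_k^*\in\hat N(x_k;C)$ with $x_k\to x$. $C$ is normally regular at $x\in C$ if $\hat N(x;C)=N(x;C)$. Coderivative: $D^*M(u,y)(y^* ):=\{u^*:(u^*,-y^* )\in N((u,y);\operatorname{gph}M)\}$ for $(u,y)\in\operatorname{gph}M$; $y$ is omitted when $M(u)=\{y\}$, so $D^*\Phi_t(\bar x,\bar z):=D^*\Phi_t(\bar x,\bar z,\bar{\mathsf y}(t))$. The coderivatives of $\Phi_t$ and $G$ take values in subsets of $\mathbb{R}^n\times\mathbb{R}^q$. $\Phi$ is integrably Lipschitz-like around $(\bar x,\bar z,\bar{\mathsf y})$ if there exist positive constants $\ell,\eta,\gamma$ and $\hat T\in\mathcal{A}$ with $\mu(T\setminus\hat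 T)=0$ such that $\Phi_t(u)\cap\mathbb{B}_\gamma(\bar{\mathsf y}(t))\subseteq\Phi_t(u')+\ell\|u-u'\|\mathbb{B}$ for all $t\in\hat T$ and $u,u'\in\mathbb{B}_\eta(\bar x,\bar z)$. *)

theory Defs
  imports "HOL-Analysis.Analysis"
begin

definition gph :: "('u \<Rightarrow> 'v set) \<Rightarrow> ('u \<times> 'v) set" where
  "gph F = {(u, v). v \<in> F u}"

(* The filter "at x within C" omits u = x.  At an isolated point of C it is bot, where
   Limsup is -\<infinity>, so the cone is the whole space. *)
definition regular_normal_cone :: "'d::euclidean_space set \<Rightarrow> 'd \<Rightarrow> 'd set" where
  "regular_normal_cone C x =
     {xs. x \<in> C \<and> Limsup (at x within C) (\<lambda>u. ereal ((xs \<bullet> (u - x)) / norm (u - x))) \<le> 0}"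

definition limiting_normal_cone :: "'d::euclidean_space set \<Rightarrow> 'd \<Rightarrow> 'd set" where
  "limiting_normal_cone C x =
     {xs. \<exists>X Xs. (\<forall>k. Xs k \<in> regular_normal_cone C (X k)) \<and>
                 X \<longlonglongrightarrow> x \<and> Xs \<longlonglongrightarrow> xs}"

definition normally_regular :: "'d::euclidean_space set \<Rightarrow> 'd \<Rightarrow> bool" where
  "normally_regular C x \<longleftrightarrow> x \<in> C \<and> regular_normal_cone C x = limiting_normal_cone C x"

definition coderivative ::
    "('u::euclidean_space \<Rightarrow> 'v::euclidean_space set) \<Rightarrow> 'u \<Rightarrow> 'v \<Rightarrow> 'v \<Rightarrow> 'u set" where
  "coderivative F u y ys = {us. (us, - ys) \<in> limiting_normal_cone (gph F) (u, y)}"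

definition aumann_integral :: "'t measure \<Rightarrow> ('t \<Rightarrow> 'v::euclidean_space set) \<Rightarrow> 'v set" where
  "aumann_integral M F = {integral\<^sup>L M f |f. integrable M f \<and> (AE t in M. f t \<in> F t)}"

definition normal_integrand ::
    "'t measure \<Rightarrow> ('t \<Rightarrow> 'u::euclidean_space \<Rightarrow> 'v::euclidean_space set) \<Rightarrow> bool" where
  "normal_integrand M \<Phi> \<longleftrightarrow>
     (\<forall>t\<in>space M. closed (gph (\<Phi> t))) \<and>
     {(t, w). t \<in> space M \<and> w \<in> gph (\<Phi> t)} \<in> sets (M \<Otimes>\<^sub>M borel)"

definition expected_map ::
    "'t measure \<Rightarrow> ('t \<Rightarrow> 'u \<Rightarrow> 'v::euclidean_space set) \<Rightarrow> 'u \<Rightarrow> 'v set" where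
  "expected_map M \<Phi> u = aumann_integral M (\<lambda>t. \<Phi> t u)"

(* The sums of sets here and below are Minkowski sums (Set_Algebras). *)
definition integrably_Lipschitz_like ::
    "'t measure \<Rightarrow> ('t \<Rightarrow> 'u::euclidean_space \<Rightarrow> 'v::euclidean_space set) \<Rightarrow> 'u \<Rightarrow> ('t \<Rightarrow> 'v) \<Rightarrow> bool"
  where
  "integrably_Lipschitz_like M \<Phi> ubar ybar \<longleftrightarrow>
     (\<exists>l \<eta> \<gamma>. l > 0 \<and> \<eta> > 0 \<and> \<gamma> > 0 \<and>
       (\<exists>T'\<in>sets M. emeasure M (space M - T') = 0 \<and>
         (\<forall>t\<in>T'. \<forall>u\<in>cball ubar \<eta>. \<forall>u'\<in>cball ubar \<eta>.
            \<Phi> t u \<inter> cball (ybar t) \<gamma> \<subseteq>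
              \<Phi> t u' + (\<lambda>b. (l * norm (u - u')) *\<^sub>R b) ` cball 0 1)))"

definition solution_map ::
    "'t measure \<Rightarrow> ('t \<Rightarrow> 'x \<times> 'z \<Rightarrow> 'v::euclidean_space set) \<Rightarrow> ('x \<times> 'z \<Rightarrow> 'v set) \<Rightarrow> 'x \<Rightarrow> 'z set"
  where
  "solution_map M \<Phi> G x = {z. 0 \<in> expected_map M \<Phi> (x, z) + G (x, z)}"

end

theory Submission
  imports Defs "HOL-Complex_Analysis.Great_Picard"
begin

text \<open>
  Write \<open>u\<close> for the pair \<open>(x, z)\<close>, \<open>ub\<close> for the reference point and \<open>w\<close> for \<open>(xs, - zs)\<close>. Normal
  regularity turns the limiting normal \<open>w\<close> to the graph of the solution map into a regular one, so
  \<open>ub\<close> locally minimises \<open>- (w \<bullet> (u - ub)) + \<epsilon> |u - ub|\<close> over all \<open>u\<close> for which some integrable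
  selection \<open>y\<close> of \<open>\<Phi> t u\<close> satisfies \<open>- \<integral>y \<in> G u\<close>. Both couplings in this constraint are relaxed: every
  \<open>t\<close> gets its own point \<open>u t\<close> with \<open>y t \<in> \<Phi> t (u t)\<close>, a separate pair \<open>(r, g)\<close> runs through the graph
  of \<open>G\<close>, and \<open>k |\<integral>y + g|\<^sup>2 + K \<integral>|u t - r|\<^sup>2\<close> is added to the objective.

  A minimiser of the relaxed problem is separately optimal in \<open>(r, g)\<close> and, after a measurable
  selection argument, in \<open>(u t, y t)\<close> for almost every \<open>t\<close>. As the penalty is quadratic, both conditions
  say that explicit vectors are proximal normals: with \<open>p = 2 k (\<integral>y + g)\<close> and \<open>v t = 2 K (r - u t)\<close>,
  the pair \<open>(v t, - p)\<close> is normal to the graph of \<open>\<Phi> t\<close>, and \<open>(w - \<integral>v, - p)\<close> is normal to the graph of \<open>G\<close>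
  up to \<open>\<epsilon>\<close>. So \<open>p\<close> is an approximate multiplier. With the weight \<open>K\<close> of the order of \<open>k\<close>
  the Lipschitz property bounds \<open>|v t|\<close> by a multiple of \<open>|p|\<close>. Letting \<open>k\<close> grow and \<open>\<epsilon>\<close> shrink, either
  the \<open>p\<close> stay bounded and a limit is the multiplier that is asked for, or they can be normalised and
  the limit is a nonzero solution of the adjoint equation with right-hand side \<open>0\<close>, which is excluded.

  Two tools from measure theory carry this. The first is Fatou's lemma in several dimensions
  (\<open>selection_of_cluster_sets\<close>): if bounded functions \<open>v k\<close> have converging integrals, then the limit
  is the integral of a selection of the pointwise cluster sets. It yields the minimisers, their
  convergence to the reference point, and the passage to the limit in the multipliers. It holds with
  atoms as well, and rests on a convexity theorem of Lyapunov type (\<open>selection_with_integral\<close>). The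
  second is the measurable projection theorem for complete measures (\<open>measurable_projection\<close>), without
  which a set-valued map that only has a measurable graph would not give measurable selections.

  Convexity of the values is used once: together with the single value at \<open>ub\<close> it upgrades the
  Lipschitz-like property, which only sees the part of \<open>\<Phi> t u\<close> near \<open>yfun t\<close>, to a Lipschitz property
  of the whole set \<open>\<Phi> t u\<close> (\<open>convex_Lipschitz_like_imp_Lipschitz\<close>).
\<close>

section \<open>Measurable projections\<close>

definition closed_rectangles :: "'t measure \<Rightarrow> ('t \<times> 'x::topological_space) set set" where
  "closed_rectangles M = {A \<times> F |A F. A \<in> sets M \<and> closed F}"

text \<open>The sets obtained from closed rectangles by the Suslin operation. The condition with number \<open>k\<close> may
  depend on the first \<open>N k\<close> coordinates of the branch \<open>s\<close> rather than on exactly \<open>k\<close> of them. With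
  this freedom countable unions and intersections need only a recoding of the branch.\<close>

definition suslin :: "'t measure \<Rightarrow> ('t \<times> 'x::topological_space) set \<Rightarrow> bool" where
  "suslin M C \<longleftrightarrow> (\<exists>R N. (\<forall>k s. R k s \<in> closed_rectangles M) \<and>
     (\<forall>k s s'. (\<forall>i<N k. s i = s' i) \<longrightarrow> R k s = R k s') \<and>
     C = {w. \<exists>s::nat \<Rightarrow> nat. \<forall>k::nat. w \<in> R k s})"

lemma suslinE:
  assumes "suslin M C"
  obtains R and N :: "nat \<Rightarrow> nat" where "\<And>k s. R k s \<in> closed_rectangles M"
    and "\<And>k s s'. (\<forall>i<N k. s i = s' i) \<Longrightarrow> R k s = R k s'"
    and "C = {w. \<exists>s::nat \<Rightarrow> nat. \<forall>k::nat. w \<in> R k s}"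
  using assms unfolding suslin_def by blast

lemma closed_rectanglesI: "A \<in> sets M \<Longrightarrow> closed F \<Longrightarrow> A \<times> F \<in> closed_rectangles M"
  by (auto simp: closed_rectangles_def)

lemma suslin_rectangle:
  assumes "A \<in> sets M" "closed F" shows "suslin M (A \<times> F)"
proof -
  have "(\<forall>(k::nat) s::nat \<Rightarrow> nat. A \<times> F \<in> closed_rectangles M)"
    using assms by (simp add: closed_rectanglesI)
  then show ?thesis
    unfolding suslin_def by (intro exI[of _ "\<lambda>k s. A \<times> F"] exI[of _ "\<lambda>_. 0"]) auto
qed

lemma suslin_sequenceE:
  fixes C :: "nat \<Rightarrow> ('t \<times> 'x::topological_space) set"
  assumes "\<And>i. suslin M (C i)"
  obtains R N where "\<And>i k s. R i k s \<in> closed_rectangles M"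
    and "\<And>i k s s'. (\<forall>j<N i k. s j = s' j) \<Longrightarrow> R i k s = R i k s'"
    and "\<And>i. C i = {w. \<exists>s::nat \<Rightarrow> nat. \<forall>k::nat. w \<in> R i k s}"
proof -
  have "\<forall>i. \<exists>R N. (\<forall>k s. R k s \<in> closed_rectangles M) \<and>
     (\<forall>k s s'. (\<forall>j<N k. s j = s' j) \<longrightarrow> R k s = R k s') \<and>
     C i = {w. \<exists>s::nat \<Rightarrow> nat. \<forall>k::nat. w \<in> R k s}"
    using assms unfolding suslin_def by blast
  from choice[OF this] obtain R where "\<forall>i. \<exists>N. (\<forall>k s. R i k s \<in> closed_rectangles M) \<and>
     (\<forall>k s s'. (\<forall>j<N k. s j = s' j) \<longrightarrow> R i k s = R i k s') \<and>
     C i = {w. \<exists>s::nat \<Rightarrow> nat. \<forall>k::nat. w \<in> R i k s}" by blast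
  from choice[OF this] obtain N where "\<forall>i. (\<forall>k s. R i k s \<in> closed_rectangles M) \<and>
     (\<forall>k s s'. (\<forall>j<N i k. s j = s' j) \<longrightarrow> R i k s = R i k s') \<and>
     C i = {w. \<exists>s::nat \<Rightarrow> nat. \<forall>k::nat. w \<in> R i k s}" by blast
  then show thesis by (intro that[of R N]) blast+
qed

lemma suslin_INT:
  fixes C :: "nat \<Rightarrow> ('t \<times> 'x::topological_space) set"
  assumes "\<And>i. suslin M (C i)"
  shows "suslin M (\<Inter>i. C i)"
proof -
  obtain R N where R: "\<And>i k s. R i k s \<in> closed_rectangles M"
    and N: "\<And>i k s s'. (\<forall>j<N i k. s j = s' j) \<Longrightarrow> R i k s = R i k s'"
    and C: "\<And>i. C i = {w. \<exists>s::nat \<Rightarrow> nat. \<forall>k::nat. w \<in> R i k s}"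
    using suslin_sequenceE[of M C, OF assms] by blast
  \<comment> \<open>One sequence codes one witness per set: coordinate \<open>j\<close> of the \<open>i\<close>-th witness sits at
    position \<open>prod_encode (i, j)\<close>.\<close>
  define R' where "R' n s = R (fst (prod_decode n)) (snd (prod_decode n))
      (\<lambda>j. s (prod_encode (fst (prod_decode n), j)))" for n and s :: "nat \<Rightarrow> nat"
  define N' where "N' n = Suc (\<Sum>j<N (fst (prod_decode n)) (snd (prod_decode n)).
      prod_encode (fst (prod_decode n), j))" for n
  have dep: "R' n s = R' n s'" if "\<forall>i<N' n. s i = s' i" for n s s'
    unfolding R'_def
  proof (rule N, intro allI impI)
    fix j assume j: "j < N (fst (prod_decode n)) (snd (prod_decode n))"
    have "prod_encode (fst (prod_decode n), j) < N' n"
      unfolding N'_def less_Suc_eq_le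
      by (rule member_le_sum[where f="\<lambda>j. prod_encode (fst (prod_decode n), j)"]) (use j in auto)
    then show "s (prod_encode (fst (prod_decode n), j)) = s' (prod_encode (fst (prod_decode n), j))"
      using that by blast
  qed
  have "(\<Inter>i. C i) = {w. \<exists>s. \<forall>k. w \<in> R' k s}"
  proof (intro equalityI subsetI)
    fix w assume "w \<in> (\<Inter>i. C i)"
    then have "\<forall>i. \<exists>s. \<forall>k. w \<in> R i k s" by (auto simp: C)
    then obtain s where s: "\<And>i k. w \<in> R i k (s i)" by metis
    have "w \<in> R' n (\<lambda>m. s (fst (prod_decode m)) (snd (prod_decode m)))" for n
      using s by (simp add: R'_def)
    then show "w \<in> {w. \<exists>s. \<forall>k. w \<in> R' k s}" by blast
  next
    fix w assume "w \<in> {w. \<exists>s. \<forall>k. w \<in> R' k s}"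
    then obtain s where s: "\<And>n. w \<in> R' n s" by blast
    have "w \<in> R i k (\<lambda>j. s (prod_encode (i, j)))" for i k
      using s[of "prod_encode (i, k)"] by (simp add: R'_def)
    then show "w \<in> (\<Inter>i. C i)" by (auto simp: C)
  qed
  moreover have "\<forall>k s. R' k s \<in> closed_rectangles M" by (simp add: R'_def R)
  ultimately show ?thesis unfolding suslin_def using dep by blast
qed

lemma suslin_UN:
  fixes C :: "nat \<Rightarrow> ('t \<times> 'x::topological_space) set"
  assumes "\<And>i. suslin M (C i)"
  shows "suslin M (\<Union>i. C i)"
proof -
  obtain R N where R: "\<And>i k s. R i k s \<in> closed_rectangles M"
    and N: "\<And>i k s s'. (\<forall>j<N i k. s j = s' j) \<Longrightarrow> R i k s = R i k s'"
    and C: "\<And>i. C i = {w. \<exists>s::nat \<Rightarrow> nat. \<forall>k::nat. w \<in> R i k s}"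
    using suslin_sequenceE[of M C, OF assms] by blast
  \<comment> \<open>The first coordinate names the set. Testing it anew in each condition keeps the number of
    relevant coordinates of a condition independent of that name.\<close>
  define R' where "R' n s = (if s 0 = fst (prod_decode n)
      then R (fst (prod_decode n)) (snd (prod_decode n)) (\<lambda>j. s (Suc j))
      else space M \<times> UNIV)" for n and s :: "nat \<Rightarrow> nat"
  define N' where "N' n = Suc (N (fst (prod_decode n)) (snd (prod_decode n)))" for n
  have dep: "R' n s = R' n s'" if *: "\<forall>i<N' n. s i = s' i" for n s s'
  proof -
    have "s 0 = s' 0" using * by (auto simp: N'_def)
    moreover have "R (fst (prod_decode n)) (snd (prod_decode n)) (\<lambda>j. s (Suc j))
        = R (fst (prod_decode n)) (snd (prod_decode n)) (\<lambda>j. s' (Suc j))"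
      by (rule N) (use * in \<open>auto simp: N'_def\<close>)
    ultimately show ?thesis by (simp add: R'_def)
  qed
  have sub: "R i k s \<subseteq> space M \<times> UNIV" for i k s
  proof -
    obtain A F where "R i k s = A \<times> F" "A \<in> sets M"
      using R[of i k s] unfolding closed_rectangles_def by blast
    then show ?thesis using sets.sets_into_space[of A M] by auto
  qed
  have "(\<Union>i. C i) = {w. \<exists>s. \<forall>k. w \<in> R' k s}"
  proof (intro equalityI subsetI)
    fix w assume "w \<in> (\<Union>i. C i)"
    then obtain i s where s: "\<And>k. w \<in> R i k s" by (auto simp: C)
    have "w \<in> space M \<times> UNIV" using sub s by blast
    then have "w \<in> R' n (case_nat i s)" for n
      using s[of "snd (prod_decode n)"] by (auto simp: R'_def)
    then show "w \<in> {w. \<exists>s. \<forall>k. w \<in> R' k s}" by blast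
  next
    fix w assume "w \<in> {w. \<exists>s. \<forall>k. w \<in> R' k s}"
    then obtain s where s: "\<And>n. w \<in> R' n s" by blast
    have "w \<in> R (s 0) k (\<lambda>j. s (Suc j))" for k
      using s[of "prod_encode (s 0, k)"] by (simp add: R'_def)
    then show "w \<in> (\<Union>i. C i)" by (auto simp: C)
  qed
  moreover have "\<forall>k s. R' k s \<in> closed_rectangles M"
    by (simp add: R'_def R closed_rectanglesI)
  ultimately show ?thesis unfolding suslin_def using dep by blast
qed

lemma suslin_Un:
  assumes "suslin M A" "suslin M B" shows "suslin M (A \<union> B)"
proof -
  have "A \<union> B = (\<Union>i::nat. if i = 0 then A else B)" by (auto split: if_splits)
  then show ?thesis using suslin_UN[of M "\<lambda>i. if i = (0::nat) then A else B"] assms by simp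
qed

lemma suslin_Int:
  assumes "suslin M A" "suslin M B" shows "suslin M (A \<inter> B)"
proof -
  have "A \<inter> B = (\<Inter>i::nat. if i = 0 then A else B)" by (auto split: if_splits)
  then show ?thesis using suslin_INT[of M "\<lambda>i. if i = (0::nat) then A else B"] assms by simp
qed

text \<open>Suslin sets are not closed under complements, but the sets that are Suslin together with their
  complement form a sigma-algebra. It contains the rectangles because an open subset of a Euclidean
  space is a countable union of closed boxes.\<close>

lemma suslin_if_measurable:
  fixes C :: "('t \<times> 'x::euclidean_space) set"
  assumes "C \<in> sets (M \<Otimes>\<^sub>M borel)"
  shows "suslin M C"
proof -
  define S :: "('t \<times> 'x) set set"
    where "S = {C. C \<subseteq> space M \<times> UNIV \<and> suslin M C \<and> suslin M (space M \<times> UNIV - C)}"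
  have SI: "C \<in> S" if "C \<subseteq> space M \<times> UNIV" "suslin M C" "suslin M (space M \<times> UNIV - C)" for C
    using that by (simp add: S_def)
  have S1: "C \<subseteq> space M \<times> UNIV" "suslin M C" "suslin M (space M \<times> UNIV - C)" if "C \<in> S" for C
    using that by (simp_all add: S_def)
  have full: "suslin M (space M \<times> (UNIV :: 'x set))" and none: "suslin M ({} :: ('t \<times> 'x) set)"
    using suslin_rectangle[of "space M" M "UNIV :: 'x set"] suslin_rectangle[of "{}" M "UNIV :: 'x set"] by auto
  have S_empty: "{} \<in> S" by (rule SI) (auto simp: full none)
  have S_compl: "space M \<times> UNIV - C \<in> S" if "C \<in> S" for C
    by (rule SI) (use S1[OF that] in \<open>auto simp: double_diff\<close>)
  have S_UN: "(\<Union>i. C i) \<in> S" if "\<And>i::nat. C i \<in> S" for C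
  proof (rule SI)
    have "space M \<times> UNIV - (\<Union>i. C i) = (\<Inter>i. space M \<times> UNIV - C i)" by auto
    then show "suslin M (space M \<times> UNIV - (\<Union>i. C i))"
      using suslin_INT[of M "\<lambda>i. space M \<times> UNIV - C i"] S1(3)[OF that] by simp
  qed (use S1[OF that] in \<open>auto intro!: suslin_UN\<close>)
  have S_Int: "C \<inter> D \<in> S" if "C \<in> S" "D \<in> S" for C D
  proof (rule SI)
    have "space M \<times> UNIV - C \<inter> D = (space M \<times> UNIV - C) \<union> (space M \<times> UNIV - D)" by auto
    then show "suslin M (space M \<times> UNIV - C \<inter> D)"
      using suslin_Un[of M] S1(3)[OF that(1)] S1(3)[OF that(2)] by simp
  qed (use S1[OF that(1)] S1[OF that(2)] in \<open>auto intro!: suslin_Int\<close>)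
  have cl: "space M \<times> F \<in> S" if "closed F" for F :: "'x set"
  proof (rule SI)
    obtain D where D: "countable D" "D \<subseteq> Pow (- F)" "\<And>X. X \<in> D \<Longrightarrow> \<exists>a b. X = cbox a b" "\<Union> D = - F"
      using open_countable_Union_open_cbox[of "- F"] \<open>closed F\<close> by (metis open_Compl)
    define E where "E = from_nat_into (insert {} D)"
    have rE: "range E = insert {} D" unfolding E_def using D(1) by (intro range_from_nat_into) auto
    have "space M \<times> UNIV - space M \<times> F = space M \<times> (\<Union>(range E))" unfolding rE using D(4) by auto
    also have "\<dots> = (\<Union>i. space M \<times> E i)" by auto
    finally have *: "space M \<times> UNIV - space M \<times> F = (\<Union>i. space M \<times> E i)" .
    have "closed (E i)" for i
    proof -
      have "E i \<in> insert {} D" using rE by blast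
      then show ?thesis using D(3)[of "E i"] closed_cbox by (metis closed_empty insertE)
    qed
    then show "suslin M (space M \<times> UNIV - space M \<times> F)"
      unfolding * by (intro suslin_UN suslin_rectangle) auto
  qed (use that in \<open>auto intro: suslin_rectangle\<close>)
  have bor: "space M \<times> B \<in> S" if "B \<in> sets borel" for B :: "'x set"
  proof -
    have "B \<in> sigma_sets UNIV (Collect closed)" using that by (simp add: borel_eq_closed)
    then show ?thesis
    proof (induction rule: sigma_sets.induct)
      case (Compl a)
      have "space M \<times> (UNIV - a) = space M \<times> UNIV - space M \<times> a" by auto
      then show ?case using S_compl[OF Compl.IH] by simp
    next
      case (Union a)
      have "space M \<times> \<Union> (range a) = (\<Union>i. space M \<times> a i)" by auto
      then show ?case using S_UN[of "\<lambda>i. space M \<times> a i"] Union.IH by simp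
    qed (auto simp: cl S_empty)
  qed
  have "C \<in> sigma_sets (space M \<times> space borel) {a \<times> b |a b. a \<in> sets M \<and> b \<in> sets (borel :: 'x measure)}"
    using assms by (simp add: sets_pair_measure)
  then have "C \<in> S"
  proof (induction rule: sigma_sets.induct)
    case (Basic c)
    then obtain a b where c: "c = a \<times> b" "a \<in> sets M" "b \<in> sets (borel :: 'x measure)" by auto
    have "a \<times> UNIV \<in> S"
    proof (rule SI)
      have "space M \<times> UNIV - a \<times> (UNIV :: 'x set) = (space M - a) \<times> UNIV" by auto
      then show "suslin M (space M \<times> UNIV - a \<times> (UNIV :: 'x set))"
        using suslin_rectangle[of "space M - a" M "UNIV :: 'x set"] c by simp
    qed (use c sets.sets_into_space in \<open>auto intro: suslin_rectangle\<close>)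
    from S_Int[OF this bor[OF c(3)]] have "a \<times> UNIV \<inter> space M \<times> b \<in> S" .
    moreover have "a \<times> UNIV \<inter> space M \<times> b = c" using c sets.sets_into_space[OF c(2)] by auto
    ultimately show ?case by simp
  qed (auto simp: S_empty S_compl S_UN)
  then show ?thesis by (rule S1)
qed

text \<open>Dependent choice for sequences that are built coordinate by coordinate. It serves both to choose
  the bounds \<open>\<tau>\<close> and to follow a branch of a tree in the next proof.\<close>

lemma prefix_choice:
  fixes Q :: "(nat \<Rightarrow> nat) \<Rightarrow> nat \<Rightarrow> bool"
  assumes base: "Q s0 0"
    and step: "\<And>s n. Q s n \<Longrightarrow> \<exists>m. Q (s(n := m)) (Suc n)"
    and prefix: "\<And>s s' n. Q s n \<Longrightarrow> (\<forall>i<n. s i = s' i) \<Longrightarrow> Q s' n"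
  obtains s where "\<And>n. Q s n"
proof -
  have "\<exists>T. \<forall>n. Q (T n) n \<and> (\<exists>m. T (Suc n) = (T n)(n := m))"
    by (rule dependent_nat_choice) (use base step in blast)+
  then obtain T where T: "\<And>n. Q (T n) n" "\<And>n. \<exists>m. T (Suc n) = (T n)(n := m)" by blast
  have agree: "\<forall>i<n. T n i = T (Suc i) i" for n
  proof (induction n)
    case (Suc n)
    obtain m where m: "T (Suc n) = (T n)(n := m)" using T(2) by blast
    show ?case
    proof (intro allI impI)
      fix i assume "i < Suc n"
      then show "T (Suc n) i = T (Suc i) i"
        using Suc m by (cases "i = n") auto
    qed
  qed simp
  show thesis
    by (rule that[of "\<lambda>i. T (Suc i) i"]) (rule prefix[OF T(1) agree])
qed

text \<open>Choquet's capacitability argument. Because the outer measure is continuous along increasing unions,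
  the coordinates of the branches can be bounded one after the other by some \<open>\<tau>\<close> while the projection
  keeps an outer measure above \<open>a\<close>. Below \<open>\<tau>\<close> the first \<open>n\<close> coordinates take finitely many values, so
  the points that pass the first conditions project to a measurable set \<open>D n\<close>. The sets \<open>D n\<close> decrease,
  and compactness (of \<open>K\<close> and of the set of branches below \<open>\<tau>\<close>) puts their intersection into the
  projection.\<close>

lemma suslin_inner_approximation:
  fixes C :: "('t \<times> 'x::euclidean_space) set"
  assumes fin: "finite_measure M" and C: "suslin M C" and K: "compact K"
    and a: "a < outer_measure_of M (fst ` (C \<inter> UNIV \<times> K))"
  shows "\<exists>D\<in>sets M. D \<subseteq> fst ` (C \<inter> UNIV \<times> K) \<and> a \<le> emeasure M D"
proof -
  interpret finite_measure M by fact
  obtain R and N :: "nat \<Rightarrow> nat" where R: "\<And>k s. R k s \<in> closed_rectangles M"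
    and N: "\<And>k s s'. (\<forall>i<N k. s i = s' i) \<Longrightarrow> R k s = R k s'"
    and Ceq: "C = {w. \<exists>s::nat \<Rightarrow> nat. \<forall>k::nat. w \<in> R k s}"
    using suslinE[OF C] by blast
  have "\<forall>k. \<forall>s. \<exists>A F. R k s = A \<times> F \<and> A \<in> sets M \<and> closed F"
    using R unfolding closed_rectangles_def by blast
  then obtain A F where RAF: "\<And>k s. R k s = A k s \<times> F k s"
    and A: "\<And>k s. A k s \<in> sets M" and F: "\<And>k s. closed (F k s)"
    by metis
  have Asp: "A k s \<subseteq> space M" for k s using A sets.sets_into_space by blast
  define P where "P \<tau> n = {t. \<exists>x\<in>K. \<exists>s. (\<forall>i<n. s i \<le> \<tau> i) \<and> (\<forall>k. (t, x) \<in> R k s)}"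
    for \<tau> :: "nat \<Rightarrow> nat" and n
  have Psp: "P \<tau> n \<subseteq> space M" for \<tau> n
  proof
    fix t assume "t \<in> P \<tau> n"
    then obtain x s where "\<forall>k. (t, x) \<in> R k s" unfolding P_def by blast
    then have "(t, x) \<in> R 0 s" by blast
    then show "t \<in> space M" using Asp[of 0 s] by (auto simp: RAF)
  qed
  have P0: "P \<tau> 0 = fst ` (C \<inter> UNIV \<times> K)" for \<tau>
    by (force simp: P_def Ceq image_iff)
  have step: "\<exists>m. a < outer_measure_of M (P (\<tau>(n := m)) (Suc n))"
    if "a < outer_measure_of M (P \<tau> n)" for \<tau> n
  proof -
    have "P \<tau> n = (\<Union>m. P (\<tau>(n := m)) (Suc n))"
    proof (intro equalityI subsetI)
      fix t assume "t \<in> P \<tau> n"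
      then obtain x s where "x \<in> K" "\<forall>i<n. s i \<le> \<tau> i" "\<forall>k. (t, x) \<in> R k s"
        unfolding P_def by blast
      then have "t \<in> P (\<tau>(n := s n)) (Suc n)"
        unfolding P_def by (auto simp: less_Suc_eq intro!: bexI[of _ x] exI[of _ s])
      then show "t \<in> (\<Union>m. P (\<tau>(n := m)) (Suc n))" by blast
    next
      fix t assume "t \<in> (\<Union>m. P (\<tau>(n := m)) (Suc n))"
      then obtain m x s where *: "x \<in> K" "\<forall>i<Suc n. s i \<le> (\<tau>(n := m)) i" "\<forall>k. (t, x) \<in> R k s"
        unfolding P_def by blast
      have "\<forall>i<n. s i \<le> \<tau> i"
      proof (intro allI impI)
        fix i assume "i < n" then show "s i \<le> \<tau> i" using *(2)[rule_format, of i] by simp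
      qed
      then show "t \<in> P \<tau> n" unfolding P_def using * by blast
    qed
    moreover have "incseq (\<lambda>m. P (\<tau>(n := m)) (Suc n))"
    proof (rule incseq_SucI, rule subsetI)
      fix m t assume "t \<in> P (\<tau>(n := m)) (Suc n)"
      then obtain x s where *: "x \<in> K" "\<forall>i<Suc n. s i \<le> (\<tau>(n := m)) i" "\<forall>k. (t, x) \<in> R k s"
        unfolding P_def by blast
      have "\<forall>i<Suc n. s i \<le> (\<tau>(n := Suc m)) i"
      proof (intro allI impI)
        fix i assume "i < Suc n"
        then show "s i \<le> (\<tau>(n := Suc m)) i" using *(2)[rule_format, of i] by (cases "i = n") auto
      qed
      then show "t \<in> P (\<tau>(n := Suc m)) (Suc n)" unfolding P_def using * by blast
    qed
    ultimately have "(SUP m. outer_measure_of M (P (\<tau>(n := m)) (Suc n))) = outer_measure_of M (P \<tau> n)"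
      using SUP_outer_measure_of_incseq[of "\<lambda>m. P (\<tau>(n := m)) (Suc n)" M] Psp by simp
    with that have "a < (SUP m. outer_measure_of M (P (\<tau>(n := m)) (Suc n)))" by simp
    then show ?thesis unfolding less_SUP_iff by blast
  qed
  \<comment> \<open>Continuity of the outer measure from below bounds the coordinates one after the other.\<close>
  obtain \<tau> where \<tau>: "\<And>n. a < outer_measure_of M (P \<tau> n)"
  proof (rule prefix_choice[of "\<lambda>\<tau> n. a < outer_measure_of M (P \<tau> n)" "\<lambda>_. 0"])
    show "a < outer_measure_of M (P (\<lambda>_. 0) 0)" using a by (simp add: P0)
    show "a < outer_measure_of M (P s' n)" if "a < outer_measure_of M (P s n)" "\<forall>i<n. s i = s' i" for s s' n
      using that by (simp add: P_def)
  qed (use step in auto)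
  define I where "I n = {k. k < n \<and> N k \<le> n}" for n
  define S where "S n = {s. \<forall>i. (i \<in> {..<n} \<longrightarrow> s i \<in> {..\<tau> i}) \<and> (i \<notin> {..<n} \<longrightarrow> s i = (0::nat))}" for n
  have "finite (S n)" for n
  proof (rule finite_subset)
    show "S n \<subseteq> {s. \<forall>i. (i \<in> {..<n} \<longrightarrow> s i \<in> {..\<Sum>i<n. \<tau> i}) \<and> (i \<notin> {..<n} \<longrightarrow> s i = 0)}"
    proof
      fix s assume s: "s \<in> S n"
      have "s i \<le> (\<Sum>i<n. \<tau> i)" if "i < n" for i
      proof -
        have "s i \<le> \<tau> i" using s that by (simp add: S_def)
        also have "\<dots> \<le> (\<Sum>i<n. \<tau> i)" using that by (intro member_le_sum) auto
        finally show ?thesis .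
      qed
      then show "s \<in> {s. \<forall>i. (i \<in> {..<n} \<longrightarrow> s i \<in> {..\<Sum>i<n. \<tau> i}) \<and> (i \<notin> {..<n} \<longrightarrow> s i = 0)}"
        using s by (simp add: S_def)
    qed
    show "finite {s. \<forall>i. (i \<in> {..<n} \<longrightarrow> s i \<in> {..\<Sum>i<n. \<tau> i}) \<and> (i \<notin> {..<n} \<longrightarrow> s i = 0)}"
      by (rule finite_set_of_finite_funs) auto
  qed
  note finS = this
  \<comment> \<open>Cutting the branches off after \<open>n\<close> coordinates leaves finitely many of them to unite over.\<close>
  define D where "D n = (\<Union>s\<in>S n. {t\<in>space M. \<exists>x\<in>K. \<forall>k\<in>I n. (t, x) \<in> R k s})" for n
  have Dsets: "D n \<in> sets M" for n
    unfolding D_def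
  proof (intro sets.finite_UN finS)
    fix s
    have "{t\<in>space M. \<exists>x\<in>K. \<forall>k\<in>I n. (t, x) \<in> R k s}
        = (if \<exists>x\<in>K. \<forall>k\<in>I n. x \<in> F k s then {t\<in>space M. \<forall>k\<in>I n. t \<in> A k s} else {})"
      by (auto simp: RAF)
    moreover have "{t\<in>space M. \<forall>k\<in>I n. t \<in> A k s} \<in> sets M"
    proof (rule sets.sets_Collect_finite_All)
      show "{t \<in> space M. t \<in> A k s} \<in> sets M" for k
        using A[of k s] Asp[of k s] by (simp add: Int_absorb1 Collect_conj_eq Int_commute inf.absorb_iff2)
    qed (simp add: I_def)
    ultimately show "{t\<in>space M. \<exists>x\<in>K. \<forall>k\<in>I n. (t, x) \<in> R k s} \<in> sets M" by simp
  qed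
  have DI: "t \<in> D n" if "t \<in> space M" "x \<in> K" "\<forall>i<n. s i \<le> \<tau> i" "\<forall>k\<in>I n. (t, x) \<in> R k s" for t x s n
  proof -
    define s' where "s' i = (if i < n then s i else 0)" for i
    have "s' \<in> S n" using that by (auto simp: S_def s'_def)
    moreover have "R k s' = R k s" if "k \<in> I n" for k
      by (rule N) (use that in \<open>auto simp: I_def s'_def\<close>)
    ultimately have "\<exists>x\<in>K. \<forall>k\<in>I n. (t, x) \<in> R k s'" "s' \<in> S n" using that by auto
    then show ?thesis unfolding D_def using that(1) by blast
  qed
  have DE: "\<exists>x\<in>K. \<exists>s. (\<forall>i<n. s i \<le> \<tau> i) \<and> (\<forall>k\<in>I n. (t, x) \<in> R k s)" if t: "t \<in> D n" for t n
  proof -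
    obtain s x where "s \<in> S n" "x \<in> K" "\<forall>k\<in>I n. (t, x) \<in> R k s" using t unfolding D_def by blast
    moreover from this have "\<forall>i<n. s i \<le> \<tau> i" by (simp add: S_def)
    ultimately show ?thesis by blast
  qed
  have Dsp: "D n \<subseteq> space M" for n unfolding D_def by auto
  have PD: "P \<tau> n \<subseteq> D n" for n
  proof
    fix t assume t: "t \<in> P \<tau> n"
    then obtain x s where "x \<in> K" "\<forall>i<n. s i \<le> \<tau> i" "\<forall>k. (t, x) \<in> R k s" unfolding P_def by blast
    then show "t \<in> D n" using Psp[of \<tau> n] t by (intro DI) auto
  qed
  have Imono: "I m \<subseteq> I n" if "m \<le> n" for m n using that by (auto simp: I_def)
  have "decseq D"
  proof (rule decseq_SucI, rule subsetI)
    fix n t assume t: "t \<in> D (Suc n)"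
    then obtain x s where *: "x \<in> K" "\<forall>i<Suc n. s i \<le> \<tau> i" "\<forall>k\<in>I (Suc n). (t, x) \<in> R k s"
      using DE by blast
    then show "t \<in> D n" using Imono[of n "Suc n"] subsetD[OF Dsp t] by (intro DI[of _ x _ s]) auto
  qed
  then have "(INF n. emeasure M (D n)) = emeasure M (\<Inter>n. D n)"
    using Dsets by (intro INF_emeasure_decseq) (auto simp: top_unique)
  moreover have "a \<le> emeasure M (D n)" for n
    using \<tau>[of n] outer_measure_of_mono[OF PD[of n], of M] Dsets[of n] by simp
  ultimately have "a \<le> emeasure M (\<Inter>n. D n)" by (metis INF_greatest)
  moreover have "(\<Inter>n. D n) \<in> sets M" using Dsets by auto
  moreover have "(\<Inter>n. D n) \<subseteq> fst ` (C \<inter> UNIV \<times> K)"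
  proof
    fix t assume t: "t \<in> (\<Inter>n. D n)"
    define good where "good \<rho> j \<longleftrightarrow> (\<forall>n. \<exists>x\<in>K. \<exists>s. (\<forall>i<j. s i = \<rho> i) \<and> (\<forall>i<n. s i \<le> \<tau> i) \<and> (\<forall>k\<in>I n. (t, x) \<in> R k s))"
      for \<rho> :: "nat \<Rightarrow> nat" and j
    \<comment> \<open>A branch through the finitely branching tree of the prefixes that occur for every \<open>n\<close>.\<close>
    obtain \<rho> where \<rho>: "\<And>j. good \<rho> j"
    proof (rule prefix_choice[of good "\<lambda>_. 0"])
      show "good (\<lambda>_. 0) 0" using t DE unfolding good_def by auto
      show "good s' n" if "good s n" "\<forall>i<n. s i = s' i" for s s' n
        using that by (simp add: good_def)
      show "\<exists>m. good (\<rho>(j := m)) (Suc j)" if good: "good \<rho> j" for \<rho> j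
      proof (rule ccontr)
        assume "\<not> (\<exists>m. good (\<rho>(j := m)) (Suc j))"
        then have "\<forall>m. \<exists>n. \<not> (\<exists>x\<in>K. \<exists>s. (\<forall>i<Suc j. s i = (\<rho>(j := m)) i) \<and> (\<forall>i<n. s i \<le> \<tau> i) \<and> (\<forall>k\<in>I n. (t, x) \<in> R k s))"
          unfolding good_def by blast
        from choice[OF this] obtain n where
          n: "\<And>m. \<not> (\<exists>x\<in>K. \<exists>s. (\<forall>i<Suc j. s i = (\<rho>(j := m)) i) \<and> (\<forall>i<n m. s i \<le> \<tau> i) \<and> (\<forall>k\<in>I (n m). (t, x) \<in> R k s))"
          by blast
        define n' where "n' = Suc j + (\<Sum>m\<le>\<tau> j. n m)"
        obtain x s where *: "x \<in> K" "\<forall>i<j. s i = \<rho> i" "\<forall>i<n'. s i \<le> \<tau> i" "\<forall>k\<in>I n'. (t, x) \<in> R k s"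
          using good unfolding good_def by blast
        have "s j \<le> \<tau> j" using *(3) by (simp add: n'_def)
        then have le: "n (s j) \<le> n'"
          using member_le_sum[of "s j" "{..\<tau> j}" n] by (simp add: n'_def)
        have "\<forall>i<Suc j. s i = (\<rho>(j := s j)) i" using *(2) by (simp add: less_Suc_eq)
        moreover have "\<forall>i<n (s j). s i \<le> \<tau> i" using *(3) le by simp
        moreover have "\<forall>k\<in>I (n (s j)). (t, x) \<in> R k s" using *(4) Imono[OF le] by blast
        ultimately show False using n[of "s j"] *(1) by blast
      qed
    qed blast
    define Z where "Z n = {x\<in>K. \<forall>k\<in>I n. (t, x) \<in> R k \<rho>}" for n
    have Zne: "Z n \<noteq> {}" for n
    proof -
      obtain x s where *: "x \<in> K" "\<forall>i<n. s i = \<rho> i" "\<forall>k\<in>I n. (t, x) \<in> R k s"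
        using \<rho>[of n] unfolding good_def by blast
      have "R k s = R k \<rho>" if "k \<in> I n" for k
        by (rule N) (use that *(2) in \<open>auto simp: I_def\<close>)
      then show ?thesis using * unfolding Z_def by blast
    qed
    have Zc: "compact (Z n)" for n
    proof -
      have "closed {x. (t, x) \<in> R k \<rho>}" for k
        using F[of k \<rho>] by (cases "t \<in> A k \<rho>") (auto simp: RAF)
      then have "closed (\<Inter>k\<in>I n. {x. (t, x) \<in> R k \<rho>})" by (intro closed_INT) auto
      moreover have "Z n = K \<inter> (\<Inter>k\<in>I n. {x. (t, x) \<in> R k \<rho>})" by (auto simp: Z_def)
      ultimately show ?thesis using K compact_Int_closed by metis
    qed
    have "\<Inter>(range Z) \<noteq> {}"
    proof (rule compact_nest)
      show "compact (Z n)" "Z n \<noteq> {}" for n using Zne Zc by auto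
      show "Z n \<subseteq> Z m" if "m \<le> n" for m n using Imono[OF that] by (auto simp: Z_def)
    qed
    then obtain x where x: "\<And>n. x \<in> Z n" by blast
    have "(t, x) \<in> R k \<rho>" for k
    proof -
      have "k \<in> I (Suc (max k (N k)))" unfolding I_def by simp linarith
      then show ?thesis using x[of "Suc (max k (N k))"] unfolding Z_def by blast
    qed
    moreover have "x \<in> K" using x[of 0] by (simp add: Z_def)
    ultimately have "(t, x) \<in> C \<inter> UNIV \<times> K" by (auto simp: Ceq)
    then show "t \<in> fst ` (C \<inter> UNIV \<times> K)" by force
  qed
  ultimately show ?thesis by blast
qed

text \<open>Countably many inner approximations exhaust the outer measure, so the set differs from their union
  by a subset of a null set, which completeness makes measurable.\<close>

lemma sets_if_inner_approximation:
  assumes "complete_measure M" and fin: "finite_measure M" and P: "P \<subseteq> space M"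
    and inner: "\<And>a. a < outer_measure_of M P \<Longrightarrow> \<exists>D\<in>sets M. D \<subseteq> P \<and> a \<le> emeasure M D"
  shows "P \<in> sets M"
proof -
  interpret complete_measure M by fact
  interpret finite_measure M by fact
  obtain E where E: "E \<in> sets M" "P \<subseteq> E" "outer_measure_of M P = emeasure M E"
    using outer_measure_of_attain[OF P] by blast
  define \<D> where "\<D> = {D\<in>sets M. D \<subseteq> P}"
  have "{} \<in> \<D>" by (simp add: \<D>_def)
  then obtain f where f: "range f \<subseteq> emeasure M ` \<D>" "(SUP D\<in>\<D>. emeasure M D) = (SUP n::nat. f n)"
    using ennreal_Sup_countable_SUP[of "emeasure M ` \<D>"] by blast
  then have "\<forall>n. \<exists>D. D \<in> \<D> \<and> f n = emeasure M D" by blast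
  then obtain D where D: "\<And>n. D n \<in> \<D>" "\<And>n. f n = emeasure M (D n)" by metis
  have U: "(\<Union>n. D n) \<in> sets M" "(\<Union>n. D n) \<subseteq> P" using D(1) by (auto simp: \<D>_def)
  have "emeasure M E \<le> (SUP D\<in>\<D>. emeasure M D)"
  proof (rule ccontr)
    assume "\<not> ?thesis"
    then obtain a where a: "(SUP D\<in>\<D>. emeasure M D) < a" "a < emeasure M E"
      by (meson dense not_le)
    then obtain D where "D \<in> \<D>" "a \<le> emeasure M D"
      using inner[of a] by (auto simp: E(3) \<D>_def)
    then have "a \<le> (SUP D\<in>\<D>. emeasure M D)" by (rule SUP_upper2)
    then show False using a by simp
  qed
  also have "\<dots> \<le> emeasure M (\<Union>n. D n)"
    unfolding f(2) D(2) using U(1) by (intro SUP_least emeasure_mono) auto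
  finally have "emeasure M (E - (\<Union>n. D n)) = 0"
    using E U by (subst emeasure_Diff) (auto simp: diff_eq_0_iff_ennreal top.not_eq_extremum less_top[symmetric])
  then have "E - (\<Union>n. D n) \<in> null_sets M" using E U by auto
  then have "P - (\<Union>n. D n) \<in> sets M"
    using E(2) by (intro complete[of _ "E - (\<Union>n. D n)"]) auto
  then have "(P - (\<Union>n. D n)) \<union> (\<Union>n. D n) \<in> sets M" using U by blast
  moreover have "(P - (\<Union>n. D n)) \<union> (\<Union>n. D n) = P" using U by blast
  ultimately show ?thesis by simp
qed

theorem measurable_projection:
  fixes C :: "('t \<times> 'x::euclidean_space) set"
  assumes "complete_measure M" "finite_measure M" and C: "C \<in> sets (M \<Otimes>\<^sub>M borel)"
  shows "fst ` C \<in> sets M"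
proof -
  have sp: "fst ` C \<subseteq> space M"
    using sets.sets_into_space[OF C] by (auto simp: space_pair_measure)
  have "fst ` (C \<inter> UNIV \<times> cball 0 (real n)) \<in> sets M" for n
  proof (rule sets_if_inner_approximation[OF assms(1,2)])
    show "fst ` (C \<inter> UNIV \<times> cball 0 (real n)) \<subseteq> space M" using sp by auto
  qed (intro suslin_inner_approximation assms suslin_if_measurable[OF C] compact_cball)
  then have "(\<Union>n. fst ` (C \<inter> UNIV \<times> cball 0 (real n))) \<in> sets M" by blast
  moreover have "(\<Union>n. fst ` (C \<inter> UNIV \<times> cball 0 (real n))) = fst ` C"
  proof (intro equalityI subsetI)
    fix t assume "t \<in> fst ` C"
    then obtain x where x: "(t, x) \<in> C" by force
    obtain n where "norm x \<le> real n" using real_arch_simple by blast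
    then have "(t, x) \<in> C \<inter> UNIV \<times> cball 0 (real n)" using x by simp
    then show "t \<in> (\<Union>n. fst ` (C \<inter> UNIV \<times> cball 0 (real n)))" by force
  qed auto
  ultimately show ?thesis by simp
qed

section \<open>Measurable selections\<close>

locale complete_finite_measure = finite_measure M + complete_measure M for M :: "'t measure"

definition measurable_graph :: "'t measure \<Rightarrow> ('t \<Rightarrow> 'x::topological_space set) \<Rightarrow> bool" where
  "measurable_graph M F \<longleftrightarrow> Measurable.pred (M \<Otimes>\<^sub>M borel) (\<lambda>w. snd w \<in> F (fst w))"

lemma measurable_graph_Collect:
  assumes "measurable_graph M F" "Measurable.pred (M \<Otimes>\<^sub>M borel) (\<lambda>w. P (fst w) (snd w))"
  shows "measurable_graph M (\<lambda>t. {x\<in>F t. P t x})"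
  using assms unfolding measurable_graph_def by simp

context complete_finite_measure
begin

lemma pred_Ex_borel:
  fixes Q :: "'t \<Rightarrow> 'x::euclidean_space \<Rightarrow> bool"
  assumes "Measurable.pred (M \<Otimes>\<^sub>M borel) (\<lambda>w. Q (fst w) (snd w))"
  shows "Measurable.pred M (\<lambda>t. \<exists>x. Q t x)"
proof -
  define C where "C = {w \<in> space (M \<Otimes>\<^sub>M (borel :: 'x measure)). Q (fst w) (snd w)}"
  have "C \<in> sets (M \<Otimes>\<^sub>M borel)" using assms by (simp add: C_def pred_def)
  then have "fst ` C \<in> sets M"
    by (rule measurable_projection[OF complete_measure_axioms finite_measure_axioms])
  moreover have "fst ` C = {t\<in>space M. \<exists>x. Q t x}"
    by (force simp: C_def space_pair_measure image_iff)
  ultimately show ?thesis by (simp add: pred_def)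
qed

text \<open>Sublevel sets of a marginal function \<open>\<lambda>t. INF x\<in>F t. \<phi> t x\<close> are projections, hence measurable. So the
  set of minimisers has a measurable graph again, which allows minimisations to be iterated.\<close>

lemma measurable_graph_argmin:
  fixes F :: "'t \<Rightarrow> 'x::euclidean_space set"
  assumes F: "measurable_graph M F"
    and cpt: "\<forall>t\<in>space M. compact (F t) \<and> F t \<noteq> {}"
    and \<phi>: "(\<lambda>w. \<phi> (fst w) (snd w)) \<in> borel_measurable (M \<Otimes>\<^sub>M borel)"
    and cont: "\<forall>t\<in>space M. continuous_on (F t) (\<phi> t)"
  shows borel_measurable_Inf_image: "(\<lambda>t. INF x\<in>F t. (\<phi> t x :: real)) \<in> borel_measurable M"
    and Inf_image_lower: "\<And>t x. t \<in> space M \<Longrightarrow> x \<in> F t \<Longrightarrow> (INF x\<in>F t. \<phi> t x) \<le> \<phi> t x"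
    and measurable_graph_argmin_set: "measurable_graph M (\<lambda>t. {x\<in>F t. \<phi> t x \<le> (INF x\<in>F t. \<phi> t x)})"
    and compact_argmin: "\<And>t. t \<in> space M \<Longrightarrow>
      compact {x\<in>F t. \<phi> t x \<le> (INF x\<in>F t. \<phi> t x)} \<and> {x\<in>F t. \<phi> t x \<le> (INF x\<in>F t. \<phi> t x)} \<noteq> {}"
proof -
  define m where "m t = (INF x\<in>F t. \<phi> t x)" for t
  have att: "\<exists>x\<in>F t. \<phi> t x = m t \<and> (\<forall>y\<in>F t. m t \<le> \<phi> t y)" if t: "t \<in> space M" for t
  proof -
    obtain x where x: "x \<in> F t" "\<And>y. y \<in> F t \<Longrightarrow> \<phi> t x \<le> \<phi> t y"
      using continuous_attains_inf[OF _ _ cont[rule_format, OF t]] cpt t by blast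
    have "m t = \<phi> t x" unfolding m_def by (rule cInf_eq_minimum) (use x in auto)
    then show ?thesis using x by auto
  qed
  show "\<And>t x. t \<in> space M \<Longrightarrow> x \<in> F t \<Longrightarrow> (INF x\<in>F t. \<phi> t x) \<le> \<phi> t x"
    using att unfolding m_def by blast+
  have m: "m \<in> borel_measurable M"
  proof (rule borel_measurable_iff_less[THEN iffD2], intro allI)
    fix a
    note [measurable] = \<phi>
    have "Measurable.pred M (\<lambda>t. \<exists>x. x \<in> F t \<and> \<phi> t x < a)"
      using F \<phi> unfolding measurable_graph_def
      by (intro pred_Ex_borel pred_intros_logic borel_measurable_pred_less borel_measurable_const)
    moreover have "(\<exists>x. x \<in> F t \<and> \<phi> t x < a) \<longleftrightarrow> m t < a" if "t \<in> space M" for t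
      using att[OF that] by (metis le_less_trans)
    ultimately show "{t \<in> space M. m t < a} \<in> sets M"
      by (simp add: pred_def cong: conj_cong)
  qed
  then show "(\<lambda>t. INF x\<in>F t. \<phi> t x) \<in> borel_measurable M" by (simp add: m_def[abs_def])
  show "measurable_graph M (\<lambda>t. {x\<in>F t. \<phi> t x \<le> (INF x\<in>F t. \<phi> t x)})"
    unfolding m_def[symmetric]
    using borel_measurable_le[OF \<phi> measurable_compose[OF measurable_fst m]]
    by (intro measurable_graph_Collect F) (simp add: pred_def)
  fix t assume t: "t \<in> space M"
  have "closed {x\<in>F t. \<phi> t x \<le> m t}"
    using cpt t by (intro continuous_on_closed_Collect_le cont[rule_format, OF t] continuous_on_const)
      (auto intro: compact_imp_closed)
  then have "compact (F t \<inter> {x\<in>F t. \<phi> t x \<le> m t})"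
    using cpt t by (intro compact_Int_closed) auto
  moreover have "F t \<inter> {x\<in>F t. \<phi> t x \<le> m t} = {x\<in>F t. \<phi> t x \<le> m t}" by auto
  ultimately have "compact {x\<in>F t. \<phi> t x \<le> m t}" by simp
  then show "compact {x\<in>F t. \<phi> t x \<le> (INF x\<in>F t. \<phi> t x)} \<and> {x\<in>F t. \<phi> t x \<le> (INF x\<in>F t. \<phi> t x)} \<noteq> {}"
    using att[OF t] unfolding m_def by auto
qed

lemma measurable_selection:
  fixes F :: "'t \<Rightarrow> 'x::euclidean_space set"
  assumes F: "measurable_graph M F" and cpt: "\<And>t. t \<in> space M \<Longrightarrow> compact (F t)"
  shows "\<exists>f\<in>borel_measurable M. \<forall>t\<in>space M. F t \<noteq> {} \<longrightarrow> f t \<in> F t"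
proof -
  define F' where "F' t = (if F t = {} then {0} else F t)" for t
  have "Measurable.pred M (\<lambda>t. \<exists>x. x \<in> F t)"
    using F unfolding measurable_graph_def by (intro pred_Ex_borel) measurable
  then have "Measurable.pred (M \<Otimes>\<^sub>M (borel :: 'x measure)) (\<lambda>w. \<exists>x. x \<in> F (fst w))"
    by measurable
  moreover have "snd w \<in> F' (fst w) \<longleftrightarrow> snd w \<in> F (fst w) \<or> \<not> (\<exists>x. x \<in> F (fst w)) \<and> snd w = 0" for w
    by (auto simp: F'_def)
  moreover have "Measurable.pred (M \<Otimes>\<^sub>M (borel :: 'x measure)) (\<lambda>w. snd w = 0)" by measurable
  moreover note F[unfolded measurable_graph_def]
  ultimately have F': "measurable_graph M F'"
    unfolding measurable_graph_def by (simp only:) (intro pred_intros_logic)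
  have cpt': "compact (F' t) \<and> F' t \<noteq> {}" if "t \<in> space M" for t
    using cpt[OF that] by (simp add: F'_def)
  \<comment> \<open>The lexicographic minimum: every coordinate that is minimised becomes constant on the
    sections that remain.\<close>
  have "\<exists>G. measurable_graph M G \<and> (\<forall>t\<in>space M. compact (G t) \<and> G t \<noteq> {} \<and> G t \<subseteq> F' t \<and>
          (\<forall>b\<in>B. \<forall>x\<in>G t. \<forall>y\<in>G t. x \<bullet> b = y \<bullet> b))" if "finite B" for B
    using that
  proof induction
    case empty
    then show ?case using F' cpt' by (intro exI[of _ F']) auto
  next
    case (insert b B)
    then obtain G where G: "measurable_graph M G" "\<And>t. t \<in> space M \<Longrightarrow> compact (G t) \<and> G t \<noteq> {}"
      "\<And>t. t \<in> space M \<Longrightarrow> G t \<subseteq> F' t" "\<And>t. t \<in> space M \<Longrightarrow> \<forall>b\<in>B. \<forall>x\<in>G t. \<forall>y\<in>G t. x \<bullet> b = y \<bullet> b"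
      by blast
    define H where "H t = {x\<in>G t. x \<bullet> b \<le> (INF x\<in>G t. x \<bullet> b)}" for t
    have \<phi>: "(\<lambda>w. snd w \<bullet> b) \<in> borel_measurable (M \<Otimes>\<^sub>M (borel :: 'x measure))" by measurable
    have cont: "\<forall>t\<in>space M. continuous_on (G t) (\<lambda>x. x \<bullet> b)" by (intro ballI continuous_intros)
    have G2: "\<forall>t\<in>space M. compact (G t) \<and> G t \<noteq> {}" using G(2) by blast
    note min = measurable_graph_argmin[of G "\<lambda>t x. x \<bullet> b", OF G(1) G2 \<phi> cont]
    have "x \<bullet> b = y \<bullet> b" if "t \<in> space M" "x \<in> H t" "y \<in> H t" for t x y
      using min(2)[OF that(1), of x] min(2)[OF that(1), of y] that by (auto simp: H_def)
    moreover have "H t \<subseteq> G t" for t by (auto simp: H_def)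
    moreover have "compact (H t) \<and> H t \<noteq> {}" if "t \<in> space M" for t
      using min(4)[OF that] by (simp add: H_def)
    moreover have "measurable_graph M H" using min(3) by (simp add: H_def[abs_def])
    moreover have "x \<bullet> c = y \<bullet> c" if "t \<in> space M" "x \<in> H t" "y \<in> H t" "c \<in> B" for t x y c
      using G(4)[OF that(1)] that(2-4) by (auto simp: H_def)
    moreover have "x \<bullet> c = y \<bullet> c" if "t \<in> space M" "x \<in> H t" "y \<in> H t" "c \<in> insert b B" for t x y c
      using calculation(1)[OF that(1-3)] calculation(5)[OF that(1-3)] that(4) by blast
    moreover have "H t \<subseteq> F' t" if "t \<in> space M" for t
      using G(3)[OF that] by (auto simp: H_def)
    ultimately show ?case by (intro exI[of _ H] conjI ballI) blast+
  qed
  from this[OF finite_Basis] obtain G where G: "measurable_graph M G"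
    "\<And>t. t \<in> space M \<Longrightarrow> G t \<noteq> {}" "\<And>t. t \<in> space M \<Longrightarrow> G t \<subseteq> F' t"
    "\<And>t. t \<in> space M \<Longrightarrow> \<forall>b\<in>Basis. \<forall>x\<in>G t. \<forall>y\<in>G t. x \<bullet> b = y \<bullet> b" by blast
  define f where "f t = (SOME x. x \<in> G t)" for t
  have f: "f t \<in> G t" if "t \<in> space M" for t
    using G(2)[OF that] unfolding f_def by (simp add: some_in_eq)
  have uniq: "x = f t" if "t \<in> space M" "x \<in> G t" for t x
  proof (rule euclidean_eqI)
    fix b :: 'x assume "b \<in> Basis"
    then show "x \<bullet> b = f t \<bullet> b" using G(4)[OF that(1)] f[OF that(1)] that(2) by metis
  qed
  have "f \<in> borel_measurable M"
  proof (rule borel_measurableI)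
    fix U :: "'x set" assume "open U"
    then have "U \<in> sets borel" by simp
    have "Measurable.pred M (\<lambda>t. \<exists>x. x \<in> G t \<and> x \<in> U)"
      using G(1) pred_sets2[OF \<open>U \<in> sets borel\<close> measurable_snd] unfolding measurable_graph_def
      by (intro pred_Ex_borel pred_intros_logic)
    moreover have "(\<exists>x. x \<in> G t \<and> x \<in> U) \<longleftrightarrow> f t \<in> U" if "t \<in> space M" for t
      using uniq[OF that] f[OF that] by blast
    ultimately have "{t\<in>space M. f t \<in> U} \<in> sets M" by (simp add: pred_def cong: conj_cong)
    then show "f -` U \<inter> space M \<in> sets M" by (simp add: vimage_def Int_def conj_commute)
  qed
  moreover have "f t \<in> F t" if "t \<in> space M" "F t \<noteq> {}" for t
    using f[OF that(1)] G(3)[OF that(1)] that(2) by (auto simp: F'_def)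
  ultimately show ?thesis by blast
qed

end

section \<open>A convexity theorem of Lyapunov type\<close>

definition lower_support :: "'x::euclidean_space set \<Rightarrow> 'x \<Rightarrow> real" where
  "lower_support A p = (INF y\<in>A. p \<bullet> y)"

lemma lower_support_eqI:
  assumes "y \<in> A" "p \<bullet> y = m" "\<And>z. z \<in> A \<Longrightarrow> m \<le> p \<bullet> z"
  shows "lower_support A p = m"
  unfolding lower_support_def by (rule cInf_eq_minimum) (use assms in auto)

lemma lower_support:
  assumes "compact A" "A \<noteq> {}"
  shows lower_support_attained: "\<exists>y\<in>A. p \<bullet> y = lower_support A p"
    and lower_support_le: "y \<in> A \<Longrightarrow> lower_support A p \<le> p \<bullet> y"
proof -
  have "continuous_on A (\<lambda>y. p \<bullet> y)" by (intro continuous_intros)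
  then obtain y where y: "y \<in> A" "\<And>z. z \<in> A \<Longrightarrow> p \<bullet> y \<le> p \<bullet> z"
    using continuous_attains_inf[OF assms] by blast
  then have "lower_support A p = p \<bullet> y" by (intro lower_support_eqI) auto
  then show "\<exists>y\<in>A. p \<bullet> y = lower_support A p" and "y \<in> A \<Longrightarrow> lower_support A p \<le> p \<bullet> y" for y
    using y by auto
qed

lemma lower_support_scaleR:
  assumes "compact A" "A \<noteq> {}" "0 \<le> r"
  shows "lower_support A (r *\<^sub>R p) = r * lower_support A p"
proof -
  obtain y where y: "y \<in> A" "p \<bullet> y = lower_support A p"
    using lower_support_attained[OF assms(1,2)] by blast
  show ?thesis
    by (rule lower_support_eqI[OF y(1)]) (use y assms lower_support_le in \<open>auto intro!: mult_left_mono\<close>)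
qed

lemma lower_support_add_const:
  assumes "compact A" "A \<noteq> {}" "\<And>y. y \<in> A \<Longrightarrow> b \<bullet> y = \<beta>"
  shows "lower_support A (a + b) = lower_support A a + \<beta>"
proof -
  obtain y where y: "y \<in> A" "a \<bullet> y = lower_support A a"
    using lower_support_attained[OF assms(1,2)] by blast
  show ?thesis
    by (rule lower_support_eqI[OF y(1)])
      (use y assms lower_support_le[of A _ a] in \<open>auto simp: inner_add_left\<close>)
qed

lemma lower_support_Lipschitz:
  assumes "compact A" "A \<noteq> {}" "\<And>y. y \<in> A \<Longrightarrow> norm y \<le> R"
  shows "\<bar>lower_support A p - lower_support A q\<bar> \<le> norm (p - q) * R"
proof -
  have le: "lower_support A p - lower_support A q \<le> norm (p - q) * R" for p q
  proof -
    obtain y where y: "y \<in> A" "q \<bullet> y = lower_support A q"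
      using lower_support_attained[OF assms(1,2)] by blast
    have "lower_support A p \<le> p \<bullet> y" using lower_support_le assms y by blast
    then have "lower_support A p - lower_support A q \<le> (p - q) \<bullet> y"
      using y by (simp add: inner_diff_left)
    also have "\<dots> \<le> norm (p - q) * norm y" by (rule norm_cauchy_schwarz)
    also have "\<dots> \<le> norm (p - q) * R" using assms(3)[OF y(1)] by (intro mult_left_mono) auto
    finally show ?thesis .
  qed
  from le[of p q] le[of q p] show ?thesis by (simp add: norm_minus_commute abs_le_iff)
qed

lemma lower_support_bound:
  assumes "compact A" "A \<noteq> {}" "\<And>y. y \<in> A \<Longrightarrow> norm y \<le> R"
  shows "\<bar>lower_support A p\<bar> \<le> norm p * R"
proof -
  have "lower_support A 0 = 0" using lower_support_scaleR[of A 0 0] assms by simp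
  then show ?thesis using lower_support_Lipschitz[OF assms, of p 0] by simp
qed

text \<open>A concave support function has as directional derivative at \<open>p\<close> the support function of the face
  exposed by \<open>p\<close>: minimisers for \<open>p + q / (n + 1)\<close> can only cluster in that face.\<close>

lemma lower_support_directional_derivative:
  assumes A: "compact A" "A \<noteq> {}"
  shows "(\<lambda>n. (lower_support A (p + (1 / Suc n) *\<^sub>R q) - lower_support A p) * Suc n)
           \<longlonglongrightarrow> lower_support {y\<in>A. p \<bullet> y \<le> lower_support A p} q" (is "?r \<longlonglongrightarrow> lower_support ?B q")
proof -
  have "closed {y. p \<bullet> y \<le> lower_support A p}"
    by (intro closed_Collect_le continuous_intros)
  then have B: "compact ?B"
    using compact_Int_closed[OF A(1), of "{y. p \<bullet> y \<le> lower_support A p}"]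
    by (simp add: Int_def)
  have Bne: "?B \<noteq> {}" using lower_support_attained[OF A, of p] by force
  have "\<exists>y\<in>A. (p + (1 / Suc n) *\<^sub>R q) \<bullet> y = lower_support A (p + (1 / Suc n) *\<^sub>R q)" for n
    using lower_support_attained[OF A] by blast
  then obtain y where y: "\<And>n. y n \<in> A"
    and ymin: "\<And>n. (p + (1 / Suc n) *\<^sub>R q) \<bullet> y n = lower_support A (p + (1 / Suc n) *\<^sub>R q)"
    by metis
  have lo: "q \<bullet> y n \<le> ?r n" for n
  proof -
    have "lower_support A p \<le> p \<bullet> y n" using lower_support_le[OF A y] .
    then have "q \<bullet> y n / Suc n \<le> lower_support A (p + (1 / Suc n) *\<^sub>R q) - lower_support A p"
      unfolding ymin[symmetric] by (simp add: inner_add_left)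
    then have "q \<bullet> y n / Suc n * Suc n \<le> ?r n" by (intro mult_right_mono) auto
    then show ?thesis by simp
  qed
  have up: "?r n \<le> lower_support ?B q" for n
  proof -
    obtain z where z: "z \<in> ?B" "q \<bullet> z = lower_support ?B q"
      using lower_support_attained[OF B Bne] by blast
    have "lower_support A (p + (1 / Suc n) *\<^sub>R q) \<le> (p + (1 / Suc n) *\<^sub>R q) \<bullet> z"
      using z by (intro lower_support_le[OF A]) auto
    also have "\<dots> \<le> lower_support A p + q \<bullet> z / Suc n"
      using z(1) by (simp add: inner_add_left)
    finally have "?r n \<le> q \<bullet> z / Suc n * Suc n" by (intro mult_right_mono) auto
    then show ?thesis using z by simp
  qed
  show ?thesis
  proof (rule LIMSEQ_I)
    fix e :: real assume e: "e > 0"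
    show "\<exists>N. \<forall>n\<ge>N. norm (?r n - lower_support ?B q) < e"
    proof (rule ccontr)
      assume "\<not> ?thesis"
      then have "\<forall>N. \<exists>n\<ge>N. ?r n \<le> lower_support ?B q - e"
        using up by (auto simp: not_less) (smt (verit, best) up)
      then obtain k where k: "\<And>N. k N \<ge> N" "\<And>N. ?r (k N) \<le> lower_support ?B q - e" by metis
      have "\<forall>N. y (k N) \<in> A" using y by blast
      then obtain z \<sigma> where z: "z \<in> A" "strict_mono \<sigma>" "((\<lambda>N. y (k N)) \<circ> \<sigma>) \<longlonglongrightarrow> z"
        using A(1) unfolding compact_def by meson
      have z': "(\<lambda>N. y (k (\<sigma> N))) \<longlonglongrightarrow> z" using z(3) by (simp add: o_def)
      have k0: "(\<lambda>N. 1 / real (Suc (k (\<sigma> N)))) \<longlonglongrightarrow> 0"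
      proof (rule tendsto_sandwich[OF _ _ tendsto_const])
        show "\<forall>\<^sub>F N in sequentially. 1 / real (Suc (k (\<sigma> N))) \<le> 1 / real (Suc N)"
        proof (intro always_eventually allI)
          fix N
          have "N \<le> k (\<sigma> N)" using k(1)[of "\<sigma> N"] seq_suble[OF z(2), of N] by linarith
          then show "1 / real (Suc (k (\<sigma> N))) \<le> 1 / real (Suc N)" by (intro divide_left_mono) auto
        qed
        show "(\<lambda>N. 1 / real (Suc N)) \<longlonglongrightarrow> 0"
          using LIMSEQ_inverse_real_of_nat by (simp add: inverse_eq_divide)
      qed auto
      obtain a where a: "a \<in> ?B" using Bne by blast
      have "p \<bullet> z \<le> p \<bullet> a"
      proof (rule LIMSEQ_le)
        show "(\<lambda>N. (p + (1 / real (Suc (k (\<sigma> N)))) *\<^sub>R q) \<bullet> y (k (\<sigma> N))) \<longlonglongrightarrow> p \<bullet> z"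
          using tendsto_inner[OF tendsto_add[OF tendsto_const tendsto_scaleR[OF k0 tendsto_const]] z', of p q] by simp
        show "(\<lambda>N. (p + (1 / real (Suc (k (\<sigma> N)))) *\<^sub>R q) \<bullet> a) \<longlonglongrightarrow> p \<bullet> a"
          using tendsto_inner[OF tendsto_add[OF tendsto_const tendsto_scaleR[OF k0 tendsto_const]] tendsto_const, of p q a] by simp
        show "\<exists>N0. \<forall>N\<ge>N0. (p + (1 / real (Suc (k (\<sigma> N)))) *\<^sub>R q) \<bullet> y (k (\<sigma> N))
            \<le> (p + (1 / real (Suc (k (\<sigma> N)))) *\<^sub>R q) \<bullet> a"
          unfolding ymin using a lower_support_le[OF A] by auto
      qed
      also have "p \<bullet> a \<le> lower_support A p" using a by simp
      finally have "z \<in> ?B" using z(1) by simp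
      then have "lower_support ?B q \<le> q \<bullet> z" using lower_support_le[OF B Bne] by blast
      moreover have "q \<bullet> z \<le> lower_support ?B q - e"
      proof (rule LIMSEQ_le_const2)
        show "(\<lambda>N. q \<bullet> y (k (\<sigma> N))) \<longlonglongrightarrow> q \<bullet> z" by (intro tendsto_intros z')
        show "\<exists>N0. \<forall>N\<ge>N0. q \<bullet> y (k (\<sigma> N)) \<le> lower_support ?B q - e"
          using lo k(2) order_trans by blast
      qed
      ultimately show False using e by simp
    qed
  qed
qed

lemma (in finite_measure) integral_bounded_convergence:
  fixes f :: "nat \<Rightarrow> 'a \<Rightarrow> 'b::{banach, second_countable_topology}"
  assumes "\<And>n. f n \<in> borel_measurable M" "g \<in> borel_measurable M"
    and "AE t in M. (\<lambda>n. f n t) \<longlonglongrightarrow> g t"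
    and "\<And>n. AE t in M. norm (f n t) \<le> B"
  shows "(\<lambda>n. integral\<^sup>L M (f n)) \<longlonglongrightarrow> integral\<^sup>L M g"
  by (rule integral_dominated_convergence[where w="\<lambda>_. B"]) (use assms in auto)

context complete_finite_measure
begin

lemma lower_support_measurable:
  fixes F :: "'t \<Rightarrow> 'x::euclidean_space set"
  assumes "measurable_graph M F" "\<forall>t\<in>space M. compact (F t) \<and> F t \<noteq> {}"
  shows "(\<lambda>t. lower_support (F t) p) \<in> borel_measurable M"
  unfolding lower_support_def
  by (rule borel_measurable_Inf_image[OF assms]) (auto intro!: continuous_intros)

text \<open>The hypothesis on \<open>v\<close> says that \<open>v\<close> lies in the closed convex set whose support function is the
  integral of the support functions of \<open>F t\<close>; the claim is that \<open>v\<close> is the integral of a single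
  selection. The role of nonatomicity is taken over by the real coordinate \<open>\<theta>\<close>: its level sets are
  null sets, or else \<open>F\<close> is single-valued on them.

  The proof is by induction on the dimension of \<open>V\<close>, the space of directions in which the sets \<open>F t\<close>
  extend. If a selection \<open>c\<close> does not have integral \<open>v\<close> already, replace \<open>F t\<close> by \<open>{c t}\<close> where \<open>\<theta> t > s\<close>
  and take the smallest \<open>s\<close> for which the hypothesis survives. The assumption on the level sets makes the
  integrated support function continuous in \<open>s\<close> (from the left as well), so for this \<open>s\<close> the hypothesis
  is an equality in some direction \<open>p \<in> V\<close>. Then the sets may be replaced by their faces in
  direction \<open>p\<close>, which lie in translates of the smaller space \<open>{x \<in> V. p \<bullet> x = 0}\<close>.\<close>

lemma selection_with_integral:
  fixes F :: "'t \<Rightarrow> 'x::euclidean_space set" and \<theta> :: "'t \<Rightarrow> real"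
  assumes V: "subspace V" and F: "measurable_graph M F"
    and cpt: "\<forall>t\<in>space M. compact (F t) \<and> F t \<noteq> {}"
    and bdd: "\<And>t y. t \<in> space M \<Longrightarrow> y \<in> F t \<Longrightarrow> norm y \<le> R"
    and FV: "\<And>t x y. t \<in> space M \<Longrightarrow> x \<in> F t \<Longrightarrow> y \<in> F t \<Longrightarrow> x - y \<in> V"
    and \<theta>: "\<theta> \<in> borel_measurable M" "\<And>t. t \<in> space M \<Longrightarrow> 0 < \<theta> t \<and> \<theta> t \<le> 1"
    and levels: "\<And>s. emeasure M {t\<in>space M. \<theta> t = s} \<noteq> 0 \<Longrightarrow>
      \<forall>t\<in>space M. \<theta> t = s \<longrightarrow> (\<forall>x\<in>F t. \<forall>y\<in>F t. x = y)"
    and v: "\<And>p. (\<integral>t. lower_support (F t) p \<partial>M) \<le> p \<bullet> v"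
  shows "\<exists>f\<in>borel_measurable M. (\<forall>t\<in>space M. f t \<in> F t) \<and> integral\<^sup>L M f = v"
  using V F cpt bdd FV levels v
proof (induction "dim V" arbitrary: V F rule: less_induct)
  case less
  note V = less.prems(1) and F = less.prems(2) and cpt = less.prems(3) and bdd = less.prems(4)
    and FV = less.prems(5) and levels = less.prems(6) and v = less.prems(7)
  have cpt': "compact (F t)" "F t \<noteq> {}" if "t \<in> space M" for t using cpt that by auto
  obtain c where "c \<in> borel_measurable M" "\<forall>t\<in>space M. F t \<noteq> {} \<longrightarrow> c t \<in> F t"
    using measurable_selection[OF F cpt'(1)] by blast
  then have c: "c \<in> borel_measurable M" "\<And>t. t \<in> space M \<Longrightarrow> c t \<in> F t"
    using cpt'(2) by auto
  have c_int: "integrable M c"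
    by (rule integrable_const_bound[of _ R]) (use c bdd in auto)
  define w where "w = v - integral\<^sup>L M c"
  define D where "D p t = lower_support (F t) p - p \<bullet> c t" for p t
  note low_meas = lower_support_measurable[OF F cpt]
  have D_meas [measurable]: "D p \<in> borel_measurable M" for p
    unfolding D_def using low_meas[of p] c(1) by measurable
  have low_bound: "\<bar>lower_support (F t) p\<bar> \<le> norm p * R" if "t \<in> space M" for p t
    using lower_support_bound[OF cpt'[OF that] bdd[OF that]] .
  have low_int: "integrable M (\<lambda>t. lower_support (F t) p)" for p
    by (rule integrable_const_bound[of _ "norm p * R"]) (use low_meas low_bound in auto)
  have D_le0: "D p t \<le> 0" if "t \<in> space M" for p t
    using lower_support_le[OF cpt'[OF that] c(2)[OF that], of p] by (simp add: D_def)
  have D_Lip: "\<bar>D p t - D q t\<bar> \<le> norm (p - q) * (2 * R)" if "t \<in> space M" for p q t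
  proof -
    have "\<bar>lower_support (F t) p - lower_support (F t) q\<bar> \<le> norm (p - q) * R"
      using lower_support_Lipschitz cpt'[OF that] bdd[OF that] by blast
    moreover have "\<bar>(p - q) \<bullet> c t\<bar> \<le> norm (p - q) * R"
      using Cauchy_Schwarz_ineq2[of "p - q" "c t"] bdd[OF that c(2)[OF that]]
      by (meson mult_left_mono norm_ge_zero order_trans)
    ultimately show ?thesis by (simp add: D_def inner_diff_left)
  qed
  have D0: "D 0 t = 0" if "t \<in> space M" for t
    using lower_support_scaleR[OF cpt'[OF that], of 0 0] by (simp add: D_def)
  have D_bound: "\<bar>D p t\<bar> \<le> norm p * (2 * R)" if "t \<in> space M" for p t
    using D_Lip[OF that, of p 0] D0[OF that] by simp
  have D_int: "integrable M (D p)" for p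
    by (rule integrable_const_bound[of _ "norm p * (2 * R)"]) (use D_bound in auto)
  have wD: "integral\<^sup>L M (D p) \<le> p \<bullet> w" for p
    using v[of p] low_int[of p] c_int unfolding D_def w_def
    by (simp add: inner_diff_right Bochner_Integration.integral_diff)
  show ?case
  proof (cases "w = 0")
    case True
    then have "integral\<^sup>L M c = v" by (simp add: w_def)
    then show ?thesis using c by blast
  next
    case False
    define g where "g s p = (\<integral>t. indicat_real {..s} (\<theta> t) * D p t \<partial>M)" for s p
    have gf_meas: "(\<lambda>t. indicat_real {..s} (\<theta> t) * D p t) \<in> borel_measurable M" for s p
      using \<theta>(1) by measurable
    have gf_bound: "\<bar>indicat_real {..s} (\<theta> t) * D p t\<bar> \<le> norm p * (2 * R)" if "t \<in> space M" for s p t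
      using D_bound[OF that, of p] order_trans[OF abs_ge_zero D_bound[OF that, of p]]
      by (simp add: indicator_def)
    define S where "S = {s. 0 \<le> s \<and> s \<le> 1 \<and> (\<forall>p. g s p \<le> p \<bullet> w)}"
    have "1 \<in> S"
    proof -
      have "g 1 p = integral\<^sup>L M (D p)" for p
        unfolding g_def using \<theta>(2) by (intro Bochner_Integration.integral_cong) auto
      then show ?thesis using wD by (simp add: S_def)
    qed
    have "0 \<notin> S"
    proof
      assume "0 \<in> S"
      moreover have "g 0 p = 0" for p
      proof -
        have "g 0 p = (\<integral>t. 0 \<partial>M)"
          unfolding g_def using \<theta>(2) by (intro Bochner_Integration.integral_cong) (auto simp: indicator_def not_le)
        then show ?thesis by simp
      qed
      ultimately have "0 \<le> p \<bullet> w" for p by (auto simp: S_def)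
      from this[of "- w"] have "w \<bullet> w \<le> 0" by simp
      then show False using False inner_gt_zero_iff[of w] by linarith
    qed
    \<comment> \<open>Truncating the set-valued map to the selection \<open>c\<close> on \<open>{\<theta> > s}\<close> shrinks the convex set
      that \<open>v\<close> belongs to. At the critical level \<open>v\<close> lies on its boundary.\<close>
    define s where "s = Inf S"
    have bS: "bdd_below S" by (auto simp: S_def bdd_below_def)
    have s01: "0 \<le> s" "s \<le> 1"
    proof -
      show "0 \<le> s" unfolding s_def using \<open>1 \<in> S\<close> by (intro cInf_greatest) (auto simp: S_def)
      show "s \<le> 1" unfolding s_def using \<open>1 \<in> S\<close> bS by (rule cInf_lower)
    qed
    have "s \<in> S"
    proof -
      have "\<exists>r\<in>S. r < s + 1 / Suc n" for n
        unfolding s_def by (rule cInf_lessD) (use \<open>1 \<in> S\<close> in auto)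
      then obtain r where r: "\<And>n. r n \<in> S" "\<And>n. r n < s + 1 / Suc n" by metis
      have rs: "s \<le> r n" for n unfolding s_def using r(1) bS by (rule cInf_lower)
      have rlim: "r \<longlonglongrightarrow> s"
      proof (rule tendsto_sandwich[OF _ _ tendsto_const])
        show "\<forall>\<^sub>F n in sequentially. r n \<le> s + inverse (real (Suc n))"
          using r(2) by (auto simp: inverse_eq_divide less_imp_le)
        show "(\<lambda>n. s + inverse (real (Suc n))) \<longlonglongrightarrow> s"
          using tendsto_add[OF tendsto_const LIMSEQ_inverse_real_of_nat, of s] by simp
      qed (use rs in auto)
      have "g s p \<le> p \<bullet> w" for p
      proof -
        have "(\<lambda>n. g (r n) p) \<longlonglongrightarrow> g s p"
          unfolding g_def
        proof (rule integral_bounded_convergence)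
          show "AE t in M. (\<lambda>n. indicat_real {..r n} (\<theta> t) * D p t) \<longlonglongrightarrow> indicat_real {..s} (\<theta> t) * D p t"
          proof (rule AE_I2)
            fix t assume "t \<in> space M"
            have "\<forall>\<^sub>F n in sequentially. indicat_real {..r n} (\<theta> t) = indicat_real {..s} (\<theta> t)"
            proof (cases "\<theta> t \<le> s")
              case True
              then have "\<theta> t \<le> r n" for n using rs[of n] by linarith
              then show ?thesis using True by simp
            next
              case False
              then have "\<forall>\<^sub>F n in sequentially. r n < \<theta> t" using rlim by (intro order_tendstoD) auto
              then show ?thesis by eventually_elim (use False in \<open>auto simp: indicator_def\<close>)
            qed
            then have "\<forall>\<^sub>F n in sequentially. indicat_real {..s} (\<theta> t) * D p t = indicat_real {..r n} (\<theta> t) * D p t"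
              by eventually_elim simp
            then show "(\<lambda>n. indicat_real {..r n} (\<theta> t) * D p t) \<longlonglongrightarrow> indicat_real {..s} (\<theta> t) * D p t"
              by (rule Lim_transform_eventually[OF tendsto_const])
          qed
          show "AE t in M. norm (indicat_real {..r n} (\<theta> t) * D p t) \<le> norm p * (2 * R)" for n
            using gf_bound by simp
        qed (rule gf_meas)+
        then show ?thesis
          by (rule LIMSEQ_le_const2) (use r(1) in \<open>auto simp: S_def\<close>)
      qed
      then show ?thesis using s01 by (simp add: S_def)
    qed
    then have s0: "0 < s" using \<open>0 \<notin> S\<close> s01 by (metis less_le)
    \<comment> \<open>Below \<open>s\<close> the hypothesis fails in some direction, which can be projected to \<open>V\<close>: orthogonally to
      \<open>V\<close> the sets do not extend, and the hypothesis is an equality.\<close>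
    define r where "r n = s - s / Suc n" for n
    have r: "0 \<le> r n" "r n < s" for n
      using s0 by (auto simp: r_def field_simps)
    have rlim: "r \<longlonglongrightarrow> s"
    proof -
      have "(\<lambda>n. s - s * inverse (real (Suc n))) \<longlonglongrightarrow> s - s * 0"
        by (intro tendsto_intros LIMSEQ_inverse_real_of_nat)
      then show ?thesis by (simp add: r_def[abs_def] divide_inverse)
    qed
    have "\<exists>p\<in>V. norm p = 1 \<and> p \<bullet> w < g (r n) p" for n
    proof -
      have "r n \<notin> S" using cInf_lower[OF _ bS, of "r n"] r(2)[of n] by (auto simp: s_def)
      then obtain p where p: "p \<bullet> w < g (r n) p" using r[of n] s01 by (auto simp: S_def not_le)
      obtain a b where ab: "a \<in> span V" "\<And>x. x \<in> span V \<Longrightarrow> orthogonal b x" "p = a + b"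
        using orthogonal_subspace_decomp_exists[of V p] by blast
      have span: "span V = V" using V by (simp add: span_eq_iff)
      have aV: "a \<in> V" using ab span by simp
      have const: "y \<in> F t \<Longrightarrow> b \<bullet> y = b \<bullet> c t" if "t \<in> space M" for t y
        using ab(2)[of "y - c t"] FV[OF that, of y "c t"] c(2)[OF that] span
        by (simp add: orthogonal_def inner_diff_right)
      have Dab: "D (a + b) t = D a t" if "t \<in> space M" for t
        using lower_support_add_const[OF cpt'[OF that] const[OF that], of a]
        by (simp add: D_def inner_add_left)
      have Db: "D (x *\<^sub>R b) t = 0" if "t \<in> space M" for t x
        using lower_support_add_const[OF cpt'[OF that], of "x *\<^sub>R b" "x * (b \<bullet> c t)" 0]
          lower_support_scaleR[OF cpt'[OF that], of 0 0] const[OF that]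
        by (simp add: D_def)
      have "0 \<le> (x *\<^sub>R b) \<bullet> w" for x
        using wD[of "x *\<^sub>R b"] Db by (simp cong: Bochner_Integration.integral_cong)
      from this[of 1] this[of "-1"] have bw: "b \<bullet> w = 0" by simp
      have "g (r n) p = g (r n) a"
        unfolding g_def ab(3) by (intro Bochner_Integration.integral_cong) (auto simp: Dab)
      then have a: "a \<bullet> w < g (r n) a" using p by (simp add: ab(3) inner_add_left bw)
      have "a \<noteq> 0"
      proof
        assume "a = 0"
        then have "g (r n) a = 0" unfolding g_def using D0 by (simp cong: Bochner_Integration.integral_cong)
        then show False using a \<open>a = 0\<close> by simp
      qed
      define x where "x = 1 / norm a"
      have x: "x > 0" using \<open>a \<noteq> 0\<close> by (simp add: x_def)
      have "D (x *\<^sub>R a) t = x * D a t" if "t \<in> space M" for t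
        using lower_support_scaleR[OF cpt'[OF that], of x a] x by (simp add: D_def algebra_simps)
      then have "g (r n) (x *\<^sub>R a) = (\<integral>t. x * (indicat_real {..r n} (\<theta> t) * D a t) \<partial>M)"
        unfolding g_def by (intro Bochner_Integration.integral_cong) auto
      also have "\<dots> = x * g (r n) a" by (simp add: g_def)
      finally have "(x *\<^sub>R a) \<bullet> w < g (r n) (x *\<^sub>R a)" using a x by simp
      moreover have "x *\<^sub>R a \<in> V" using V aV by (simp add: subspace_scale)
      moreover have "norm (x *\<^sub>R a) = 1" using \<open>a \<noteq> 0\<close> by (simp add: x_def)
      ultimately show ?thesis by blast
    qed
    then obtain P where P: "\<And>n. P n \<in> V" "\<And>n. norm (P n) = 1" "\<And>n. P n \<bullet> w < g (r n) (P n)"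
      by metis
    have "\<forall>n. P n \<in> sphere 0 1" using P(2) by simp
    then obtain p \<sigma> where p: "p \<in> sphere 0 1" "strict_mono \<sigma>" "(P \<circ> \<sigma>) \<longlonglongrightarrow> p"
      using compact_sphere[of "0 :: 'x" 1] unfolding compact_def by meson
    have plim: "(\<lambda>n. P (\<sigma> n)) \<longlonglongrightarrow> p" using p(3) by (simp add: o_def)
    have rlim': "(\<lambda>n. r (\<sigma> n)) \<longlonglongrightarrow> s" using LIMSEQ_subseq_LIMSEQ[OF rlim p(2)] by (simp add: o_def)
    have p0: "p \<noteq> 0" using p(1) by auto
    have pV: "p \<in> V"
      using closed_sequentially[OF closed_subspace[OF V], of "\<lambda>n. P (\<sigma> n)" p] P(1) plim by blast
    have "p \<bullet> w \<le> g s p"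
    proof (rule LIMSEQ_le)
      show "(\<lambda>n. P (\<sigma> n) \<bullet> w) \<longlonglongrightarrow> p \<bullet> w" by (intro tendsto_intros plim)
      show "\<exists>N. \<forall>n\<ge>N. P (\<sigma> n) \<bullet> w \<le> g (r (\<sigma> n)) (P (\<sigma> n))" using P(3) by (auto simp: less_imp_le)
      show "(\<lambda>n. g (r (\<sigma> n)) (P (\<sigma> n))) \<longlonglongrightarrow> g s p"
        unfolding g_def
      proof (rule integral_bounded_convergence)
        show "AE t in M. norm (indicat_real {..r (\<sigma> n)} (\<theta> t) * D (P (\<sigma> n)) t) \<le> 1 * (2 * R)" for n
          using gf_bound[of _ "r (\<sigma> n)" "P (\<sigma> n)"] P(2) by (intro AE_I2) simp
        have ae: "AE t in M. \<theta> t = s \<longrightarrow> (\<forall>q. D q t = 0)"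
        proof (cases "emeasure M {t\<in>space M. \<theta> t = s} = 0")
          case True
          have "{t\<in>space M. \<theta> t = s} \<in> null_sets M"
            using True \<theta>(1) by (intro null_setsI) measurable
          then have "AE t in M. \<theta> t \<noteq> s" by (rule AE_I') auto
          then show ?thesis by eventually_elim simp
        next
          case False
          have "D q t = 0" if t: "t \<in> space M" "\<theta> t = s" for q t
          proof -
            obtain y where "y \<in> F t" "q \<bullet> y = lower_support (F t) q"
              using lower_support_attained[OF cpt'[OF t(1)]] by blast
            moreover have "y = c t" using levels[OF False] t c(2)[OF t(1)] \<open>y \<in> F t\<close> by blast
            ultimately show ?thesis by (simp add: D_def)
          qed
          then show ?thesis by (intro AE_I2) blast
        qed
        show "AE t in M. (\<lambda>n. indicat_real {..r (\<sigma> n)} (\<theta> t) * D (P (\<sigma> n)) t) \<longlonglongrightarrow> indicat_real {..s} (\<theta> t) * D p t"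
          using ae AE_space
        proof eventually_elim
          case (elim t)
          have Dlim: "(\<lambda>n. D (P (\<sigma> n)) t) \<longlonglongrightarrow> D p t"
          proof (rule LIM_zero_cancel, rule Lim_null_comparison)
            show "\<forall>\<^sub>F n in sequentially. norm (D (P (\<sigma> n)) t - D p t) \<le> norm (P (\<sigma> n) - p) * (2 * R)"
            proof (intro always_eventually allI)
              fix n show "norm (D (P (\<sigma> n)) t - D p t) \<le> norm (P (\<sigma> n) - p) * (2 * R)"
                using D_Lip[OF elim(2), of "P (\<sigma> n)" p] by simp
            qed
            show "(\<lambda>n. norm (P (\<sigma> n) - p) * (2 * R)) \<longlonglongrightarrow> 0"
              using plim by (intro tendsto_mult_left_zero tendsto_norm_zero) (simp add: LIM_zero)
          qed
          consider "\<theta> t < s" | "\<theta> t = s" | "\<theta> t > s" by linarith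
          then show ?case
          proof cases
            case 1
            then have "\<forall>\<^sub>F n in sequentially. \<theta> t < r (\<sigma> n)" using rlim' by (intro order_tendstoD)
            then have "\<forall>\<^sub>F n in sequentially. D (P (\<sigma> n)) t = indicat_real {..r (\<sigma> n)} (\<theta> t) * D (P (\<sigma> n)) t"
              by eventually_elim simp
            then show ?thesis using Lim_transform_eventually[OF Dlim] 1 by simp
          next
            case 2 then show ?thesis using elim(1) by simp
          next
            case 3
            then have "\<not> \<theta> t \<le> r (\<sigma> n)" for n using r(2)[of "\<sigma> n"] by linarith
            then show ?thesis using 3 by simp
          qed
        qed
      qed (rule gf_meas)+
    qed
    moreover have sS: "g s q \<le> q \<bullet> w" for q using \<open>s \<in> S\<close> by (simp add: S_def)
    ultimately have eq: "g s p = p \<bullet> w" by (meson antisym)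
    define F' where "F' t = {y\<in>F t. \<theta> t \<le> s \<or> y = c t}" for t
    have F'if: "F' t = (if \<theta> t \<le> s then F t else {c t})" if "t \<in> space M" for t
      using c(2)[OF that] by (auto simp: F'_def)
    have F': "measurable_graph M F'"
      unfolding F'_def
    proof (rule measurable_graph_Collect[OF F])
      have "(\<lambda>w. c (fst w)) \<in> borel_measurable (M \<Otimes>\<^sub>M (borel :: 'x measure))"
        "(\<lambda>w. \<theta> (fst w)) \<in> borel_measurable (M \<Otimes>\<^sub>M (borel :: 'x measure))"
        using c(1) \<theta>(1) by measurable
      then show "Measurable.pred (M \<Otimes>\<^sub>M borel) (\<lambda>w. \<theta> (fst w) \<le> s \<or> snd w = c (fst w))"
        by measurable
    qed
    have cptF': "\<forall>t\<in>space M. compact (F' t) \<and> F' t \<noteq> {}" using cpt F'if by simp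
    have low': "lower_support (F' t) q = q \<bullet> c t + indicat_real {..s} (\<theta> t) * D q t" if "t \<in> space M" for q t
      using that lower_support_eqI[of "c t" "{c t}" q] by (auto simp: F'if D_def)
    have int_low': "(\<integral>t. lower_support (F' t) q \<partial>M) = q \<bullet> integral\<^sup>L M c + g s q" for q
    proof -
      have gint: "integrable M (\<lambda>t. indicat_real {..s} (\<theta> t) * D q t)"
        by (rule integrable_const_bound[of _ "norm q * (2 * R)"]) (use gf_bound gf_meas in auto)
      have "(\<integral>t. lower_support (F' t) q \<partial>M) = (\<integral>t. q \<bullet> c t + indicat_real {..s} (\<theta> t) * D q t \<partial>M)"
        by (intro Bochner_Integration.integral_cong low') auto
      also have "\<dots> = q \<bullet> integral\<^sup>L M c + g s q"
        using gint c_int by (simp add: g_def)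
      finally show ?thesis .
    qed
    have F'v: "(\<integral>t. lower_support (F' t) q \<partial>M) \<le> q \<bullet> v" for q
      using sS[of q] by (simp add: int_low' w_def inner_diff_right)
    have F'p: "(\<integral>t. lower_support (F' t) p \<partial>M) = p \<bullet> v"
      using eq by (simp add: int_low' w_def inner_diff_right)
    have F'bdd: "norm y \<le> R" if "t \<in> space M" "y \<in> F' t" for t y
      using bdd that by (auto simp: F'_def)
    define F2 where "F2 t = {y\<in>F' t. p \<bullet> y \<le> lower_support (F' t) p}" for t
    have \<phi>: "(\<lambda>w. p \<bullet> snd w) \<in> borel_measurable (M \<Otimes>\<^sub>M (borel :: 'x measure))" by measurable
    have cont: "\<forall>t\<in>space M. continuous_on (F' t) (\<lambda>y. p \<bullet> y)" by (intro ballI continuous_intros)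
    note argmin = measurable_graph_argmin[of F' "\<lambda>t y. p \<bullet> y", OF F' cptF' \<phi> cont, folded lower_support_def]
    have F2: "measurable_graph M F2" using argmin(3) by (simp add: F2_def[abs_def])
    have cptF2: "\<forall>t\<in>space M. compact (F2 t) \<and> F2 t \<noteq> {}" using argmin(4) by (simp add: F2_def)
    have F2F: "F2 t \<subseteq> F t" for t by (auto simp: F2_def F'_def)
    define V2 where "V2 = {x\<in>V. p \<bullet> x = 0}"
    have V2: "subspace V2" using V by (auto simp: V2_def subspace_def inner_add_right)
    have "p \<notin> V2" using p0 by (simp add: V2_def)
    then have "V2 \<noteq> V" using pV by blast
    then have "span V2 \<subset> span V" using V V2 by (auto simp: span_eq_iff[THEN iffD2] V2_def)
    then have dim: "dim V2 < dim V" by (rule dim_psubset)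
    have "(\<integral>t. lower_support (F2 t) q \<partial>M) \<le> q \<bullet> v" for q
    proof -
      let ?r = "\<lambda>n t. (lower_support (F' t) (p + (1 / Suc n) *\<^sub>R q) - lower_support (F' t) p) * Suc n"
      have low'int: "integrable M (\<lambda>t. lower_support (F' t) q)" for q
      proof (rule integrable_const_bound[of _ "norm q * R"])
        show "AE t in M. norm (lower_support (F' t) q) \<le> norm q * R"
          using lower_support_bound[OF _ _ F'bdd] cptF' by (intro AE_I2) simp
      qed (rule lower_support_measurable[OF F' cptF'])
      have "(\<lambda>n. \<integral>t. ?r n t \<partial>M) \<longlonglongrightarrow> (\<integral>t. lower_support (F2 t) q \<partial>M)"
      proof (rule integral_bounded_convergence)
        show "?r n \<in> borel_measurable M" for n
          using lower_support_measurable[OF F' cptF'] by measurable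
        show "(\<lambda>t. lower_support (F2 t) q) \<in> borel_measurable M"
          by (rule lower_support_measurable[OF F2 cptF2])
        show "AE t in M. (\<lambda>n. ?r n t) \<longlonglongrightarrow> lower_support (F2 t) q"
          unfolding F2_def using cptF' by (intro AE_I2 lower_support_directional_derivative) auto
        show "AE t in M. norm (?r n t) \<le> norm q * R" for n
        proof (rule AE_I2)
          fix t assume t: "t \<in> space M"
          have "\<bar>lower_support (F' t) (p + (1 / Suc n) *\<^sub>R q) - lower_support (F' t) p\<bar>
              \<le> norm (p + (1 / Suc n) *\<^sub>R q - p) * R"
            using cptF' t by (intro lower_support_Lipschitz F'bdd[OF t]) auto
          also have "\<dots> = norm q * R / Suc n" by simp
          finally show "norm (?r n t) \<le> norm q * R"
            by (simp add: abs_mult pos_le_divide_eq[symmetric])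
        qed
      qed
      moreover have "(\<integral>t. ?r n t \<partial>M) \<le> q \<bullet> v" for n
      proof -
        have "(\<integral>t. ?r n t \<partial>M) = ((\<integral>t. lower_support (F' t) (p + (1 / Suc n) *\<^sub>R q) \<partial>M) - p \<bullet> v) * Suc n"
          using low'int by (simp add: F'p Bochner_Integration.integral_diff)
        also have "\<dots> \<le> ((p + (1 / Suc n) *\<^sub>R q) \<bullet> v - p \<bullet> v) * Suc n"
          by (intro mult_right_mono diff_right_mono F'v) auto
        also have "\<dots> = q \<bullet> v" by (simp add: inner_add_left)
        finally show ?thesis .
      qed
      ultimately show ?thesis by (intro LIMSEQ_le_const2) auto
    qed
    moreover have "x - y \<in> V2" if t: "t \<in> space M" and xy: "x \<in> F2 t" "y \<in> F2 t" for t x y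
    proof -
      have "p \<bullet> x = lower_support (F' t) p" "p \<bullet> y = lower_support (F' t) p"
        using argmin(2)[OF t, of x] argmin(2)[OF t, of y] xy by (auto simp: F2_def)
      then show ?thesis
        using FV[OF t, of x y] xy F2F by (auto simp: V2_def inner_diff_right)
    qed
    moreover have "\<forall>t\<in>space M. \<theta> t = s' \<longrightarrow> (\<forall>x\<in>F2 t. \<forall>y\<in>F2 t. x = y)"
      if "emeasure M {t\<in>space M. \<theta> t = s'} \<noteq> 0" for s'
      using levels[OF that] F2F by (meson subsetD)
    moreover have "norm y \<le> R" if "t \<in> space M" "y \<in> F2 t" for t y
      using bdd that F2F by blast
    ultimately obtain f where "f \<in> borel_measurable M" "\<forall>t\<in>space M. f t \<in> F2 t" "integral\<^sup>L M f = v"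
      using less.hyps[OF dim V2 F2 cptF2] by blast
    then show ?thesis using F2F by blast
  qed
qed

end

section \<open>Fatou's lemma in several dimensions\<close>

text \<open>Base \<open>3\<close> with digits \<open>0\<close> and \<open>1\<close>, so that, unlike in base \<open>2\<close>, the digits can be recovered.\<close>

definition ternary :: "(nat \<Rightarrow> bool) \<Rightarrow> real" where
  "ternary x = (\<Sum>i. of_bool (x i) * (1/3) ^ Suc i)"

lemma ternary_summable: "summable (\<lambda>i. of_bool (x i) * (1/3 :: real) ^ Suc i)"
proof (rule summable_comparison_test'[where N=0])
  show "summable (\<lambda>i. (1/3 :: real) ^ Suc i)" by (simp only: summable_Suc_iff) (simp add: summable_geometric)
qed simp

lemma ternary_bounds: "0 \<le> ternary x" "ternary x \<le> 1/2"
proof -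
  show "0 \<le> ternary x" unfolding ternary_def by (intro suminf_nonneg ternary_summable) simp
  have s: "(\<lambda>i. (1/3 :: real) ^ Suc i) sums (1/3 * (1 / (1 - 1/3)))"
    unfolding power_Suc by (intro sums_mult geometric_sums) simp
  have "ternary x \<le> (\<Sum>i. (1/3 :: real) ^ Suc i)"
    unfolding ternary_def by (intro suminf_le ternary_summable sums_summable[OF s]) auto
  then show "ternary x \<le> 1/2" using sums_unique[OF s] by simp
qed

lemma ternary_Suc: "ternary x = (of_bool (x 0) + ternary (\<lambda>i. x (Suc i))) / 3"
proof -
  have "ternary x = (\<Sum>i. of_bool (x (Suc i)) * (1/3) ^ Suc (Suc i)) + of_bool (x 0) / 3"
    unfolding ternary_def using suminf_split_head[OF ternary_summable[of x]] by simp
  also have "(\<Sum>i. of_bool (x (Suc i)) * (1/3 :: real) ^ Suc (Suc i))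
      = (\<Sum>i. (1/3) * (of_bool (x (Suc i)) * (1/3) ^ Suc i))" by (simp add: mult_ac)
  also have "\<dots> = (1/3) * ternary (\<lambda>i. x (Suc i))"
    unfolding ternary_def by (rule suminf_mult[OF ternary_summable])
  finally show ?thesis by (simp add: field_simps)
qed

lemma ternary_inj: "ternary x = ternary y \<Longrightarrow> x i = y i"
proof (induction i arbitrary: x y)
  case 0
  then show ?case
    using ternary_Suc[of x] ternary_Suc[of y] ternary_bounds[of "\<lambda>i. x (Suc i)"]
      ternary_bounds[of "\<lambda>i. y (Suc i)"] by (cases "x 0"; cases "y 0") auto
next
  case (Suc i)
  have "x 0 = y 0"
    using Suc.prems ternary_Suc[of x] ternary_Suc[of y] ternary_bounds[of "\<lambda>i. x (Suc i)"]
      ternary_bounds[of "\<lambda>i. y (Suc i)"] by (cases "x 0"; cases "y 0") auto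
  then have "ternary (\<lambda>i. x (Suc i)) = ternary (\<lambda>i. y (Suc i))"
    using Suc.prems ternary_Suc[of x] ternary_Suc[of y] by simp
  then show ?case by (rule Suc.IH)
qed

text \<open>Only natural numbers are quantified, which makes cluster sets of measurable functions measurable
  by inspection.\<close>

definition cluster_set :: "(nat \<Rightarrow> 'x::metric_space) \<Rightarrow> 'x set" where
  "cluster_set x = {y. \<forall>m n. \<exists>k\<ge>n. dist (x k) y < 1 / Suc m}"

lemma cluster_setI:
  assumes "strict_mono (\<sigma> :: nat \<Rightarrow> nat)" "(\<lambda>k. x (\<sigma> k)) \<longlonglongrightarrow> y"
  shows "y \<in> cluster_set x"
  unfolding cluster_set_def
proof (intro CollectI allI)
  fix m n :: nat
  have "\<forall>\<^sub>F k in sequentially. dist (x (\<sigma> k)) y < 1 / Suc m"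
    using assms(2) by (intro tendstoD) auto
  then obtain k0 where k0: "\<And>k. k \<ge> k0 \<Longrightarrow> dist (x (\<sigma> k)) y < 1 / Suc m"
    unfolding eventually_sequentially by blast
  have "n \<le> \<sigma> (max k0 n)" using seq_suble[OF assms(1), of "max k0 n"] by simp
  then show "\<exists>k\<ge>n. dist (x k) y < 1 / Suc m" using k0[of "max k0 n"] by (intro exI[of _ "\<sigma> (max k0 n)"]) simp
qed

lemma cluster_setE:
  assumes "y \<in> cluster_set x"
  obtains \<sigma> :: "nat \<Rightarrow> nat" where "strict_mono \<sigma>" "(\<lambda>k. x (\<sigma> k)) \<longlonglongrightarrow> y"
proof -
  have ex: "\<exists>k\<ge>n. dist (x k) y < 1 / Suc m" for m n using assms by (auto simp: cluster_set_def)
  have "\<exists>f. \<forall>n. dist (x (f n)) y < 1 / Suc n \<and> f n < f (Suc n)"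
  proof (rule dependent_nat_choice)
    show "\<exists>k. dist (x k) y < 1 / Suc 0" using ex[of 0 0] by blast
    show "\<exists>k'. dist (x k') y < 1 / Suc (Suc n) \<and> k < k'" for k n
      using ex[of "Suc k" "Suc n"] by (auto simp: Suc_le_eq)
  qed
  then obtain f where f: "\<And>n. dist (x (f n)) y < 1 / Suc n" "\<And>n. f n < f (Suc n)" by blast
  have "(\<lambda>k. x (f k)) \<longlonglongrightarrow> y"
  proof (rule metric_tendsto_imp_tendsto[OF LIMSEQ_inverse_real_of_nat])
    show "\<forall>\<^sub>F k in sequentially. dist (x (f k)) y \<le> dist (inverse (real (Suc k))) 0"
      using f(1) by (intro always_eventually allI) (simp add: inverse_eq_divide less_imp_le)
  qed
  moreover have "strict_mono f" using f(2) by (simp add: strict_mono_Suc_iff)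
  ultimately show thesis using that by blast
qed

lemma closed_cluster_set: "closed (cluster_set x)"
proof -
  have "cluster_set x = (\<Inter>n. closure (x ` {n..}))"
  proof (intro equalityI subsetI)
    fix y assume "y \<in> cluster_set x"
    then have *: "\<exists>k\<ge>n. dist (x k) y < 1 / Suc m" for m n by (auto simp: cluster_set_def)
    show "y \<in> (\<Inter>n. closure (x ` {n..}))"
    proof (intro INT_I, unfold closure_approachable, intro allI impI)
      fix n and e :: real assume "e > 0"
      then obtain m where "1 / Suc m < e" using nat_approx_posE by blast
      then show "\<exists>z\<in>x ` {n..}. dist z y < e" using *[of n m] by force
    qed
  next
    fix y assume y: "y \<in> (\<Inter>n. closure (x ` {n..}))"
    show "y \<in> cluster_set x"
      unfolding cluster_set_def
    proof (intro CollectI allI)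
      fix m n
      have "y \<in> closure (x ` {n..})" using y by blast
      then obtain z where "z \<in> x ` {n..}" "dist z y < 1 / Suc m"
        unfolding closure_approachable by (metis of_nat_0_less_iff zero_less_Suc zero_less_divide_1_iff)
      then show "\<exists>k\<ge>n. dist (x k) y < 1 / Suc m" by auto
    qed
  qed
  then show ?thesis by auto
qed

lemma cluster_set_bounded:
  fixes x :: "nat \<Rightarrow> 'x::euclidean_space"
  assumes "\<And>k. norm (x k) \<le> R"
  shows cluster_set_nonempty: "cluster_set x \<noteq> {}"
    and cluster_set_norm_le: "y \<in> cluster_set x \<Longrightarrow> norm y \<le> R"
    and compact_cluster_set: "compact (cluster_set x)"
proof -
  have "\<forall>k. x k \<in> cball 0 R" using assms by simp
  then obtain y \<sigma> where "strict_mono \<sigma>" "(x \<circ> \<sigma>) \<longlonglongrightarrow> y"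
    using compact_cball[of "0 :: 'x" R] unfolding compact_def by meson
  then have "y \<in> cluster_set x" by (intro cluster_setI) (auto simp: o_def)
  then show "cluster_set x \<noteq> {}" by blast
  show le: "norm y \<le> R" if y: "y \<in> cluster_set x" for y
  proof -
    obtain \<sigma> where "strict_mono (\<sigma> :: nat \<Rightarrow> nat)" "(\<lambda>k. x (\<sigma> k)) \<longlonglongrightarrow> y"
      using y by (rule cluster_setE)
    then show ?thesis using assms by (intro LIMSEQ_le_const2[OF tendsto_norm]) auto
  qed
  have "cluster_set x \<subseteq> cball 0 R" using le by auto
  then show "compact (cluster_set x)"
    using closed_cluster_set bounded_subset[OF bounded_cball] compact_eq_bounded_closed by blast
qed

lemma lower_support_cluster_set:
  fixes x :: "nat \<Rightarrow> 'x::euclidean_space"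
  assumes bdd: "\<And>k. norm (x k) \<le> R"
  shows "(\<lambda>k. max 0 (lower_support (cluster_set x) p - p \<bullet> x k)) \<longlonglongrightarrow> 0"
proof (rule LIMSEQ_I)
  fix e :: real assume e: "e > 0"
  let ?l = "lower_support (cluster_set x) p"
  show "\<exists>N. \<forall>n\<ge>N. norm (max 0 (?l - p \<bullet> x n) - 0) < e"
  proof (rule ccontr)
    assume "\<not> ?thesis"
    then have "\<forall>N. \<exists>n\<ge>N. p \<bullet> x n \<le> ?l - e" using e by (auto simp: not_less max_def split: if_splits) (smt (verit))
    then obtain k where k: "\<And>N. N \<le> k N" "\<And>N. p \<bullet> x (k N) \<le> ?l - e" by metis
    obtain z where z: "z \<in> cluster_set (\<lambda>N. x (k N))"
      using cluster_set_nonempty[of "\<lambda>N. x (k N)" R] bdd by blast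
    have "z \<in> cluster_set x"
      unfolding cluster_set_def
    proof (intro CollectI allI)
      fix m n
      obtain N where "n \<le> N" "dist (x (k N)) z < 1 / Suc m" using z by (auto simp: cluster_set_def)
      then show "\<exists>j\<ge>n. dist (x j) z < 1 / Suc m" using k(1)[of N] order_trans by blast
    qed
    then have "?l \<le> p \<bullet> z"
      using lower_support_le[OF compact_cluster_set cluster_set_nonempty] bdd by blast
    moreover obtain \<sigma> where \<sigma>: "strict_mono (\<sigma> :: nat \<Rightarrow> nat)" "(\<lambda>j. x (k (\<sigma> j))) \<longlonglongrightarrow> z"
      using z by (rule cluster_setE)
    have "p \<bullet> z \<le> ?l - e"
      by (rule LIMSEQ_le_const2[OF tendsto_inner[OF tendsto_const \<sigma>(2)]]) (use k(2) in auto)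
    ultimately show False using e by simp
  qed
qed

context complete_finite_measure
begin

text \<open>Fatou's lemma in several dimensions, in the version of Schmeidler and Artstein. Let \<open>\<theta>\<close>
  be a real function that separates points as well as all the \<open>v k\<close> together do. Every \<open>v k\<close> is constant
  on its level sets, and at most countably many of these have positive measure. A diagonal subsequence
  converges on the latter, so its cluster sets are singletons there, and they satisfy the hypotheses of
  \<open>selection_with_integral\<close>.\<close>

lemma selection_of_cluster_sets:
  fixes v :: "nat \<Rightarrow> 't \<Rightarrow> 'x::euclidean_space"
  assumes v_meas: "\<And>k. v k \<in> borel_measurable M"
    and bdd: "\<And>k t. t \<in> space M \<Longrightarrow> norm (v k t) \<le> R"
    and lim: "(\<lambda>k. integral\<^sup>L M (v k)) \<longlonglongrightarrow> I"
  shows "\<exists>f\<in>borel_measurable M. (\<forall>t\<in>space M. f t \<in> cluster_set (\<lambda>k. v k t)) \<and> integral\<^sup>L M f = I"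
proof -
  obtain B :: "'x set set" where B: "countable B" "topological_basis B" using ex_countable_basis by blast
  have Bne: "B \<noteq> {}" using topological_basisE[OF B(2), of UNIV undefined] by blast
  define U where "U i = from_nat_into B i" for i
  have Uopen: "open (U i)" for i
    using B from_nat_into[OF Bne] by (auto simp: U_def topological_basis_open)
  have sep: "\<exists>i. x \<in> U i \<and> y \<notin> U i" if "x \<noteq> y" for x y
  proof -
    have "open (- {y})" "x \<in> - {y}" using that by auto
    then obtain W where "W \<in> B" "x \<in> W" "W \<subseteq> - {y}"
      by (rule topological_basisE[OF B(2)])
    then show ?thesis using from_nat_into_surj[OF B(1), of W] by (metis ComplD U_def insertI1 subsetD)
  qed
  \<comment> \<open>A real coordinate that remembers all of the functions \<open>v k\<close>.\<close>
  define code where "code t n = (v (fst (prod_decode n)) t \<in> U (snd (prod_decode n)))" for t n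
  define \<theta> where "\<theta> t = 1/2 + ternary (code t)" for t
  have v_const: "v k t = v k t'" if "\<theta> t = \<theta> t'" for k t t'
  proof (rule ccontr)
    assume "v k t \<noteq> v k t'"
    then obtain i where i: "v k t \<in> U i" "v k t' \<notin> U i" using sep by blast
    have "code t (prod_encode (k, i)) = code t' (prod_encode (k, i))"
      using that by (intro ternary_inj) (simp add: \<theta>_def)
    then show False using i by (simp add: code_def)
  qed
  have \<theta>: "\<theta> \<in> borel_measurable M"
  proof -
    have "Measurable.pred M (\<lambda>t. code t n)" for n
      unfolding code_def by (rule pred_sets2[OF _ v_meas]) (simp add: Uopen)
    then have "(\<lambda>t. of_bool (code t i) * (1/3 :: real) ^ Suc i) \<in> borel_measurable M" for i
      by measurable
    then show ?thesis unfolding \<theta>_def ternary_def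
      by (intro borel_measurable_add borel_measurable_const borel_measurable_suminf)
  qed
  have \<theta>01: "0 < \<theta> t \<and> \<theta> t \<le> 1" for t using ternary_bounds[of "code t"] by (simp add: \<theta>_def)
  define Z where "Z = {s. measure (distr M borel \<theta>) {s} \<noteq> 0}"
  have Z: "countable Z"
    unfolding Z_def by (intro finite_measure.countable_support finite_measure_distr \<theta>)
  have Zin: "s \<in> Z" if "emeasure M {t\<in>space M. \<theta> t = s} \<noteq> 0" for s
  proof -
    have "\<theta> -` {s} \<inter> space M = {t\<in>space M. \<theta> t = s}" by auto
    then have "measure (distr M borel \<theta>) {s} = measure M {t\<in>space M. \<theta> t = s}"
      using \<theta> by (subst measure_distr) auto
    then show ?thesis using that by (simp add: Z_def emeasure_eq_measure)
  qed
  have "\<exists>t. t \<in> space M \<and> \<theta> t = s" if "s \<in> Z" for s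
  proof (rule ccontr)
    assume "\<not> ?thesis"
    then have "\<theta> -` {s} \<inter> space M = {}" by auto
    then have "measure (distr M borel \<theta>) {s} = 0" using \<theta> by (subst measure_distr) auto
    then show False using that by (simp add: Z_def)
  qed
  then obtain \<tau> where \<tau>: "\<And>s. s \<in> Z \<Longrightarrow> \<tau> s \<in> space M \<and> \<theta> (\<tau> s) = s" by metis
  obtain \<kappa> where \<kappa>: "strict_mono (\<kappa> :: nat \<Rightarrow> nat)" "\<And>s. s \<in> Z \<Longrightarrow> \<exists>l. (\<lambda>n. v (\<kappa> n) (\<tau> s)) \<longlonglongrightarrow> l"
    using function_convergent_subsequence[OF Z, of "\<lambda>n s. v n (\<tau> s)" R] \<tau> bdd by metis
  define F where "F t = cluster_set (\<lambda>n. v (\<kappa> n) t)" for t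
  have bdd': "norm (v (\<kappa> n) t) \<le> R" if "t \<in> space M" for n t using bdd[OF that] .
  have cpt: "\<forall>t\<in>space M. compact (F t) \<and> F t \<noteq> {}"
    unfolding F_def
    by (intro ballI conjI compact_cluster_set[OF bdd'] cluster_set_nonempty[OF bdd'])
  have F: "measurable_graph M F"
    unfolding measurable_graph_def F_def cluster_set_def mem_Collect_eq
  proof (intro pred_intros_countable)
    fix m n k
    have "(\<lambda>w. dist (v (\<kappa> k) (fst w)) (snd w)) \<in> borel_measurable (M \<Otimes>\<^sub>M (borel :: 'x measure))"
      by (intro borel_measurable_dist measurable_compose[OF measurable_fst v_meas] measurable_snd)
    then show "Measurable.pred (M \<Otimes>\<^sub>M (borel :: 'x measure)) (\<lambda>w. n \<le> k \<and> dist (v (\<kappa> k) (fst w)) (snd w) < 1 / real (Suc m))"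
      by measurable
  qed
  have "\<exists>f\<in>borel_measurable M. (\<forall>t\<in>space M. f t \<in> F t) \<and> integral\<^sup>L M f = I"
  proof (rule selection_with_integral[OF subspace_UNIV F cpt _ _ \<theta>])
    show "norm y \<le> R" if "t \<in> space M" "y \<in> F t" for t y
      using cluster_set_norm_le[of "\<lambda>n. v (\<kappa> n) t", OF bdd'[OF that(1)]] that(2) by (simp add: F_def)
    show "\<forall>t\<in>space M. \<theta> t = s \<longrightarrow> (\<forall>x\<in>F t. \<forall>y\<in>F t. x = y)"
      if s: "emeasure M {t \<in> space M. \<theta> t = s} \<noteq> 0" for s
    proof (intro ballI impI)
      fix t x y assume t: "t \<in> space M" "\<theta> t = s" and xy: "x \<in> F t" "y \<in> F t"
      obtain l where "(\<lambda>n. v (\<kappa> n) (\<tau> s)) \<longlonglongrightarrow> l" using \<kappa>(2) Zin[OF s] by blast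
      then have l: "(\<lambda>n. v (\<kappa> n) t) \<longlonglongrightarrow> l" using v_const[of t "\<tau> s"] t \<tau>[OF Zin[OF s]] by simp
      have "x = l" if "x \<in> F t" for x
      proof -
        obtain \<sigma> where \<sigma>: "strict_mono (\<sigma> :: nat \<Rightarrow> nat)" "(\<lambda>k. v (\<kappa> (\<sigma> k)) t) \<longlonglongrightarrow> x"
          using \<open>x \<in> F t\<close> unfolding F_def by (rule cluster_setE)
        moreover have "(\<lambda>k. v (\<kappa> (\<sigma> k)) t) \<longlonglongrightarrow> l"
          using LIMSEQ_subseq_LIMSEQ[OF l \<sigma>(1)] by (simp add: o_def)
        ultimately show ?thesis using LIMSEQ_unique by blast
      qed
      then show "x = y" using xy by blast
    qed
    show "(\<integral>t. lower_support (F t) p \<partial>M) \<le> p \<bullet> I" for p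
    proof -
      let ?e = "\<lambda>k t. max 0 (lower_support (F t) p - p \<bullet> v (\<kappa> k) t)"
      have low_meas: "(\<lambda>t. lower_support (F t) p) \<in> borel_measurable M"
        by (rule lower_support_measurable[OF F cpt])
      have low_bound: "\<bar>lower_support (F t) p\<bar> \<le> norm p * R" if "t \<in> space M" for t
        unfolding F_def
        by (intro lower_support_bound compact_cluster_set[OF bdd'[OF that]] cluster_set_nonempty[OF bdd'[OF that]]
            cluster_set_norm_le[of "\<lambda>n. v (\<kappa> n) t", OF bdd'[OF that]])
      have pv_bound: "\<bar>p \<bullet> v (\<kappa> k) t\<bar> \<le> norm p * R" if "t \<in> space M" for k t
        using Cauchy_Schwarz_ineq2[of p "v (\<kappa> k) t"] bdd'[OF that]
        by (meson mult_left_mono norm_ge_zero order_trans)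
      have e_meas: "?e k \<in> borel_measurable M" for k using low_meas v_meas by measurable
      have e_bound: "norm (?e k t) \<le> 2 * (norm p * R)" if "t \<in> space M" for k t
        using low_bound[OF that] pv_bound[OF that, of k] by (auto simp: max_def)
      have "(\<lambda>k. integral\<^sup>L M (?e k)) \<longlonglongrightarrow> integral\<^sup>L M (\<lambda>t. 0)"
      proof (rule integral_bounded_convergence[OF e_meas])
        show "AE t in M. (\<lambda>k. ?e k t) \<longlonglongrightarrow> 0"
          unfolding F_def by (intro AE_I2 lower_support_cluster_set[OF bdd'])
        show "AE t in M. norm (?e k t) \<le> 2 * (norm p * R)" for k using e_bound by (intro AE_I2)
      qed simp
      moreover have "(\<lambda>k. p \<bullet> integral\<^sup>L M (v (\<kappa> k))) \<longlonglongrightarrow> p \<bullet> I"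
        using LIMSEQ_subseq_LIMSEQ[OF lim \<kappa>(1)] by (intro tendsto_inner tendsto_const) (simp add: o_def)
      ultimately have "(\<lambda>k. p \<bullet> integral\<^sup>L M (v (\<kappa> k)) + integral\<^sup>L M (?e k)) \<longlonglongrightarrow> p \<bullet> I + 0"
        by (intro tendsto_add) auto
      moreover have "(\<integral>t. lower_support (F t) p \<partial>M) \<le> p \<bullet> integral\<^sup>L M (v (\<kappa> k)) + integral\<^sup>L M (?e k)" for k
      proof -
        have v_int: "integrable M (v (\<kappa> k))"
          by (rule integrable_const_bound[of _ R]) (use bdd' v_meas in auto)
        have e_int: "integrable M (?e k)"
          by (rule integrable_const_bound[of _ "2 * (norm p * R)"]) (use e_bound e_meas in \<open>auto intro!: AE_I2\<close>)
        have "(\<integral>t. lower_support (F t) p \<partial>M) \<le> (\<integral>t. p \<bullet> v (\<kappa> k) t + ?e k t \<partial>M)"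
        proof (rule integral_mono)
          show "integrable M (\<lambda>t. lower_support (F t) p)"
            by (rule integrable_const_bound[of _ "norm p * R"]) (use low_bound low_meas in auto)
        qed (use v_int e_int in auto)
        also have "\<dots> = p \<bullet> integral\<^sup>L M (v (\<kappa> k)) + integral\<^sup>L M (?e k)"
          using v_int e_int by (subst Bochner_Integration.integral_add) auto
        finally show ?thesis .
      qed
      ultimately show ?thesis by (intro LIMSEQ_le_const[where x="p \<bullet> I"]) auto
    qed
  qed (use \<theta>01 in auto)
  moreover have "F t \<subseteq> cluster_set (\<lambda>k. v k t)" for t
  proof
    fix y assume "y \<in> F t"
    then obtain \<sigma> where \<sigma>: "strict_mono (\<sigma> :: nat \<Rightarrow> nat)" "(\<lambda>k. v (\<kappa> (\<sigma> k)) t) \<longlonglongrightarrow> y"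
      unfolding F_def by (rule cluster_setE)
    then show "y \<in> cluster_set (\<lambda>k. v k t)"
      using cluster_setI[of "\<kappa> \<circ> \<sigma>" "\<lambda>k. v k t" y] strict_mono_o[OF \<kappa>(1) \<sigma>(1)] \<sigma>(2)
      by (simp add: o_def)
  qed
  ultimately show ?thesis by blast
qed

end

section \<open>Normal cones and Lipschitz-like maps\<close>

text \<open>The quotients are cleared, so isolated points need no separate treatment below.\<close>

lemma regular_normal_cone_iff:
  "\<nu> \<in> regular_normal_cone C x \<longleftrightarrow>
     x \<in> C \<and> (\<forall>e>0. \<exists>d>0. \<forall>u\<in>C. u \<noteq> x \<longrightarrow> dist u x < d \<longrightarrow> \<nu> \<bullet> (u - x) < e * norm (u - x))"
proof -
  have "Limsup (at x within C) (\<lambda>u. ereal ((\<nu> \<bullet> (u - x)) / norm (u - x))) \<le> 0 \<longleftrightarrow>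
      (\<forall>e>0. \<forall>\<^sub>F u in at x within C. (\<nu> \<bullet> (u - x)) / norm (u - x) < e)"
  proof (intro iffI allI impI)
    fix e :: real
    assume "Limsup (at x within C) (\<lambda>u. ereal ((\<nu> \<bullet> (u - x)) / norm (u - x))) \<le> 0" "e > 0"
    then have "Limsup (at x within C) (\<lambda>u. ereal ((\<nu> \<bullet> (u - x)) / norm (u - x))) < ereal e"
      by (simp add: le_less_trans zero_ereal_def)
    then have "\<forall>\<^sub>F u in at x within C. ereal ((\<nu> \<bullet> (u - x)) / norm (u - x)) < ereal e"
      by (rule Limsup_lessD)
    then show "\<forall>\<^sub>F u in at x within C. (\<nu> \<bullet> (u - x)) / norm (u - x) < e" by simp
  next
    assume *: "\<forall>e>0. \<forall>\<^sub>F u in at x within C. (\<nu> \<bullet> (u - x)) / norm (u - x) < e"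
    show "Limsup (at x within C) (\<lambda>u. ereal ((\<nu> \<bullet> (u - x)) / norm (u - x))) \<le> 0"
      unfolding Limsup_le_iff
    proof (intro allI impI)
      fix y :: ereal assume "0 < y"
      then obtain e where e: "0 < ereal e" "ereal e < y" using ereal_dense2 by blast
      then have "\<forall>\<^sub>F u in at x within C. (\<nu> \<bullet> (u - x)) / norm (u - x) < e" using * by simp
      then show "\<forall>\<^sub>F u in at x within C. ereal ((\<nu> \<bullet> (u - x)) / norm (u - x)) < y"
      proof eventually_elim
        case (elim u)
        then have "ereal ((\<nu> \<bullet> (u - x)) / norm (u - x)) < ereal e" by simp
        then show ?case using e(2) by (rule less_trans)
      qed
    qed
  qed
  also have "\<dots> \<longleftrightarrow> (\<forall>e>0. \<exists>d>0. \<forall>u\<in>C. u \<noteq> x \<longrightarrow> dist u x < d \<longrightarrow> \<nu> \<bullet> (u - x) < e * norm (u - x))"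
    unfolding eventually_at by (simp add: pos_divide_less_eq imp_conjL cong: imp_cong conj_cong)
  finally show ?thesis by (simp add: regular_normal_cone_def)
qed

lemma proximal_normal_imp_regular:
  assumes "x \<in> C" "d > 0"
    and *: "\<And>u. u \<in> C \<Longrightarrow> dist u x < d \<Longrightarrow> \<nu> \<bullet> (u - x) \<le> c * (norm (u - x))\<^sup>2"
  shows "\<nu> \<in> regular_normal_cone C x"
  unfolding regular_normal_cone_iff
proof (intro conjI allI impI)
  fix e :: real assume e: "e > 0"
  define d' where "d' = min d (e / (\<bar>c\<bar> + 1))"
  have "d' > 0" using assms(2) e by (simp add: d'_def)
  moreover have "\<nu> \<bullet> (u - x) < e * norm (u - x)" if u: "u \<in> C" "u \<noteq> x" "dist u x < d'" for u
  proof -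
    have n: "norm (u - x) > 0" using u by simp
    have "norm (u - x) < e / (\<bar>c\<bar> + 1)" using u by (simp add: d'_def dist_norm)
    then have "(\<bar>c\<bar> + 1) * norm (u - x) < e" by (simp add: pos_less_divide_eq mult.commute)
    moreover have "c * norm (u - x) \<le> (\<bar>c\<bar> + 1) * norm (u - x)" by (intro mult_right_mono) auto
    ultimately have "c * norm (u - x) < e" by linarith
    then have "c * norm (u - x) * norm (u - x) < e * norm (u - x)" using n by (intro mult_strict_right_mono) auto
    moreover have "\<nu> \<bullet> (u - x) \<le> c * (norm (u - x))\<^sup>2" using * u by (simp add: d'_def)
    ultimately show ?thesis by (simp add: power2_eq_square)
  qed
  ultimately show "\<exists>d>0. \<forall>u\<in>C. u \<noteq> x \<longrightarrow> dist u x < d \<longrightarrow> \<nu> \<bullet> (u - x) < e * norm (u - x)"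
    by blast
qed (rule assms)

lemma regular_normal_cone_scaleR:
  assumes "\<nu> \<in> regular_normal_cone C x" "c > 0"
  shows "c *\<^sub>R \<nu> \<in> regular_normal_cone C x"
  unfolding regular_normal_cone_iff
proof (intro conjI allI impI)
  show "x \<in> C" using assms(1) by (simp add: regular_normal_cone_iff)
  fix e :: real assume "e > 0"
  then have "e / c > 0" using assms(2) by simp
  then obtain d where "d > 0" "\<forall>u\<in>C. u \<noteq> x \<longrightarrow> dist u x < d \<longrightarrow> \<nu> \<bullet> (u - x) < e / c * norm (u - x)"
    using assms(1) unfolding regular_normal_cone_iff by blast
  then show "\<exists>d>0. \<forall>u\<in>C. u \<noteq> x \<longrightarrow> dist u x < d \<longrightarrow> (c *\<^sub>R \<nu>) \<bullet> (u - x) < e * norm (u - x)"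
    using assms(2) by (intro exI[of _ d]) (auto simp: field_simps)
qed

text \<open>The Lipschitz-like inclusion only concerns points near \<open>y0\<close>. Compared with the single value at \<open>ub\<close> it
  shows that \<open>F u\<close> has points within \<open>\<gamma> / 2\<close> of \<open>y0\<close> and no points at distances between \<open>\<gamma> / 2\<close> and \<open>\<gamma>\<close>. A
  convex set cannot jump over this gap.\<close>

lemma convex_Lipschitz_like_imp_Lipschitz:
  fixes F :: "'u::euclidean_space \<Rightarrow> 'v::euclidean_space set"
  assumes pos: "l > 0" "\<gamma> > 0"
    and Lip: "\<And>u u'. u \<in> cball ub \<eta> \<Longrightarrow> u' \<in> cball ub \<eta> \<Longrightarrow>
      F u \<inter> cball y0 \<gamma> \<subseteq> F u' + (\<lambda>b. (l * norm (u - u')) *\<^sub>R b) ` cball 0 1"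
    and single: "F ub = {y0}"
    and conv: "\<And>u. u \<in> cball ub \<eta> \<Longrightarrow> convex (F u)"
    and small: "0 \<le> \<eta>" "2 * l * \<eta> \<le> \<gamma>"
    and u: "u \<in> cball ub \<eta>" and y: "y \<in> F u"
  shows "norm (y - y0) \<le> l * norm (u - ub) \<and>
    (\<forall>u'\<in>cball ub \<eta>. \<exists>y'\<in>F u'. norm (y' - y) \<le> l * norm (u' - u))"
proof -
  have near: "\<exists>z'\<in>F b. norm (z' - z) \<le> l * norm (b - a)"
    if "a \<in> cball ub \<eta>" "b \<in> cball ub \<eta>" "z \<in> F a" "z \<in> cball y0 \<gamma>" for a b z
  proof -
    have "z \<in> F b + (\<lambda>x. (l * norm (a - b)) *\<^sub>R x) ` cball 0 1" using Lip[OF that(1,2)] that by blast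
    then obtain z' x where *: "z' \<in> F b" "norm x \<le> 1" "z = z' + (l * norm (a - b)) *\<^sub>R x"
      by (auto simp: set_plus_def)
    have "norm (z' - z) = l * norm (a - b) * norm x" using * pos by (simp add: abs_mult)
    also have "\<dots> \<le> l * norm (a - b) * 1" using * pos by (intro mult_left_mono) auto
    finally show ?thesis using * by (metis mult.right_neutral norm_minus_commute)
  qed
  have ub: "ub \<in> cball ub \<eta>" using small by simp
  have "norm (u - ub) \<le> \<eta>" using u by (simp add: dist_norm norm_minus_commute)
  then have half: "l * norm (u - ub) \<le> \<gamma> / 2"
    using mult_left_mono[of "norm (u - ub)" \<eta> l] small pos by linarith
  have close: "norm (z - y0) \<le> l * norm (u - ub)" if "z \<in> F u" "z \<in> cball y0 \<gamma>" for z
    using near[OF u ub that] by (simp add: single norm_minus_commute)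
  have le: "norm (y - y0) \<le> l * norm (u - ub)"
  proof (cases "y \<in> cball y0 \<gamma>")
    case True then show ?thesis using close y by blast
  next
    \<comment> \<open>A far point of the convex value would put a point of it on the sphere of radius \<open>\<gamma>\<close>.\<close>
    case False
    obtain y1 where y1: "y1 \<in> F u" "norm (y1 - y0) \<le> l * norm (u - ub)"
      using near[OF ub u, of y0] single pos by auto
    let ?g = "\<lambda>s. norm (((1 - s) *\<^sub>R y1 + s *\<^sub>R y) - y0)"
    have "\<exists>s\<ge>0. s \<le> 1 \<and> ?g s = \<gamma>"
    proof (rule IVT')
      show "?g 0 \<le> \<gamma>" using y1 half pos by simp
      show "\<gamma> \<le> ?g 1" using False by (simp add: dist_norm norm_minus_commute)
    qed (auto intro!: continuous_intros)
    then obtain s where s: "0 \<le> s" "s \<le> 1" "?g s = \<gamma>" by blast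
    have "(1 - s) *\<^sub>R y1 + s *\<^sub>R y \<in> F u"
      using conv[OF u] y1(1) y s by (intro convexD) auto
    moreover have "(1 - s) *\<^sub>R y1 + s *\<^sub>R y \<in> cball y0 \<gamma>"
      using s(3) by (simp add: dist_norm norm_minus_commute)
    ultimately have "?g s \<le> l * norm (u - ub)" by (rule close)
    then show ?thesis using s(3) half pos by simp
  qed
  have "y \<in> cball y0 \<gamma>" using le half pos by (simp add: dist_norm norm_minus_commute)
  then show ?thesis using le near[OF u _ y] by blast
qed

lemma limiting_normal_coneI:
  assumes "\<And>k. Xs k \<in> regular_normal_cone C (X k)" "X \<longlonglongrightarrow> x" "Xs \<longlonglongrightarrow> \<nu>"
  shows "\<nu> \<in> limiting_normal_cone C x"
  using assms unfolding limiting_normal_cone_def by blast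

section \<open>Selections of the graphs\<close>

text \<open>The situation after the convexity argument. The conditions hold at every \<open>t\<close>: exceptional null sets
  are removed by changing the data on them.\<close>

locale Lipschitz_integrand = complete_finite_measure M
  for M :: "'t measure" +
  fixes \<Phi> :: "'t \<Rightarrow> 'u::euclidean_space \<Rightarrow> 'v::euclidean_space set"
    and ub :: 'u and y0 :: "'t \<Rightarrow> 'v" and l \<eta> :: real
  assumes l: "l > 0" and \<eta>: "\<eta> > 0"
    and graph: "measurable_graph M (\<lambda>t. gph (\<Phi> t))"
    and closed_gph: "t \<in> space M \<Longrightarrow> closed (gph (\<Phi> t))"
    and y0_int: "integrable M y0"
    and y0: "t \<in> space M \<Longrightarrow> y0 t \<in> \<Phi> t ub"
    and near: "t \<in> space M \<Longrightarrow> u \<in> cball ub \<eta> \<Longrightarrow> y \<in> \<Phi> t u \<Longrightarrow> norm (y - y0 t) \<le> l * norm (u - ub)"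
    and Lip: "t \<in> space M \<Longrightarrow> u \<in> cball ub \<eta> \<Longrightarrow> u' \<in> cball ub \<eta> \<Longrightarrow> y \<in> \<Phi> t u \<Longrightarrow>
      \<exists>y'\<in>\<Phi> t u'. norm (y' - y) \<le> l * norm (u' - u)"
begin

abbreviation yb :: 'v where
  "yb \<equiv> integral\<^sup>L M y0"

definition gph_selection :: "('t \<Rightarrow> 'u) \<Rightarrow> ('t \<Rightarrow> 'v) \<Rightarrow> bool" where
  "gph_selection u y \<longleftrightarrow> u \<in> borel_measurable M \<and> y \<in> borel_measurable M \<and>
     (\<forall>t\<in>space M. u t \<in> cball ub \<eta> \<and> y t \<in> \<Phi> t (u t))"

lemma y0_meas: "y0 \<in> borel_measurable M"
  using y0_int by (rule borel_measurable_integrable)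

lemma gph_selectionD:
  assumes "gph_selection u y"
  shows "u \<in> borel_measurable M" "y \<in> borel_measurable M"
    and "t \<in> space M \<Longrightarrow> u t \<in> cball ub \<eta>" "t \<in> space M \<Longrightarrow> norm (u t - ub) \<le> \<eta>"
    and "t \<in> space M \<Longrightarrow> y t \<in> \<Phi> t (u t)"
    and "t \<in> space M \<Longrightarrow> norm (y t - y0 t) \<le> l * norm (u t - ub)"
    and "t \<in> space M \<Longrightarrow> norm (y t - y0 t) \<le> l * \<eta>"
proof -
  show "u \<in> borel_measurable M" "y \<in> borel_measurable M"
    and u: "t \<in> space M \<Longrightarrow> u t \<in> cball ub \<eta>" and "t \<in> space M \<Longrightarrow> y t \<in> \<Phi> t (u t)" for t
    using assms by (auto simp: gph_selection_def)
  then show n: "t \<in> space M \<Longrightarrow> norm (y t - y0 t) \<le> l * norm (u t - ub)" using near by blast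
  show u': "t \<in> space M \<Longrightarrow> norm (u t - ub) \<le> \<eta>"
    using u by (simp add: dist_norm norm_minus_commute)
  show "norm (y t - y0 t) \<le> l * \<eta>" if "t \<in> space M"
    using order_trans[OF n[OF that] mult_left_mono[OF u'[OF that]]] l by simp
qed

lemma gph_selection_integrable:
  assumes "gph_selection u y"
  shows "integrable M u" "integrable M y"
proof -
  note D = gph_selectionD[OF assms]
  show "integrable M u"
  proof (rule integrable_const_bound[of _ "\<eta> + norm ub"])
    show "AE t in M. norm (u t) \<le> \<eta> + norm ub"
    proof (rule AE_I2)
      fix t assume "t \<in> space M"
      then show "norm (u t) \<le> \<eta> + norm ub"
        using D(4)[of t] norm_triangle_sub[of "u t" ub] by linarith
    qed
  qed (rule D)
  have "integrable M (\<lambda>t. y t - y0 t)"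
    by (rule integrable_const_bound[of _ "l * \<eta>"]) (use D(2,7) y0_meas in \<open>auto intro!: AE_I2\<close>)
  then have "integrable M (\<lambda>t. (y t - y0 t) + y0 t)"
    using y0_int by (rule Bochner_Integration.integrable_add)
  then show "integrable M y" by simp
qed

lemma gph_selection_base: "gph_selection (\<lambda>_. ub) y0"
  using y0 y0_meas \<eta> by (simp add: gph_selection_def)

lemma gph_selection_sq_integrable:
  assumes "gph_selection u y" "norm (r - ub) \<le> \<eta>"
  shows "integrable M (\<lambda>t. (norm (u t - r))\<^sup>2)"
    and "t \<in> space M \<Longrightarrow> (norm (u t - r))\<^sup>2 \<le> (2 * \<eta>)\<^sup>2"
proof -
  note D = gph_selectionD[OF assms(1)]
  show le: "(norm (u t - r))\<^sup>2 \<le> (2 * \<eta>)\<^sup>2" if "t \<in> space M" for t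
  proof (rule power_mono)
    show "norm (u t - r) \<le> 2 * \<eta>"
      using D(4)[OF that] assms(2) norm_triangle_ineq4[of "u t - ub" "r - ub"] by simp
  qed simp
  show "integrable M (\<lambda>t. (norm (u t - r))\<^sup>2)"
    by (rule integrable_const_bound[of _ "(2 * \<eta>)\<^sup>2"]) (use D(1) le in \<open>auto intro!: AE_I2\<close>)
qed

text \<open>Fatou's lemma is applied to the bounded triples \<open>(us j t - ub, ys j t - y0 t, |us j t - r j|\<^sup>2)\<close>. As
  the graphs are closed, a cluster point of these triples is again of this form.\<close>

lemma gph_selections_compact:
  assumes sel: "\<And>j. gph_selection (us j) (ys j)"
    and r: "\<And>j. norm (r j - ub) \<le> \<eta>" "r \<longlonglongrightarrow> r0"
  shows "\<exists>(\<sigma>::nat \<Rightarrow> nat) u y. strict_mono \<sigma> \<and> gph_selection u y \<and>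
    (\<lambda>j. integral\<^sup>L M (ys (\<sigma> j))) \<longlonglongrightarrow> integral\<^sup>L M y \<and>
    (\<lambda>j. \<integral>t. (norm (us (\<sigma> j) t - r (\<sigma> j)))\<^sup>2 \<partial>M) \<longlonglongrightarrow> (\<integral>t. (norm (u t - r0))\<^sup>2 \<partial>M)"
proof -
  note D = gph_selectionD[OF sel]
  note sq = gph_selection_sq_integrable[OF sel r(1)]
  define V where "V j t = (us j t - ub, ys j t - y0 t, (norm (us j t - r j))\<^sup>2)" for j t
  define R where "R = \<eta> + l * \<eta> + (2 * \<eta>)\<^sup>2"
  have V_meas: "V j \<in> borel_measurable M" for j
    unfolding V_def using D(1,2)[of j] y0_meas by measurable
  have V_bound: "norm (V j t) \<le> R" if "t \<in> space M" for j t
  proof -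
    have "norm (V j t) \<le> norm (us j t - ub) + (norm (ys j t - y0 t) + norm ((norm (us j t - r j))\<^sup>2))"
      unfolding V_def by (intro order_trans[OF norm_Pair_le] add_left_mono norm_Pair_le)
    also have "\<dots> \<le> \<eta> + (l * \<eta> + (2 * \<eta>)\<^sup>2)"
      using D(4,7)[OF that, of j] sq(2)[OF that, of j] by (intro add_mono) auto
    finally show ?thesis by (simp add: R_def)
  qed
  have V_int: "integrable M (V j)" for j
    by (rule integrable_const_bound[of _ R]) (use V_meas V_bound in \<open>auto intro!: AE_I2\<close>)
  have "norm (integral\<^sup>L M (V j)) \<le> R * measure M (space M)" for j
  proof -
    have "norm (integral\<^sup>L M (V j)) \<le> (\<integral>t. norm (V j t) \<partial>M)" by (rule integral_norm_bound)
    also have "\<dots> \<le> (\<integral>t. R \<partial>M)"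
      by (rule integral_mono) (use V_int V_bound in auto)
    finally show ?thesis by (simp add: mult.commute)
  qed
  then have "\<forall>j. integral\<^sup>L M (V j) \<in> cball 0 (R * measure M (space M))" by simp
  then obtain I \<sigma> where \<sigma>: "strict_mono (\<sigma> :: nat \<Rightarrow> nat)" "((\<lambda>j. integral\<^sup>L M (V j)) \<circ> \<sigma>) \<longlonglongrightarrow> I"
    using compact_cball[of "0 :: 'u \<times> 'v \<times> real" "R * measure M (space M)"] unfolding compact_def by meson
  have "(\<lambda>j. integral\<^sup>L M (V (\<sigma> j))) \<longlonglongrightarrow> I" using \<sigma>(2) by (simp add: o_def)
  from selection_of_cluster_sets[of "\<lambda>j. V (\<sigma> j)", OF V_meas V_bound this]
  obtain f where f: "f \<in> borel_measurable M" "\<And>t. t \<in> space M \<Longrightarrow> f t \<in> cluster_set (\<lambda>j. V (\<sigma> j) t)"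
    "integral\<^sup>L M f = I" by blast
  define u where "u t = ub + fst (f t)" for t
  define y where "y t = y0 t + fst (snd (f t))" for t
  have *: "u t \<in> cball ub \<eta> \<and> y t \<in> \<Phi> t (u t) \<and> snd (snd (f t)) = (norm (u t - r0))\<^sup>2 \<and> norm (f t) \<le> R"
    if t: "t \<in> space M" for t
  proof -
    obtain \<tau> where \<tau>: "strict_mono (\<tau> :: nat \<Rightarrow> nat)" "(\<lambda>j. V (\<sigma> (\<tau> j)) t) \<longlonglongrightarrow> f t"
      using f(2)[OF t] by (rule cluster_setE)
    have 1: "(\<lambda>j. us (\<sigma> (\<tau> j)) t) \<longlonglongrightarrow> u t"
      using tendsto_add[OF tendsto_const tendsto_fst[OF \<tau>(2)], of ub] by (simp add: V_def u_def)
    have 2: "(\<lambda>j. ys (\<sigma> (\<tau> j)) t) \<longlonglongrightarrow> y t"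
      using tendsto_add[OF tendsto_const tendsto_fst[OF tendsto_snd[OF \<tau>(2)]], of "y0 t"]
      by (simp add: V_def y_def)
    have 3: "(\<lambda>j. (norm (us (\<sigma> (\<tau> j)) t - r (\<sigma> (\<tau> j))))\<^sup>2) \<longlonglongrightarrow> snd (snd (f t))"
      using tendsto_snd[OF tendsto_snd[OF \<tau>(2)]] by (simp add: V_def)
    have "(\<lambda>j. r (\<sigma> (\<tau> j))) \<longlonglongrightarrow> r0"
      using LIMSEQ_subseq_LIMSEQ[OF r(2) strict_mono_o[OF \<sigma>(1) \<tau>(1)]] by (simp add: o_def)
    then have "(\<lambda>j. (norm (us (\<sigma> (\<tau> j)) t - r (\<sigma> (\<tau> j))))\<^sup>2) \<longlonglongrightarrow> (norm (u t - r0))\<^sup>2"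
      by (intro tendsto_intros 1)
    then have "snd (snd (f t)) = (norm (u t - r0))\<^sup>2" using 3 LIMSEQ_unique by blast
    moreover have "u t \<in> cball ub \<eta>"
      by (rule closed_sequentially[OF closed_cball _ 1]) (use D(3)[OF t] in auto)
    moreover have "(u t, y t) \<in> gph (\<Phi> t)"
      by (rule closed_sequentially[OF closed_gph[OF t] _ tendsto_Pair[OF 1 2]])
        (use D(5)[OF t] in \<open>auto simp: gph_def\<close>)
    moreover have "norm (f t) \<le> R"
      by (rule LIMSEQ_le_const2[OF tendsto_norm[OF \<tau>(2)]]) (use V_bound[OF t] in auto)
    ultimately show ?thesis by (simp add: gph_def)
  qed
  have "u \<in> borel_measurable M" "y \<in> borel_measurable M"
  proof -
    have "(\<lambda>t. fst (f t)) \<in> borel_measurable M" "(\<lambda>t. fst (snd (f t))) \<in> borel_measurable M"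
      by (rule measurable_compose[OF f(1)], intro borel_measurable_continuous_onI continuous_intros)+
    then show "u \<in> borel_measurable M" "y \<in> borel_measurable M"
      unfolding u_def y_def using y0_meas by measurable
  qed
  then have sel': "gph_selection u y" using * by (simp add: gph_selection_def)
  have f_int: "integrable M f"
    by (rule integrable_const_bound[of _ R]) (use f(1) * in \<open>auto intro!: AE_I2\<close>)
  have lim: "(\<lambda>j. integral\<^sup>L M (V (\<sigma> j))) \<longlonglongrightarrow> integral\<^sup>L M f" using \<sigma>(2) f(3) by (simp add: o_def)
  have i2: "fst (snd (integral\<^sup>L M g)) = (\<integral>t. fst (snd (g t)) \<partial>M)"
    and i3: "snd (snd (integral\<^sup>L M g)) = (\<integral>t. snd (snd (g t)) \<partial>M)"
    if "integrable M g" for g :: "'t \<Rightarrow> 'u \<times> 'v \<times> real"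
    using integral_bounded_linear[OF bounded_linear_compose[OF bounded_linear_fst bounded_linear_snd] that]
      integral_bounded_linear[OF bounded_linear_compose[OF bounded_linear_snd bounded_linear_snd] that]
    by simp_all
  have "(\<lambda>j. (\<integral>t. ys (\<sigma> j) t - y0 t \<partial>M)) \<longlonglongrightarrow> (\<integral>t. y t - y0 t \<partial>M)"
    using tendsto_fst[OF tendsto_snd[OF lim]] unfolding i2[OF V_int] i2[OF f_int]
    by (simp only: V_def y_def fst_conv snd_conv add_diff_cancel_left')
  moreover have "(\<integral>t. ys (\<sigma> j) t - y0 t \<partial>M) = integral\<^sup>L M (ys (\<sigma> j)) - yb" for j
    by (rule Bochner_Integration.integral_diff[OF gph_selection_integrable(2)[OF sel] y0_int])
  moreover have "(\<integral>t. y t - y0 t \<partial>M) = integral\<^sup>L M y - yb"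
    by (rule Bochner_Integration.integral_diff[OF gph_selection_integrable(2)[OF sel'] y0_int])
  ultimately have "(\<lambda>j. integral\<^sup>L M (ys (\<sigma> j)) - yb) \<longlonglongrightarrow> integral\<^sup>L M y - yb"
    by simp
  from tendsto_add[OF this tendsto_const[of "yb"]]
  have A: "(\<lambda>j. integral\<^sup>L M (ys (\<sigma> j))) \<longlonglongrightarrow> integral\<^sup>L M y" by simp
  have "(\<integral>t. snd (snd (f t)) \<partial>M) = (\<integral>t. (norm (u t - r0))\<^sup>2 \<partial>M)"
    by (intro Bochner_Integration.integral_cong) (use * in auto)
  then have "(\<lambda>j. \<integral>t. (norm (us (\<sigma> j) t - r (\<sigma> j)))\<^sup>2 \<partial>M) \<longlonglongrightarrow> (\<integral>t. (norm (u t - r0))\<^sup>2 \<partial>M)"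
    using tendsto_snd[OF tendsto_snd[OF lim]] unfolding i3[OF V_int] i3[OF f_int]
    by (simp only: V_def snd_conv)
  then show ?thesis using A \<sigma>(1) sel' by blast
qed

end

section \<open>The penalised problem\<close>

lemma (in finite_measure) norm_integral_squared_le:
  fixes d :: "'a \<Rightarrow> 'b::euclidean_space"
  assumes d: "integrable M d" and d2: "integrable M (\<lambda>t. (norm (d t))\<^sup>2)"
  shows "(norm (integral\<^sup>L M d))\<^sup>2 \<le> measure M (space M) * (\<integral>t. (norm (d t))\<^sup>2 \<partial>M)"
proof (cases "measure M (space M) = 0")
  case True
  then have "space M \<in> null_sets M" by (intro null_setsI) (auto simp: emeasure_eq_measure)
  then have "AE t in M. d t = 0" by (rule AE_I') auto
  then have "integral\<^sup>L M d = 0" by (rule integral_eq_zero_AE)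
  then show ?thesis using True by simp
next
  case False
  define \<mu> where "\<mu> = measure M (space M)"
  have \<mu>: "\<mu> > 0" using False by (simp add: \<mu>_def less_le)
  define e where "e = integral\<^sup>L M d"
  have "0 \<le> (\<integral>t. (norm (\<mu> *\<^sub>R d t - e))\<^sup>2 \<partial>M)" by simp
  also have "\<dots> = (\<integral>t. \<mu>\<^sup>2 * (norm (d t))\<^sup>2 - 2 * \<mu> * (e \<bullet> d t) + (norm e)\<^sup>2 \<partial>M)"
    by (intro Bochner_Integration.integral_cong refl, unfold power2_norm_eq_inner)
      (simp add: inner_diff_left inner_diff_right inner_commute algebra_simps power2_eq_square)
  also have "\<dots> = \<mu>\<^sup>2 * (\<integral>t. (norm (d t))\<^sup>2 \<partial>M) - 2 * \<mu> * (e \<bullet> e) + \<mu> * (norm e)\<^sup>2"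
    using d d2 by (simp add: e_def \<mu>_def)
  also have "\<dots> = \<mu> * (\<mu> * (\<integral>t. (norm (d t))\<^sup>2 \<partial>M) - (norm e)\<^sup>2)"
    by (simp add: dot_square_norm power2_eq_square algebra_simps)
  finally show ?thesis using \<mu> by (simp add: zero_le_mult_iff e_def \<mu>_def)
qed

text \<open>The concave square root lies below its tangent. The smooth function \<open>sqrt (|x|\<^sup>2 + \<delta>\<^sup>2)\<close> stands in for
  the norm, and this bound keeps all optimality conditions quadratic.\<close>

lemma sqrt_norm_quadratic_bound:
  fixes x x' :: "'a::euclidean_space"
  assumes "\<delta> > 0"
  defines "s \<equiv> sqrt ((norm x)\<^sup>2 + \<delta>\<^sup>2)"
  shows "sqrt ((norm x')\<^sup>2 + \<delta>\<^sup>2) \<le> s + ((1 / s) *\<^sub>R x) \<bullet> (x' - x) + (norm (x' - x))\<^sup>2 / (2 * s)"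
    and "norm ((1 / s) *\<^sub>R x) \<le> 1" and "s > 0"
proof -
  show s: "s > 0" using assms by (simp add: s_def add_nonneg_pos)
  have "norm x \<le> s" unfolding s_def by (rule real_le_rsqrt) simp
  then show "norm ((1 / s) *\<^sub>R x) \<le> 1" using s by simp
  define s' where "s' = sqrt ((norm x')\<^sup>2 + \<delta>\<^sup>2)"
  have "0 \<le> (s' - s)\<^sup>2" by simp
  then have "2 * s * s' \<le> s\<^sup>2 + s'\<^sup>2" by (simp add: power2_diff algebra_simps)
  moreover have "s'\<^sup>2 = s\<^sup>2 + (norm x')\<^sup>2 - (norm x)\<^sup>2" by (simp add: s'_def s_def)
  moreover have "(norm x')\<^sup>2 - (norm x)\<^sup>2 = 2 * (x \<bullet> (x' - x)) + (norm (x' - x))\<^sup>2"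
    by (simp add: power2_norm_eq_inner inner_diff_left inner_diff_right inner_commute algebra_simps)
  ultimately have "2 * s * s' \<le> 2 * s\<^sup>2 + 2 * (x \<bullet> (x' - x)) + (norm (x' - x))\<^sup>2" by linarith
  then have "s' * (2 * s) \<le> 2 * s * s + 2 * (x \<bullet> (x' - x)) + (norm (x' - x))\<^sup>2"
    by (simp add: power2_eq_square mult_ac)
  then have "s' \<le> (2 * s * s + 2 * (x \<bullet> (x' - x)) + (norm (x' - x))\<^sup>2) / (2 * s)"
    using s by (simp only: pos_le_divide_eq)
  also have "\<dots> = s + ((1 / s) *\<^sub>R x) \<bullet> (x' - x) + (norm (x' - x))\<^sup>2 / (2 * s)"
    using s by (simp add: add_divide_distrib)
  finally show "sqrt ((norm x')\<^sup>2 + \<delta>\<^sup>2) \<le> s + ((1 / s) *\<^sub>R x) \<bullet> (x' - x) + (norm (x' - x))\<^sup>2 / (2 * s)"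
    by (simp add: s'_def)
qed

context Lipschitz_integrand
begin

text \<open>The square root is the smoothed distance to \<open>ub\<close>. The other two penalties measure the violation of
  \<open>\<integral>y = - g\<close> and of \<open>u t = r\<close>.\<close>

definition penalty ::
    "'u \<Rightarrow> real \<Rightarrow> real \<Rightarrow> real \<Rightarrow> real \<Rightarrow> 'u \<Rightarrow> 'v \<Rightarrow> ('t \<Rightarrow> 'u) \<Rightarrow> ('t \<Rightarrow> 'v) \<Rightarrow> real" where
  "penalty w \<epsilon> \<delta> k K r g u y =
     - (w \<bullet> (r - ub)) + \<epsilon> * sqrt ((norm (r - ub))\<^sup>2 + \<delta>\<^sup>2)
     + k * (norm (integral\<^sup>L M y + g))\<^sup>2 + K * (\<integral>t. (norm (u t - r))\<^sup>2 \<partial>M)"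

text \<open>The relaxed problem is not convex, and yet the infimum is attained, because the penalty depends on
  the selections only through the integrals that \<open>gph_selections_compact\<close> controls.\<close>

lemma penalty_minimiser:
  assumes Q: "compact Q" "Q \<noteq> {}" "\<And>r g. (r, g) \<in> Q \<Longrightarrow> norm (r - ub) \<le> \<eta>"
    and nonneg: "\<epsilon> \<ge> 0" "k \<ge> 0" "K \<ge> 0"
  shows "\<exists>r g u y. (r, g) \<in> Q \<and> gph_selection u y \<and>
    (\<forall>r' g' u' y'. (r', g') \<in> Q \<longrightarrow> gph_selection u' y' \<longrightarrow>
      penalty w \<epsilon> \<delta> k K r g u y \<le> penalty w \<epsilon> \<delta> k K r' g' u' y')"
proof -
  let ?J = "penalty w \<epsilon> \<delta> k K"
  define A where "A = {?J r g u y |r g u y. (r, g) \<in> Q \<and> gph_selection u y}"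
  have Ane: "A \<noteq> {}" using Q(2) gph_selection_base by (fastforce simp: A_def)
  have "- (norm w * \<eta>) \<le> x" if x: "x \<in> A" for x
  proof -
    obtain r g u y where *: "x = ?J r g u y" "(r, g) \<in> Q" using x unfolding A_def by blast
    have "w \<bullet> (r - ub) \<le> norm w * norm (r - ub)" by (rule norm_cauchy_schwarz)
    also have "\<dots> \<le> norm w * \<eta>" using Q(3)[OF *(2)] by (intro mult_left_mono) auto
    finally have "- (norm w * \<eta>) \<le> - (w \<bullet> (r - ub))" by simp
    moreover have "0 \<le> \<epsilon> * sqrt ((norm (r - ub))\<^sup>2 + \<delta>\<^sup>2)" using nonneg by simp
    moreover have "0 \<le> k * (norm (integral\<^sup>L M y + g))\<^sup>2" using nonneg by simp
    moreover have "0 \<le> K * (\<integral>t. (norm (u t - r))\<^sup>2 \<partial>M)" using nonneg by simp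
    ultimately show ?thesis unfolding *(1) penalty_def by linarith
  qed
  then have bA: "bdd_below A" by (rule bdd_belowI)
  have "\<exists>r g u y. (r, g) \<in> Q \<and> gph_selection u y \<and> ?J r g u y < Inf A + 1 / Suc n" for n
  proof -
    obtain x where "x \<in> A" "x < Inf A + 1 / Suc n" using cInf_lessD[OF Ane, of "Inf A + 1 / Suc n"] by auto
    then show ?thesis unfolding A_def by blast
  qed
  then obtain r g u y where s: "\<And>n. (r n, g n) \<in> Q" "\<And>n. gph_selection (u n) (y n)"
    "\<And>n. ?J (r n) (g n) (u n) (y n) < Inf A + 1 / Suc n"
    by metis
  obtain q \<sigma> where \<sigma>: "q \<in> Q" "strict_mono (\<sigma> :: nat \<Rightarrow> nat)" "((\<lambda>n. (r n, g n)) \<circ> \<sigma>) \<longlonglongrightarrow> q"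
    using Q(1) s(1) unfolding compact_def by (metis (no_types, lifting))
  have rlim: "(\<lambda>n. r (\<sigma> n)) \<longlonglongrightarrow> fst q" and glim: "(\<lambda>n. g (\<sigma> n)) \<longlonglongrightarrow> snd q"
    using tendsto_fst[OF \<sigma>(3)] tendsto_snd[OF \<sigma>(3)] by (simp_all add: o_def)
  obtain \<tau> u' y' where \<tau>: "strict_mono (\<tau> :: nat \<Rightarrow> nat)" "gph_selection u' y'"
    "(\<lambda>j. integral\<^sup>L M (y (\<sigma> (\<tau> j)))) \<longlonglongrightarrow> integral\<^sup>L M y'"
    "(\<lambda>j. \<integral>t. (norm (u (\<sigma> (\<tau> j)) t - r (\<sigma> (\<tau> j))))\<^sup>2 \<partial>M) \<longlonglongrightarrow> (\<integral>t. (norm (u' t - fst q))\<^sup>2 \<partial>M)"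
    using gph_selections_compact[of "\<lambda>n. u (\<sigma> n)" "\<lambda>n. y (\<sigma> n)" "\<lambda>n. r (\<sigma> n)" "fst q"]
      s(2) Q(3)[OF s(1)] rlim by blast
  have rlim': "(\<lambda>n. r (\<sigma> (\<tau> n))) \<longlonglongrightarrow> fst q" and glim': "(\<lambda>n. g (\<sigma> (\<tau> n))) \<longlonglongrightarrow> snd q"
    using LIMSEQ_subseq_LIMSEQ[OF rlim \<tau>(1)] LIMSEQ_subseq_LIMSEQ[OF glim \<tau>(1)] by (simp_all add: o_def)
  have "(\<lambda>j. ?J (r (\<sigma> (\<tau> j))) (g (\<sigma> (\<tau> j))) (u (\<sigma> (\<tau> j))) (y (\<sigma> (\<tau> j)))) \<longlonglongrightarrow> ?J (fst q) (snd q) u' y'"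
    unfolding penalty_def by (intro tendsto_intros rlim' glim' \<tau>(3,4))
  moreover have "(\<lambda>j. Inf A + 1 / Suc (\<sigma> (\<tau> j))) \<longlonglongrightarrow> Inf A + 0"
  proof (intro tendsto_add tendsto_const)
    have "(\<lambda>j. inverse (real (Suc (\<sigma> (\<tau> j))))) \<longlonglongrightarrow> 0"
      using LIMSEQ_subseq_LIMSEQ[OF LIMSEQ_inverse_real_of_nat strict_mono_o[OF \<sigma>(2) \<tau>(1)]]
      by (simp add: o_def)
    then show "(\<lambda>j. 1 / real (Suc (\<sigma> (\<tau> j)))) \<longlonglongrightarrow> 0" by (simp add: inverse_eq_divide)
  qed
  ultimately have "?J (fst q) (snd q) u' y' \<le> Inf A + 0"
    by (rule LIMSEQ_le) (use s(3) in \<open>auto intro: less_imp_le\<close>)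
  moreover have "Inf A \<le> ?J r' g' u' y'" if "(r', g') \<in> Q" "gph_selection u' y'" for r' g' u' y'
    by (rule cInf_lower[OF _ bA]) (use that in \<open>auto simp: A_def\<close>)
  ultimately have "\<forall>r1 g1 u1 y1. (r1, g1) \<in> Q \<longrightarrow> gph_selection u1 y1 \<longrightarrow>
      ?J (fst q) (snd q) u' y' \<le> ?J r1 g1 u1 y1" by fastforce
  then show ?thesis
    using \<sigma>(1) \<tau>(2) by (intro exI[of _ "fst q"] exI[of _ "snd q"] exI[of _ u'] exI[of _ y']) simp
qed

text \<open>Optimality in \<open>(r, g)\<close> alone. The penalty is bounded above by a quadratic function that touches it at
  \<open>(r, g)\<close>, so the negative gradient is a proximal normal.\<close>

lemma penalty_outer_normal:
  assumes \<Gamma>: "(r, g) \<in> \<Gamma>" and d: "d > 0" and pos: "\<epsilon> \<ge> 0" "\<delta> > 0" "k > 0" "K > 0"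
    and r: "norm (r - ub) < \<eta>" and sel: "gph_selection u y"
    and min: "\<And>r' g'. (r', g') \<in> \<Gamma> \<Longrightarrow> dist (r', g') (r, g) < d \<Longrightarrow>
      penalty w \<epsilon> \<delta> k K r g u y \<le> penalty w \<epsilon> \<delta> k K r' g' u y"
  shows "\<exists>\<xi>. norm \<xi> \<le> 1 \<and>
    (w - \<epsilon> *\<^sub>R \<xi> - (\<integral>t. (2 * K) *\<^sub>R (r - u t) \<partial>M), - ((2 * k) *\<^sub>R (integral\<^sup>L M y + g)))
      \<in> regular_normal_cone \<Gamma> (r, g)"
proof -
  define s where "s = sqrt ((norm (r - ub))\<^sup>2 + \<delta>\<^sup>2)"
  define \<xi> where "\<xi> = (1 / s) *\<^sub>R (r - ub)"
  note sq = sqrt_norm_quadratic_bound[OF pos(2), where x="r - ub", folded s_def, folded \<xi>_def]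
  define \<mu> where "\<mu> = measure M (space M)"
  define a where "a = integral\<^sup>L M y + g"
  define v where "v t = (2 * K) *\<^sub>R (r - u t)" for t
  define c where "c = \<epsilon> / (2 * s) + k + K * \<mu>"
  note D = gph_selectionD[OF sel]
  have u_int: "integrable M u" using gph_selection_integrable[OF sel] by blast
  have v_int: "integrable M v" unfolding v_def using u_int by simp
  have "(w - \<epsilon> *\<^sub>R \<xi> - integral\<^sup>L M v, - ((2 * k) *\<^sub>R a)) \<in> regular_normal_cone \<Gamma> (r, g)"
  proof (rule proximal_normal_imp_regular[OF \<Gamma>, of "min d (\<eta> - norm (r - ub))"])
    show "0 < min d (\<eta> - norm (r - ub))" using d r by simp
    fix x :: "'u \<times> 'v" assume x: "x \<in> \<Gamma>" "dist x (r, g) < min d (\<eta> - norm (r - ub))"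
    obtain r' g' where x': "x = (r', g')" by (cases x)
    define h where "h = r' - r"
    define e where "e = g' - g"
    have he: "r' = r + h" "g' = g + e" by (simp_all add: h_def e_def)
    have "norm h \<le> dist x (r, g)" using norm_fst_le[of h e] by (simp add: x' h_def e_def dist_norm)
    then have r': "norm (r' - ub) \<le> \<eta>"
      using x(2) norm_triangle_ineq[of "r - ub" h] by (simp add: he algebra_simps)
    have n2: "(norm (x - (r, g)))\<^sup>2 = (norm h)\<^sup>2 + (norm e)\<^sup>2"
      by (simp add: x' h_def e_def norm_Pair)
    have S: "sqrt ((norm (r' - ub))\<^sup>2 + \<delta>\<^sup>2) \<le> s + \<xi> \<bullet> h + (norm h)\<^sup>2 / (2 * s)"
      using sq(1)[where x'="r' - ub"] by (simp add: h_def)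
    have A: "(norm (integral\<^sup>L M y + g'))\<^sup>2 = (norm a)\<^sup>2 + 2 * (a \<bullet> e) + (norm e)\<^sup>2"
      by (simp add: a_def he power2_norm_eq_inner inner_add_left inner_add_right inner_commute algebra_simps)
    have I: "(\<integral>t. (norm (u t - r'))\<^sup>2 \<partial>M) = (\<integral>t. (norm (u t - r))\<^sup>2 \<partial>M) + (1 / K) * (h \<bullet> integral\<^sup>L M v) + \<mu> * (norm h)\<^sup>2"
    proof -
      have "(\<integral>t. (norm (u t - r'))\<^sup>2 \<partial>M) = (\<integral>t. (norm (u t - r))\<^sup>2 + (1 / K) * (h \<bullet> v t) + (norm h)\<^sup>2 \<partial>M)"
        by (intro Bochner_Integration.integral_cong refl)
          (use pos in \<open>simp add: v_def he power2_norm_eq_inner inner_diff_left inner_diff_right inner_add_left inner_add_right inner_commute field_simps\<close>)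
      also have "\<dots> = (\<integral>t. (norm (u t - r))\<^sup>2 \<partial>M) + (1 / K) * (h \<bullet> integral\<^sup>L M v) + \<mu> * (norm h)\<^sup>2"
        using gph_selection_sq_integrable(1)[OF sel, of r] r v_int by (simp add: \<mu>_def)
      finally show ?thesis .
    qed
    have "penalty w \<epsilon> \<delta> k K r g u y \<le> penalty w \<epsilon> \<delta> k K r' g' u y"
      using min x by (simp add: x')
    also have "\<dots> \<le> - (w \<bullet> (r' - ub)) + \<epsilon> * (s + \<xi> \<bullet> h + (norm h)\<^sup>2 / (2 * s))
        + k * ((norm a)\<^sup>2 + 2 * (a \<bullet> e) + (norm e)\<^sup>2)
        + K * ((\<integral>t. (norm (u t - r))\<^sup>2 \<partial>M) + (1 / K) * (h \<bullet> integral\<^sup>L M v) + \<mu> * (norm h)\<^sup>2)"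
      unfolding penalty_def A I using mult_left_mono[OF S pos(1)] by simp
    finally have "w \<bullet> h - \<epsilon> * (\<xi> \<bullet> h) - h \<bullet> integral\<^sup>L M v - 2 * k * (a \<bullet> e)
        \<le> \<epsilon> * ((norm h)\<^sup>2 / (2 * s)) + k * (norm e)\<^sup>2 + K * (\<mu> * (norm h)\<^sup>2)"
      unfolding penalty_def a_def[symmetric] s_def[symmetric] using pos
      by (simp add: he inner_add_right inner_diff_right algebra_simps)
    moreover have "\<epsilon> * ((norm h)\<^sup>2 / (2 * s)) + k * (norm e)\<^sup>2 + K * (\<mu> * (norm h)\<^sup>2)
        \<le> c * ((norm h)\<^sup>2 + (norm e)\<^sup>2)"
    proof -
      have "0 \<le> \<epsilon> / (2 * s) * (norm e)\<^sup>2" "0 \<le> k * (norm h)\<^sup>2" "0 \<le> K * \<mu> * (norm e)\<^sup>2"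
        using pos sq(3) by (auto simp: \<mu>_def)
      then show ?thesis unfolding c_def by (simp add: algebra_simps)
    qed
    ultimately show "(w - \<epsilon> *\<^sub>R \<xi> - integral\<^sup>L M v, - ((2 * k) *\<^sub>R a)) \<bullet> (x - (r, g)) \<le> c * (norm (x - (r, g)))\<^sup>2"
      unfolding n2 by (simp add: x' he inner_diff_left inner_commute[of h])
  qed
  then show ?thesis using sq(2) unfolding v_def a_def by blast
qed

text \<open>Optimality in the selections, localised in \<open>t\<close>. Only the term \<open>k |\<integral>y + g|\<^sup>2\<close> couples different \<open>t\<close>. When \<open>y\<close>
  changes by \<open>d\<close>, it changes by \<open>p \<bullet> \<integral>d + k |\<integral>d|\<^sup>2\<close>, and by the Cauchy-Schwarz inequality
  \<open>|\<integral>d|\<^sup>2 \<le> \<mu> \<integral>|d|\<^sup>2\<close>, where \<open>\<mu>\<close> is the total mass. The resulting bound is an integral over \<open>t\<close>. If its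
  integrand could be made negative on a set of positive measure, a measurable selection of the better points
  would lower the penalty.\<close>

lemma penalty_pointwise:
  assumes pos: "k > 0" "K > 0" and r: "norm (r - ub) \<le> \<eta>" and sel: "gph_selection u y"
    and min: "\<And>u' y'. gph_selection u' y' \<Longrightarrow>
      penalty w \<epsilon> \<delta> k K r g u y \<le> penalty w \<epsilon> \<delta> k K r g u' y'"
  defines "p \<equiv> (2 * k) *\<^sub>R (integral\<^sup>L M y + g)"
  shows "AE t in M. \<forall>u'\<in>cball ub \<eta>. \<forall>y'\<in>\<Phi> t u'.
    0 \<le> p \<bullet> (y' - y t) + k * measure M (space M) * (norm (y' - y t))\<^sup>2
          + K * (norm (u' - r))\<^sup>2 - K * (norm (u t - r))\<^sup>2"
proof -
  define \<mu> where "\<mu> = measure M (space M)"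
  note D = gph_selectionD[OF sel]
  define q where "q t w = p \<bullet> (snd w - y t) + k * \<mu> * (norm (snd w - y t))\<^sup>2
          + K * (norm (fst w - r))\<^sup>2 - K * (norm (u t - r))\<^sup>2" for t and w :: "'u \<times> 'v"
  have ymeas: "(\<lambda>w. y (fst w)) \<in> borel_measurable (M \<Otimes>\<^sub>M (borel :: ('u \<times> 'v) measure))"
    and umeas: "(\<lambda>w. u (fst w)) \<in> borel_measurable (M \<Otimes>\<^sub>M (borel :: ('u \<times> 'v) measure))"
    using D(1,2) by measurable
  have fmeas: "(\<lambda>w. fst (snd w)) \<in> borel_measurable (M \<Otimes>\<^sub>M (borel :: ('u \<times> 'v) measure))"
    and smeas: "(\<lambda>w. snd (snd w)) \<in> borel_measurable (M \<Otimes>\<^sub>M (borel :: ('u \<times> 'v) measure))"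
    by (rule measurable_compose[OF measurable_snd], intro borel_measurable_continuous_onI continuous_intros)+
  have qmeas: "(\<lambda>w. q (fst w) (snd w)) \<in> borel_measurable (M \<Otimes>\<^sub>M (borel :: ('u \<times> 'v) measure))"
    unfolding q_def using ymeas umeas fmeas smeas by measurable
  \<comment> \<open>The closed condition \<open>\<le> - (1 / Suc n)\<close> instead of \<open>< 0\<close> keeps the sections compact.\<close>
  define F where "F n t = {w\<in>gph (\<Phi> t). fst w \<in> cball ub \<eta> \<and> q t w \<le> - (1 / Suc n)}" for n :: nat and t
  have Fm: "measurable_graph M (F n)" for n
    unfolding F_def
  proof (intro measurable_graph_Collect[OF graph] pred_intros_logic)
    show "Measurable.pred (M \<Otimes>\<^sub>M (borel :: ('u \<times> 'v) measure)) (\<lambda>w. fst (snd w) \<in> cball ub \<eta>)"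
      by (rule pred_sets2[OF _ fmeas]) simp
    show "Measurable.pred (M \<Otimes>\<^sub>M (borel :: ('u \<times> 'v) measure)) (\<lambda>w. q (fst w) (snd w) \<le> - (1 / real (Suc n)))"
      using borel_measurable_le[OF qmeas borel_measurable_const] by (simp add: pred_def)
  qed
  have Fc: "compact (F n t)" if t: "t \<in> space M" for n t
  proof -
    have "closed {w. q t w \<le> - (1 / Suc n)}"
      unfolding q_def by (intro closed_Collect_le continuous_intros)
    moreover have "F n t = gph (\<Phi> t) \<inter> (cball ub \<eta> \<times> cball (y0 t) (l * \<eta>)) \<inter> {w. q t w \<le> - (1 / Suc n)}"
    proof -
      have "y' \<in> cball (y0 t) (l * \<eta>)" if "u' \<in> cball ub \<eta>" "y' \<in> \<Phi> t u'" for u' y'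
      proof -
        have "norm (y' - y0 t) \<le> l * norm (u' - ub)" using near[OF t that] .
        also have "\<dots> \<le> l * \<eta>" using that(1) l by (intro mult_left_mono) (auto simp: dist_norm norm_minus_commute)
        finally show ?thesis by (simp add: dist_norm norm_minus_commute)
      qed
      then show ?thesis unfolding F_def gph_def by auto
    qed
    moreover have "compact (gph (\<Phi> t) \<inter> (cball ub \<eta> \<times> cball (y0 t) (l * \<eta>)))"
      by (intro closed_Int_compact closed_gph[OF t] compact_Times compact_cball)
    ultimately show ?thesis by (simp add: compact_Int_closed)
  qed
  have null: "AE t in M. F n t = {}" for n
  proof -
    obtain f where f: "f \<in> borel_measurable M" "\<And>t. t \<in> space M \<Longrightarrow> F n t \<noteq> {} \<Longrightarrow> f t \<in> F n t"
      using measurable_selection[OF Fm Fc, of n] by blast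
    define A where "A = {t\<in>space M. F n t \<noteq> {}}"
    have A: "A \<in> sets M"
    proof -
      have "Measurable.pred M (\<lambda>t. \<exists>w. w \<in> F n t)"
        using Fm[of n] unfolding measurable_graph_def by (rule pred_Ex_borel)
      moreover have "A = {t\<in>space M. \<exists>w. w \<in> F n t}" by (auto simp: A_def)
      ultimately show ?thesis by (simp add: pred_def)
    qed
    define u' where "u' t = (if t \<in> A then fst (f t) else u t)" for t
    define y' where "y' t = (if t \<in> A then snd (f t) else y t)" for t
    have fA: "f t \<in> gph (\<Phi> t)" "fst (f t) \<in> cball ub \<eta>" "q t (f t) \<le> - (1 / Suc n)" if "t \<in> A" for t
      using f(2)[of t] that by (auto simp: A_def F_def)
    have "(\<lambda>t. fst (f t)) \<in> borel_measurable M" "(\<lambda>t. snd (f t)) \<in> borel_measurable M"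
      by (rule measurable_compose[OF f(1)], intro borel_measurable_continuous_onI continuous_intros)+
    then have "u' \<in> borel_measurable M" "y' \<in> borel_measurable M"
      unfolding u'_def y'_def using A D(1,2) by (auto intro!: measurable_If_set)
    moreover have "u' t \<in> cball ub \<eta> \<and> y' t \<in> \<Phi> t (u' t)" if "t \<in> space M" for t
      using fA[of t] D(3,5)[OF that] by (auto simp: u'_def y'_def gph_def split: prod.splits)
    ultimately have sel': "gph_selection u' y'" by (simp add: gph_selection_def)
    note D' = gph_selectionD[OF sel']
    define d where "d t = y' t - y t" for t
    have dbound: "norm (d t) \<le> 2 * (l * \<eta>)" if "t \<in> space M" for t
      using D(7)[OF that] D'(7)[OF that] norm_triangle_ineq4[of "y' t - y0 t" "y t - y0 t"]
      by (simp add: d_def)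
    have dmeas: "d \<in> borel_measurable M" unfolding d_def using D(2) D'(2) by measurable
    have dint: "integrable M d"
      by (rule integrable_const_bound[of _ "2 * (l * \<eta>)"]) (use dbound dmeas in \<open>auto intro!: AE_I2\<close>)
    have d2int: "integrable M (\<lambda>t. (norm (d t))\<^sup>2)"
    proof (rule integrable_const_bound[of _ "(2 * (l * \<eta>))\<^sup>2"])
      show "AE t in M. norm ((norm (d t))\<^sup>2) \<le> (2 * (l * \<eta>))\<^sup>2"
      proof (rule AE_I2)
        fix t assume "t \<in> space M"
        then have "(norm (d t))\<^sup>2 \<le> (2 * (l * \<eta>))\<^sup>2" using dbound by (intro power_mono) auto
        then show "norm ((norm (d t))\<^sup>2) \<le> (2 * (l * \<eta>))\<^sup>2" by simp
      qed
    qed (use dmeas in measurable)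
    have Id: "integral\<^sup>L M y' = integral\<^sup>L M y + integral\<^sup>L M d"
      unfolding d_def using gph_selection_integrable(2)[OF sel] gph_selection_integrable(2)[OF sel']
      by (simp add: Bochner_Integration.integral_diff)
    define a where "a = integral\<^sup>L M y + g"
    have "(norm (integral\<^sup>L M y' + g))\<^sup>2 = (norm a)\<^sup>2 + 2 * (a \<bullet> integral\<^sup>L M d) + (norm (integral\<^sup>L M d))\<^sup>2"
      by (simp add: a_def Id power2_norm_eq_inner inner_add_left inner_add_right inner_commute algebra_simps)
    then have up: "(norm (integral\<^sup>L M y' + g))\<^sup>2 \<le> (norm a)\<^sup>2 + 2 * (a \<bullet> integral\<^sup>L M d) + \<mu> * (\<integral>t. (norm (d t))\<^sup>2 \<partial>M)"
      using norm_integral_squared_le[OF dint d2int] by (simp add: \<mu>_def)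
    note S = gph_selection_sq_integrable(1)[OF sel r] and S' = gph_selection_sq_integrable(1)[OF sel' r]
    have "0 \<le> penalty w \<epsilon> \<delta> k K r g u' y' - penalty w \<epsilon> \<delta> k K r g u y" using min[OF sel'] by simp
    also have "\<dots> = k * ((norm (integral\<^sup>L M y' + g))\<^sup>2 - (norm a)\<^sup>2)
        + K * ((\<integral>t. (norm (u' t - r))\<^sup>2 \<partial>M) - (\<integral>t. (norm (u t - r))\<^sup>2 \<partial>M))"
      by (simp add: penalty_def a_def algebra_simps)
    also have "\<dots> \<le> k * (2 * (a \<bullet> integral\<^sup>L M d) + \<mu> * (\<integral>t. (norm (d t))\<^sup>2 \<partial>M))
        + K * ((\<integral>t. (norm (u' t - r))\<^sup>2 \<partial>M) - (\<integral>t. (norm (u t - r))\<^sup>2 \<partial>M))"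
      using up pos by (intro add_mono mult_left_mono) auto
    also have "\<dots> = (\<integral>t. p \<bullet> d t + k * \<mu> * (norm (d t))\<^sup>2 + (K * (norm (u' t - r))\<^sup>2 - K * (norm (u t - r))\<^sup>2) \<partial>M)"
      using dint d2int S S' by (simp add: p_def a_def algebra_simps)
    also have "\<dots> \<le> (\<integral>t. indicat_real A t * (- (1 / Suc n)) \<partial>M)"
    proof (rule integral_mono)
      show "integrable M (\<lambda>t. p \<bullet> d t + k * \<mu> * (norm (d t))\<^sup>2 + (K * (norm (u' t - r))\<^sup>2 - K * (norm (u t - r))\<^sup>2))"
        using dint d2int S S' by simp
      show "integrable M (\<lambda>t. indicat_real A t * (- (1 / real (Suc n))))"
        using A by (simp add: less_top[symmetric])
      fix t assume "t \<in> space M"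
      show "p \<bullet> d t + k * \<mu> * (norm (d t))\<^sup>2 + (K * (norm (u' t - r))\<^sup>2 - K * (norm (u t - r))\<^sup>2)
          \<le> indicat_real A t * (- (1 / real (Suc n)))"
      proof (cases "t \<in> A")
        case True
        then show ?thesis using fA(3)[OF True] by (simp add: q_def d_def u'_def y'_def)
      next
        case False
        then show ?thesis by (simp add: d_def u'_def y'_def)
      qed
    qed
    also have "\<dots> = - (measure M A / Suc n)" using A by simp
    finally have "measure M A = 0"
      using measure_nonneg[of M A] by (simp add: field_simps)
    then have "A \<in> null_sets M" using A by (intro null_setsI) (simp_all add: emeasure_eq_measure)
    then show ?thesis by (rule AE_I') (auto simp: A_def)
  qed
  have "AE t in M. \<forall>n. F n t = {}" using null by (simp add: AE_all_countable)
  then show ?thesis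
  proof eventually_elim
    case (elim t)
    show ?case
    proof (intro ballI)
      fix u' y' assume *: "u' \<in> cball ub \<eta>" "y' \<in> \<Phi> t u'"
      have "0 \<le> q t (u', y')"
      proof (rule ccontr)
        assume "\<not> ?thesis"
        then obtain n where "1 / Suc n < - q t (u', y')" using nat_approx_posE[of "- q t (u', y')"] by auto
        then have "(u', y') \<in> F n t" using * by (simp add: F_def gph_def)
        then show False using elim by blast
      qed
      then show "0 \<le> p \<bullet> (y' - y t) + k * measure M (space M) * (norm (y' - y t))\<^sup>2
          + K * (norm (u' - r))\<^sup>2 - K * (norm (u t - r))\<^sup>2"
        by (simp add: q_def \<mu>_def)
    qed
  qed
qed

end

context Lipschitz_integrand
begin

text \<open>The ratio \<open>K / k\<close>. Its second summand absorbs the term \<open>k \<mu> |d t|\<^sup>2 \<le> k \<mu> l\<^sup>2 |u t - r|\<^sup>2\<close> of the pointwise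
  inequality when the points \<open>u t\<close> are compared with \<open>r\<close>.\<close>

definition penalty_weight :: real where
  "penalty_weight = 1 + measure M (space M) * l\<^sup>2"

lemma penalty_weight_ge1: "1 \<le> penalty_weight"
  by (simp add: penalty_weight_def)

text \<open>Testing the pointwise inequality at \<open>u' = r\<close>, where the Lipschitz property provides a value close to
  \<open>y t\<close>, bounds \<open>|u t - r|\<close> uniformly in \<open>t\<close>, and with it \<open>v t = 2 K (r - u t)\<close>. Read at arbitrary
  points of the graph, the inequality says that \<open>(v t, - p)\<close> is a proximal normal.\<close>

lemma penalty_inner_normals:
  assumes pos: "k > 0" and K: "K = k * penalty_weight" and r: "norm (r - ub) \<le> \<eta>"
    and sel: "gph_selection u y"
    and min: "\<And>u' y'. gph_selection u' y' \<Longrightarrow>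
      penalty w \<epsilon> \<delta> k K r g u y \<le> penalty w \<epsilon> \<delta> k K r g u' y'"
  defines "p \<equiv> (2 * k) *\<^sub>R (integral\<^sup>L M y + g)"
  shows "AE t in M. norm (u t - r) \<le> 2 * l * norm (integral\<^sup>L M y + g)"
    and "AE t in M. norm ((2 * K) *\<^sub>R (r - u t)) \<le> 2 * l * penalty_weight * norm p"
    and "AE t in M. norm (u t - ub) < \<eta> \<longrightarrow>
      ((2 * K) *\<^sub>R (r - u t), - p) \<in> regular_normal_cone (gph (\<Phi> t)) (u t, y t)"
proof -
  define \<mu> where "\<mu> = measure M (space M)"
  define a where "a = integral\<^sup>L M y + g"
  have Kpos: "K > 0" using pos penalty_weight_ge1 by (simp add: K)
  have \<mu>: "0 \<le> \<mu>" by (simp add: \<mu>_def)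
  note D = gph_selectionD[OF sel]
  have rin: "r \<in> cball ub \<eta>" using r by (simp add: dist_norm norm_minus_commute)
  have ineq: "AE t in M. \<forall>u'\<in>cball ub \<eta>. \<forall>y'\<in>\<Phi> t u'.
    0 \<le> p \<bullet> (y' - y t) + k * \<mu> * (norm (y' - y t))\<^sup>2 + K * (norm (u' - r))\<^sup>2 - K * (norm (u t - r))\<^sup>2"
    unfolding p_def \<mu>_def by (rule penalty_pointwise[OF pos Kpos r sel min])
  have p: "norm p = 2 * k * norm a" using pos by (simp add: p_def a_def)
  show dist: "AE t in M. norm (u t - r) \<le> 2 * l * norm (integral\<^sup>L M y + g)"
    using ineq AE_space
  proof eventually_elim
    case (elim t)
    define x where "x = norm (u t - r)"
    have x0: "0 \<le> x" by (simp add: x_def)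
    obtain y' where y': "y' \<in> \<Phi> t r" "norm (y' - y t) \<le> l * norm (r - u t)"
      using Lip[OF elim(2) D(3)[OF elim(2)] rin D(5)[OF elim(2)]] by blast
    have y'x: "norm (y' - y t) \<le> l * x" using y' by (simp add: x_def norm_minus_commute)
    have "p \<bullet> (y' - y t) \<le> norm p * norm (y' - y t)" by (rule norm_cauchy_schwarz)
    also have "\<dots> \<le> 2 * k * norm a * (l * x)" unfolding p using y'x pos by (intro mult_left_mono) auto
    finally have 1: "p \<bullet> (y' - y t) \<le> 2 * k * norm a * (l * x)" .
    have "k * \<mu> * (norm (y' - y t))\<^sup>2 \<le> k * \<mu> * (l * x)\<^sup>2"
      using y'x pos \<mu> by (intro mult_left_mono power_mono) auto
    moreover have "0 \<le> p \<bullet> (y' - y t) + k * \<mu> * (norm (y' - y t))\<^sup>2 - K * x\<^sup>2"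
      using elim(1) rin y'(1) by (fastforce simp: x_def)
    ultimately have "K * x\<^sup>2 \<le> 2 * k * norm a * (l * x) + k * \<mu> * (l * x)\<^sup>2" using 1 by linarith
    then have "k * (x * x) \<le> k * (2 * l * norm a * x)"
      by (simp add: K penalty_weight_def \<mu>_def power2_eq_square algebra_simps)
    then have "x * x \<le> 2 * l * norm a * x" using pos by simp
    then show ?case using x0 l unfolding x_def[symmetric] a_def[symmetric]
      by (cases "x = 0") auto
  qed
  show "AE t in M. norm ((2 * K) *\<^sub>R (r - u t)) \<le> 2 * l * penalty_weight * norm p"
    using dist
  proof eventually_elim
    case (elim t)
    have "norm ((2 * K) *\<^sub>R (r - u t)) = 2 * K * norm (u t - r)"
      using Kpos by (simp add: norm_minus_commute)
    also have "\<dots> \<le> 2 * K * (2 * l * norm a)"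
      using elim Kpos by (intro mult_left_mono) (auto simp: a_def)
    finally show ?case by (simp add: p K mult_ac)
  qed
  show "AE t in M. norm (u t - ub) < \<eta> \<longrightarrow>
      ((2 * K) *\<^sub>R (r - u t), - p) \<in> regular_normal_cone (gph (\<Phi> t)) (u t, y t)"
    using ineq AE_space
  proof eventually_elim
    case (elim t)
    show ?case
    proof
      assume int: "norm (u t - ub) < \<eta>"
      show "((2 * K) *\<^sub>R (r - u t), - p) \<in> regular_normal_cone (gph (\<Phi> t)) (u t, y t)"
      proof (rule proximal_normal_imp_regular[where d="\<eta> - norm (u t - ub)" and c="K + k * \<mu>"])
        show "(u t, y t) \<in> gph (\<Phi> t)" using D(5)[OF elim(2)] by (simp add: gph_def)
        show "0 < \<eta> - norm (u t - ub)" using int by simp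
        fix x assume x: "x \<in> gph (\<Phi> t)" "dist x (u t, y t) < \<eta> - norm (u t - ub)"
        obtain u' y' where x': "x = (u', y')" by (cases x)
        define h where "h = u' - u t"
        define e where "e = y' - y t"
        have he: "u' = u t + h" by (simp add: h_def)
        have "norm h \<le> dist x (u t, y t)" using norm_fst_le[of h e] by (simp add: x' h_def e_def dist_norm)
        then have "norm (u' - ub) \<le> \<eta>"
          using x(2) norm_triangle_ineq[of "u t - ub" h] by (simp add: he algebra_simps)
        then have "u' \<in> cball ub \<eta>" by (simp add: dist_norm norm_minus_commute)
        moreover have "y' \<in> \<Phi> t u'" using x(1) by (simp add: x' gph_def)
        ultimately have "0 \<le> p \<bullet> e + k * \<mu> * (norm e)\<^sup>2 + K * (norm (u' - r))\<^sup>2 - K * (norm (u t - r))\<^sup>2"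
          using elim(1) by (simp add: e_def)
        also have "(norm (u' - r))\<^sup>2 = (norm (u t - r))\<^sup>2 + 2 * ((u t - r) \<bullet> h) + (norm h)\<^sup>2"
          by (simp add: he power2_norm_eq_inner inner_add_left inner_add_right inner_diff_left inner_diff_right inner_commute algebra_simps)
        finally have 1: "(2 * K) * ((r - u t) \<bullet> h) - p \<bullet> e \<le> K * (norm h)\<^sup>2 + k * \<mu> * (norm e)\<^sup>2"
          by (simp add: inner_diff_left algebra_simps)
        have "0 \<le> k * \<mu> * (norm h)\<^sup>2" "0 \<le> K * (norm e)\<^sup>2" using pos \<mu> Kpos by auto
        then have "K * (norm h)\<^sup>2 + k * \<mu> * (norm e)\<^sup>2 \<le> (K + k * \<mu>) * ((norm h)\<^sup>2 + (norm e)\<^sup>2)"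
          by (simp add: algebra_simps)
        also have "(norm h)\<^sup>2 + (norm e)\<^sup>2 = (norm (x - (u t, y t)))\<^sup>2"
          by (simp add: x' h_def e_def norm_Pair)
        finally show "((2 * K) *\<^sub>R (r - u t), - p) \<bullet> (x - (u t, y t)) \<le> (K + k * \<mu>) * (norm (x - (u t, y t)))\<^sup>2"
          using 1 by (simp add: x' h_def[symmetric] e_def[symmetric])
      qed
    qed
  qed
qed

definition feasible_set :: "('u \<times> 'v) set \<Rightarrow> 'u set" where
  "feasible_set \<Gamma> = {r. \<exists>y. integrable M y \<and> (AE t in M. y t \<in> \<Phi> t r) \<and> (r, - integral\<^sup>L M y) \<in> \<Gamma>}"

text \<open>Along growing \<open>k\<close> the penalised quantities tend to zero, so by \<open>gph_selections_compact\<close> every cluster point of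
  the minimisers is feasible for the problem without relaxation. There the assumption \<open>loc\<close> makes \<open>ub\<close> the
  only candidate.\<close>

lemma penalty_minimisers_converge:
  fixes \<Gamma> :: "('u \<times> 'v) set"
  assumes \<Gamma>: "closed \<Gamma>" "(ub, - yb) \<in> \<Gamma>"
    and \<rho>: "0 < \<rho>" "\<rho> \<le> \<eta>" and \<epsilon>: "\<epsilon> > 0" and \<beta>: "\<beta> > 0"
    and loc: "\<forall>r\<in>feasible_set \<Gamma>. norm (r - ub) \<le> \<rho> \<longrightarrow> w \<bullet> (r - ub) \<le> \<epsilon> / 2 * norm (r - ub)"
  shows "\<exists>\<delta> k r g u y. \<delta> > 0 \<and> k > 0 \<and> (r, g) \<in> \<Gamma> \<and> gph_selection u y \<and>
     dist (r, g) (ub, - yb) < \<beta> \<and> norm (integral\<^sup>L M y + g) < \<beta> \<and>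
     (\<forall>r' g' u' y'. (r', g') \<in> \<Gamma> \<longrightarrow> dist (r', g') (ub, - yb) \<le> \<rho> \<longrightarrow> gph_selection u' y' \<longrightarrow>
        penalty w \<epsilon> \<delta> k (k * penalty_weight) r g u y \<le> penalty w \<epsilon> \<delta> k (k * penalty_weight) r' g' u' y')"
proof -
  define Q where "Q = cball (ub, - yb) \<rho> \<inter> \<Gamma>"
  have Q: "compact Q" unfolding Q_def using \<Gamma>(1) by (intro compact_Int_closed compact_cball)
  have base: "(ub, - yb) \<in> Q" using \<Gamma>(2) \<rho> by (simp add: Q_def)
  have Qr: "norm (r - ub) \<le> \<rho>" if "(r, g) \<in> Q" for r g
  proof -
    have "norm (r - ub) \<le> norm (r - ub, g + yb)" by (rule norm_fst_le)
    also have "\<dots> = dist (ub, - yb) (r, g)" by (subst dist_commute) (simp add: dist_norm)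
    finally show ?thesis using that by (simp add: Q_def)
  qed
  define k where "k n = real (Suc n)" for n
  define \<delta> where "\<delta> n = 1 / real (Suc n)" for n
  let ?J = "\<lambda>n. penalty w \<epsilon> (\<delta> n) (k n) (k n * penalty_weight)"
  have kpos: "k n > 0" "k n * penalty_weight \<ge> k n" for n
    using penalty_weight_ge1 by (auto simp: k_def)
  have "\<forall>n. \<exists>r g u y. (r, g) \<in> Q \<and> gph_selection u y \<and>
    (\<forall>r' g' u' y'. (r', g') \<in> Q \<longrightarrow> gph_selection u' y' \<longrightarrow> ?J n r g u y \<le> ?J n r' g' u' y')"
  proof
    fix n show "\<exists>r g u y. (r, g) \<in> Q \<and> gph_selection u y \<and>
      (\<forall>r' g' u' y'. (r', g') \<in> Q \<longrightarrow> gph_selection u' y' \<longrightarrow> ?J n r g u y \<le> ?J n r' g' u' y')"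
    proof (rule penalty_minimiser[OF Q])
      show "Q \<noteq> {}" using base by blast
      show "norm (r - ub) \<le> \<eta>" if "(r, g) \<in> Q" for r g using Qr[OF that] \<rho> by simp
    qed (use \<epsilon> kpos(1)[of n] kpos(2)[of n] in auto)
  qed
  then obtain r g u y where rg: "\<And>n. (r n, g n) \<in> Q" and sel: "\<And>n. gph_selection (u n) (y n)"
    and min: "\<And>n r' g' u' y'. (r', g') \<in> Q \<Longrightarrow> gph_selection u' y' \<Longrightarrow> ?J n (r n) (g n) (u n) (y n) \<le> ?J n r' g' u' y'"
    by metis
  define a where "a n = integral\<^sup>L M (y n) + g n" for n
  define E where "E n = (\<integral>t. (norm (u n t - r n))\<^sup>2 \<partial>M)" for n
  have E0: "0 \<le> E n" for n by (simp add: E_def)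
  have val: "- (w \<bullet> (r n - ub)) + \<epsilon> * sqrt ((norm (r n - ub))\<^sup>2 + (\<delta> n)\<^sup>2)
      + k n * (norm (a n))\<^sup>2 + k n * E n \<le> \<epsilon> * \<delta> n" for n
  proof -
    have "?J n (r n) (g n) (u n) (y n) \<le> ?J n ub (- yb) (\<lambda>_. ub) y0"
      by (rule min[OF base gph_selection_base])
    also have "\<dots> = \<epsilon> * \<delta> n" by (simp add: penalty_def \<delta>_def)
    finally have "- (w \<bullet> (r n - ub)) + \<epsilon> * sqrt ((norm (r n - ub))\<^sup>2 + (\<delta> n)\<^sup>2)
      + k n * (norm (a n))\<^sup>2 + (k n * penalty_weight) * E n \<le> \<epsilon> * \<delta> n"
      by (simp add: penalty_def a_def E_def)
    moreover have "k n * E n \<le> (k n * penalty_weight) * E n"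
      using kpos(2) E0 by (intro mult_right_mono) auto
    ultimately show ?thesis by linarith
  qed
  define B where "B = \<epsilon> + norm w * \<rho>"
  have kB: "k n * (norm (a n))\<^sup>2 + k n * E n \<le> B" for n
  proof -
    have "w \<bullet> (r n - ub) \<le> norm w * norm (r n - ub)" by (rule norm_cauchy_schwarz)
    also have "\<dots> \<le> norm w * \<rho>" using Qr[OF rg] by (intro mult_left_mono) auto
    finally have "w \<bullet> (r n - ub) \<le> norm w * \<rho>" .
    moreover have "0 \<le> \<epsilon> * sqrt ((norm (r n - ub))\<^sup>2 + (\<delta> n)\<^sup>2)" using \<epsilon> by simp
    moreover have "\<epsilon> * \<delta> n \<le> \<epsilon> * 1" using \<epsilon> by (intro mult_left_mono) (auto simp: \<delta>_def)
    ultimately show ?thesis using val[of n] unfolding B_def by linarith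
  qed
  have lim0: "(\<lambda>n. B / k n) \<longlonglongrightarrow> 0"
    using tendsto_mult_right_zero[OF LIMSEQ_inverse_real_of_nat, of B] by (simp add: k_def divide_inverse)
  have a2: "(\<lambda>n. (norm (a n))\<^sup>2) \<longlonglongrightarrow> 0"
  proof (rule tendsto_sandwich[OF _ _ tendsto_const lim0])
    show "\<forall>\<^sub>F n in sequentially. (norm (a n))\<^sup>2 \<le> B / k n"
    proof (intro always_eventually allI)
      fix n
      have "0 \<le> k n * E n" using kpos(1)[of n] E0[of n] by simp
      then have "k n * (norm (a n))\<^sup>2 \<le> B" using kB[of n] by linarith
      then show "(norm (a n))\<^sup>2 \<le> B / k n" using kpos(1)[of n] by (simp add: pos_le_divide_eq mult.commute)
    qed
  qed simp
  have "(\<lambda>n. sqrt ((norm (a n))\<^sup>2)) \<longlonglongrightarrow> sqrt 0" by (intro tendsto_real_sqrt a2)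
  then have a0: "a \<longlonglongrightarrow> 0" by (simp add: tendsto_norm_zero_iff)
  have Elim: "E \<longlonglongrightarrow> 0"
  proof (rule tendsto_sandwich[OF _ _ tendsto_const lim0])
    show "\<forall>\<^sub>F n in sequentially. E n \<le> B / k n"
    proof (intro always_eventually allI)
      fix n
      have "0 \<le> k n * (norm (a n))\<^sup>2" using kpos(1)[of n] by simp
      then have "k n * E n \<le> B" using kB[of n] by linarith
      then show "E n \<le> B / k n" using kpos(1)[of n] by (simp add: pos_le_divide_eq mult.commute)
    qed
  qed (use E0 in auto)
  obtain q \<sigma> where \<sigma>: "q \<in> Q" "strict_mono (\<sigma> :: nat \<Rightarrow> nat)" "((\<lambda>n. (r n, g n)) \<circ> \<sigma>) \<longlonglongrightarrow> q"
    using Q rg unfolding compact_def by (metis (no_types, lifting))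
  have rlim: "(\<lambda>n. r (\<sigma> n)) \<longlonglongrightarrow> fst q" and glim: "(\<lambda>n. g (\<sigma> n)) \<longlonglongrightarrow> snd q"
    using tendsto_fst[OF \<sigma>(3)] tendsto_snd[OF \<sigma>(3)] by (simp_all add: o_def)
  have r\<eta>: "norm (r n - ub) \<le> \<eta>" for n using Qr[OF rg] \<rho>(2) order_trans by blast
  obtain \<tau> u' y' where \<tau>: "strict_mono (\<tau> :: nat \<Rightarrow> nat)" "gph_selection u' y'"
    "(\<lambda>j. integral\<^sup>L M (y (\<sigma> (\<tau> j)))) \<longlonglongrightarrow> integral\<^sup>L M y'"
    "(\<lambda>j. \<integral>t. (norm (u (\<sigma> (\<tau> j)) t - r (\<sigma> (\<tau> j))))\<^sup>2 \<partial>M) \<longlonglongrightarrow> (\<integral>t. (norm (u' t - fst q))\<^sup>2 \<partial>M)"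
    using gph_selections_compact[of "\<lambda>n. u (\<sigma> n)" "\<lambda>n. y (\<sigma> n)" "\<lambda>n. r (\<sigma> n)" "fst q"]
      sel r\<eta> rlim by blast
  define \<kappa> where "\<kappa> j = \<sigma> (\<tau> j)" for j
  have \<kappa>: "strict_mono \<kappa>" using strict_mono_o[OF \<sigma>(2) \<tau>(1)] by (simp add: \<kappa>_def[abs_def] o_def)
  have rlim': "(\<lambda>n. r (\<kappa> n)) \<longlonglongrightarrow> fst q" and glim': "(\<lambda>n. g (\<kappa> n)) \<longlonglongrightarrow> snd q"
    using LIMSEQ_subseq_LIMSEQ[OF rlim \<tau>(1)] LIMSEQ_subseq_LIMSEQ[OF glim \<tau>(1)] by (simp_all add: o_def \<kappa>_def)
  have a0': "(\<lambda>j. a (\<kappa> j)) \<longlonglongrightarrow> 0" and E0': "(\<lambda>j. E (\<kappa> j)) \<longlonglongrightarrow> 0"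
    using LIMSEQ_subseq_LIMSEQ[OF a0 \<kappa>] LIMSEQ_subseq_LIMSEQ[OF Elim \<kappa>] by (simp_all add: o_def)
  \<comment> \<open>The penalised quantities vanish in the limit, so the cluster point solves the original inclusion.\<close>
  have "(\<lambda>j. a (\<kappa> j)) \<longlonglongrightarrow> integral\<^sup>L M y' + snd q"
    unfolding a_def by (intro tendsto_add glim') (use \<tau>(3) in \<open>simp add: \<kappa>_def\<close>)
  then have yq: "snd q = - integral\<^sup>L M y'"
    using LIMSEQ_unique[OF a0'] by (metis add_eq_0_iff)
  have "(\<integral>t. (norm (u' t - fst q))\<^sup>2 \<partial>M) = 0"
    using LIMSEQ_unique[OF \<tau>(4)] E0' by (simp add: E_def \<kappa>_def)
  moreover have q\<rho>: "norm (fst q - ub) \<le> \<rho>" using Qr[of "fst q" "snd q"] \<sigma>(1) by simp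
  ultimately have "AE t in M. (norm (u' t - fst q))\<^sup>2 = 0"
    using gph_selection_sq_integrable(1)[OF \<tau>(2), of "fst q"] \<rho>(2)
    by (subst (asm) integral_nonneg_eq_0_iff_AE) auto
  then have yAE: "AE t in M. y' t \<in> \<Phi> t (fst q)"
    using AE_space
  proof eventually_elim
    case (elim t)
    then have "u' t = fst q" by simp
    then show ?case using gph_selectionD(5)[OF \<tau>(2) elim(2)] by metis
  qed
  have le: "w \<bullet> (fst q - ub) \<le> \<epsilon> / 2 * norm (fst q - ub)"
  proof (rule loc[rule_format, OF _ q\<rho>])
    have "(fst q, - integral\<^sup>L M y') \<in> \<Gamma>" using \<sigma>(1) by (simp add: yq[symmetric] Q_def)
    then show "fst q \<in> feasible_set \<Gamma>"
      using yAE gph_selection_integrable(2)[OF \<tau>(2)] unfolding feasible_set_def by blast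
  qed
  have "- (w \<bullet> (fst q - ub)) + \<epsilon> * norm (fst q - ub) \<le> 0"
  proof (rule LIMSEQ_le)
    show "(\<lambda>j. - (w \<bullet> (r (\<kappa> j) - ub)) + \<epsilon> * norm (r (\<kappa> j) - ub)) \<longlonglongrightarrow> - (w \<bullet> (fst q - ub)) + \<epsilon> * norm (fst q - ub)"
      by (intro tendsto_intros rlim')
    have "\<delta> \<longlonglongrightarrow> 0" using LIMSEQ_inverse_real_of_nat by (simp add: \<delta>_def[abs_def] inverse_eq_divide)
    from tendsto_mult_right_zero[OF LIMSEQ_subseq_LIMSEQ[OF this \<kappa>], of \<epsilon>]
    show "(\<lambda>j. \<epsilon> * \<delta> (\<kappa> j)) \<longlonglongrightarrow> 0" by (simp add: o_def)
    show "\<exists>N. \<forall>j\<ge>N. - (w \<bullet> (r (\<kappa> j) - ub)) + \<epsilon> * norm (r (\<kappa> j) - ub) \<le> \<epsilon> * \<delta> (\<kappa> j)"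
    proof (intro exI[of _ 0] allI impI)
      fix j :: nat
      have "norm (r (\<kappa> j) - ub) \<le> sqrt ((norm (r (\<kappa> j) - ub))\<^sup>2 + (\<delta> (\<kappa> j))\<^sup>2)"
        by (rule real_le_rsqrt) simp
      then have "\<epsilon> * norm (r (\<kappa> j) - ub) \<le> \<epsilon> * sqrt ((norm (r (\<kappa> j) - ub))\<^sup>2 + (\<delta> (\<kappa> j))\<^sup>2)"
        using \<epsilon> by (intro mult_left_mono) auto
      moreover have "0 \<le> k (\<kappa> j) * (norm (a (\<kappa> j)))\<^sup>2" "0 \<le> k (\<kappa> j) * E (\<kappa> j)"
        using kpos(1)[of "\<kappa> j"] E0[of "\<kappa> j"] by auto
      ultimately show "- (w \<bullet> (r (\<kappa> j) - ub)) + \<epsilon> * norm (r (\<kappa> j) - ub) \<le> \<epsilon> * \<delta> (\<kappa> j)"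
        using val[of "\<kappa> j"] by linarith
    qed
  qed
  with le have "\<epsilon> / 2 * norm (fst q - ub) \<le> 0" by simp
  then have q1: "fst q = ub" using \<epsilon> by (simp add: mult_le_0_iff)
  have "AE t in M. y' t = y0 t"
    using yAE AE_space
  proof eventually_elim
    case (elim t)
    then show ?case using near[OF elim(2), of ub "y' t"] \<eta> by (simp add: q1)
  qed
  then have "integral\<^sup>L M y' = yb"
    using gph_selectionD(2)[OF \<tau>(2)] y0_meas by (intro integral_cong_AE)
  then have q: "q = (ub, - yb)" using q1 yq by (metis prod.collapse)
  have "(\<lambda>j. (r (\<kappa> j), g (\<kappa> j))) \<longlonglongrightarrow> (ub, - yb)" using tendsto_Pair[OF rlim' glim'] by (simp add: q)
  from tendstoD[OF this \<beta>] tendstoD[OF a0' \<beta>]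
  have "\<forall>\<^sub>F j in sequentially. dist (r (\<kappa> j), g (\<kappa> j)) (ub, - yb) < \<beta> \<and> dist (a (\<kappa> j)) 0 < \<beta>"
    by (rule eventually_conj)
  then obtain j where j: "dist (r (\<kappa> j), g (\<kappa> j)) (ub, - yb) < \<beta>" "norm (a (\<kappa> j)) < \<beta>"
    unfolding eventually_sequentially by auto
  have "?J (\<kappa> j) (r (\<kappa> j)) (g (\<kappa> j)) (u (\<kappa> j)) (y (\<kappa> j)) \<le> ?J (\<kappa> j) r' g' u' y'"
    if "(r', g') \<in> \<Gamma>" "dist (r', g') (ub, - yb) \<le> \<rho>" "gph_selection u' y'" for r' g' u' y'
    by (rule min) (use that in \<open>auto simp: Q_def dist_commute\<close>)
  moreover have "\<delta> (\<kappa> j) > 0" by (simp add: \<delta>_def)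
  moreover have "(r (\<kappa> j), g (\<kappa> j)) \<in> \<Gamma>" using rg by (simp add: Q_def)
  ultimately show ?thesis
    using kpos(1)[of "\<kappa> j"] sel[of "\<kappa> j"] j unfolding a_def by blast
qed

end

section \<open>Approximate multipliers and their limits\<close>

context Lipschitz_integrand
begin

text \<open>The multiplier relations with all errors bounded by the same \<open>e\<close>, at nearby points of the graphs. The
  bound on \<open>v\<close> is linear in \<open>p\<close>, so it survives normalisation.\<close>

definition approximate_multiplier ::
    "('u \<times> 'v) set \<Rightarrow> 'u \<Rightarrow> real \<Rightarrow> 'v \<Rightarrow> 'u \<Rightarrow> ('t \<Rightarrow> 'u) \<Rightarrow> bool" where
  "approximate_multiplier \<Gamma> w e p q v \<longleftrightarrow>
     v \<in> borel_measurable M \<and>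
     (AE t in M. norm (v t) \<le> 2 * l * penalty_weight * norm p) \<and>
     (\<exists>u y. AE t in M. norm (u t - ub) \<le> e \<and> norm (y t - y0 t) \<le> l * e \<and>
        (v t, - p) \<in> regular_normal_cone (gph (\<Phi> t)) (u t, y t)) \<and>
     (\<exists>z. dist z (ub, - yb) \<le> e \<and> (q, - p) \<in> regular_normal_cone \<Gamma> z) \<and>
     norm (q + integral\<^sup>L M v - w) \<le> e"

lemma approximate_multiplier_exists:
  fixes \<Gamma> :: "('u \<times> 'v) set"
  assumes \<Gamma>: "closed \<Gamma>" "(ub, - yb) \<in> \<Gamma>"
    and w: "w \<in> regular_normal_cone (feasible_set \<Gamma>) ub"
    and e: "e > 0"
  shows "\<exists>p q v. approximate_multiplier \<Gamma> w e p q v"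
proof -
  have "e / 2 > 0" using e by simp
  then obtain d where d: "d > 0" "\<forall>r\<in>feasible_set \<Gamma>. r \<noteq> ub \<longrightarrow> dist r ub < d \<longrightarrow> w \<bullet> (r - ub) < e / 2 * norm (r - ub)"
    using w unfolding regular_normal_cone_iff by blast
  define \<rho> where "\<rho> = min (d / 2) \<eta>"
  have \<rho>: "0 < \<rho>" "\<rho> \<le> \<eta>" "\<rho> < d" using d(1) \<eta> by (auto simp: \<rho>_def)
  have loc: "\<forall>r\<in>feasible_set \<Gamma>. norm (r - ub) \<le> \<rho> \<longrightarrow> w \<bullet> (r - ub) \<le> e / 2 * norm (r - ub)"
  proof (intro ballI impI)
    fix r assume r: "r \<in> feasible_set \<Gamma>" "norm (r - ub) \<le> \<rho>"
    then have "dist r ub < d" using \<rho>(3) by (simp add: dist_norm)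
    then show "w \<bullet> (r - ub) \<le> e / 2 * norm (r - ub)"
      using d(2) r(1) by (cases "r = ub") (auto simp: less_imp_le)
  qed
  \<comment> \<open>The factor \<open>1 + 2 * l\<close> accounts for \<open>|u t - ub| \<le> |u t - r| + |r - ub| \<le> 2 * l * \<beta> + \<beta>\<close>.\<close>
  define \<beta> where "\<beta> = min e (min (\<eta> / 2) (\<rho> / 2)) / (1 + 2 * l)"
  have \<beta>: "\<beta> > 0" "(1 + 2 * l) * \<beta> \<le> e" "(1 + 2 * l) * \<beta> \<le> \<eta> / 2" "\<beta> \<le> e" "\<beta> \<le> \<rho> / 2"
  proof -
    show "\<beta> > 0" using e \<eta> \<rho> l by (simp add: \<beta>_def)
    have eq: "(1 + 2 * l) * \<beta> = min e (min (\<eta> / 2) (\<rho> / 2))" using l by (simp add: \<beta>_def)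
    then show "(1 + 2 * l) * \<beta> \<le> e" "(1 + 2 * l) * \<beta> \<le> \<eta> / 2" by auto
    have "\<beta> \<le> (1 + 2 * l) * \<beta>" using \<open>\<beta> > 0\<close> l by simp
    then show "\<beta> \<le> e" "\<beta> \<le> \<rho> / 2" unfolding eq by auto
  qed
  obtain \<delta> k r g u y where pos: "\<delta> > 0" "k > 0" and rg: "(r, g) \<in> \<Gamma>" and sel: "gph_selection u y"
    and near0: "dist (r, g) (ub, - yb) < \<beta>" and a: "norm (integral\<^sup>L M y + g) < \<beta>"
    and min: "\<And>r' g' u' y'. (r', g') \<in> \<Gamma> \<Longrightarrow> dist (r', g') (ub, - yb) \<le> \<rho> \<Longrightarrow> gph_selection u' y' \<Longrightarrow>
        penalty w e \<delta> k (k * penalty_weight) r g u y \<le> penalty w e \<delta> k (k * penalty_weight) r' g' u' y'"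
    using penalty_minimisers_converge[OF \<Gamma> \<rho>(1,2) e \<beta>(1) loc] by blast
  define K where "K = k * penalty_weight"
  have K: "K > 0" using pos penalty_weight_ge1 by (simp add: K_def)
  have r: "norm (r - ub) < \<beta>"
    using norm_fst_le[of "r - ub" "g + yb"] near0 by (simp add: dist_norm)
  have \<beta>\<eta>: "\<beta> < \<eta>" using \<beta>(5) \<rho> by linarith
  define p where "p = (2 * k) *\<^sub>R (integral\<^sup>L M y + g)"
  define v where "v t = (2 * K) *\<^sub>R (r - u t)" for t
  have "\<exists>\<xi>. norm \<xi> \<le> 1 \<and>
    (w - e *\<^sub>R \<xi> - (\<integral>t. (2 * K) *\<^sub>R (r - u t) \<partial>M), - ((2 * k) *\<^sub>R (integral\<^sup>L M y + g)))
      \<in> regular_normal_cone \<Gamma> (r, g)"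
  proof (rule penalty_outer_normal[OF rg _ _ pos K _ sel])
    show "0 < \<rho> / 2" using \<rho> by simp
    show "norm (r - ub) < \<eta>" using r \<beta>\<eta> by simp
    show "penalty w e \<delta> k K r g u y \<le> penalty w e \<delta> k K r' g' u y"
      if "(r', g') \<in> \<Gamma>" "dist (r', g') (r, g) < \<rho> / 2" for r' g'
      unfolding K_def
    proof (rule min[OF that(1) _ sel])
      show "dist (r', g') (ub, - yb) \<le> \<rho>"
        using dist_triangle[of "(r', g')" "(ub, - yb)" "(r, g)"] that(2) near0 \<beta>(5) by linarith
    qed
  qed (use e in simp)
  then obtain \<xi> where \<xi>: "norm \<xi> \<le> 1"
    "(w - e *\<^sub>R \<xi> - integral\<^sup>L M v, - p) \<in> regular_normal_cone \<Gamma> (r, g)"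
    unfolding v_def p_def by blast
  have r\<eta>: "norm (r - ub) \<le> \<eta>" using r \<beta>\<eta> by simp
  have min': "penalty w e \<delta> k K r g u y \<le> penalty w e \<delta> k K r g u' y'" if "gph_selection u' y'" for u' y'
    unfolding K_def by (rule min[OF rg _ that]) (use near0 \<beta>(5) \<rho> in linarith)
  have inner: "AE t in M. norm (u t - r) \<le> 2 * l * norm (integral\<^sup>L M y + g)"
    "AE t in M. norm (v t) \<le> 2 * l * penalty_weight * norm p"
    "AE t in M. norm (u t - ub) < \<eta> \<longrightarrow> (v t, - p) \<in> regular_normal_cone (gph (\<Phi> t)) (u t, y t)"
    unfolding v_def p_def
    by (rule penalty_inner_normals[OF pos(2) K_def r\<eta> sel min'], assumption)+
  have "AE t in M. norm (u t - ub) \<le> e \<and> norm (y t - y0 t) \<le> l * e \<and>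
      (v t, - p) \<in> regular_normal_cone (gph (\<Phi> t)) (u t, y t)"
    using inner(1,3) AE_space
  proof eventually_elim
    case (elim t)
    have "norm (u t - ub) \<le> norm (u t - r) + norm (r - ub)"
      using norm_triangle_ineq[of "u t - r" "r - ub"] by simp
    also have "\<dots> \<le> 2 * l * \<beta> + \<beta>"
    proof -
      have "2 * l * norm (integral\<^sup>L M y + g) \<le> 2 * l * \<beta>" using a l by (intro mult_left_mono) auto
      then show ?thesis using elim(1) r by linarith
    qed
    finally have u\<beta>: "norm (u t - ub) \<le> (1 + 2 * l) * \<beta>" by (simp add: algebra_simps)
    then have "norm (u t - ub) \<le> e" "norm (u t - ub) < \<eta>" using \<beta>(2,3) \<eta> by linarith+
    moreover from this(1) have "norm (y t - y0 t) \<le> l * e"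
      using gph_selectionD(6)[OF sel elim(3)] mult_left_mono[of "norm (u t - ub)" e l] l by linarith
    ultimately show ?case using elim(2) by blast
  qed
  moreover have "norm (w - e *\<^sub>R \<xi> - integral\<^sup>L M v + integral\<^sup>L M v - w) \<le> e"
    using \<xi>(1) e by (simp add: mult_left_le)
  moreover have "v \<in> borel_measurable M" unfolding v_def using gph_selectionD(1)[OF sel] by measurable
  moreover have "dist (r, g) (ub, - yb) \<le> e" using near0 \<beta>(4) by linarith
  ultimately have "approximate_multiplier \<Gamma> w e p (w - e *\<^sub>R \<xi> - integral\<^sup>L M v) v"
    unfolding approximate_multiplier_def using inner(2) \<xi>(2) by blast
  then show ?thesis by blast
qed

lemma approximate_multiplier_scaleR:
  assumes "approximate_multiplier \<Gamma> w e p q v" and c: "0 < c" "c \<le> 1"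
  shows "approximate_multiplier \<Gamma> (c *\<^sub>R w) e (c *\<^sub>R p) (c *\<^sub>R q) (\<lambda>t. c *\<^sub>R v t)"
proof -
  have v: "v \<in> borel_measurable M" and vb: "AE t in M. norm (v t) \<le> 2 * l * penalty_weight * norm p"
    and n: "norm (q + integral\<^sup>L M v - w) \<le> e"
    using assms(1) by (auto simp: approximate_multiplier_def)
  obtain u y where uy: "AE t in M. norm (u t - ub) \<le> e \<and> norm (y t - y0 t) \<le> l * e \<and>
        (v t, - p) \<in> regular_normal_cone (gph (\<Phi> t)) (u t, y t)"
    using assms(1) unfolding approximate_multiplier_def by blast
  obtain z where z: "dist z (ub, - yb) \<le> e" "(q, - p) \<in> regular_normal_cone \<Gamma> z"
    using assms(1) unfolding approximate_multiplier_def by blast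
  have "AE t in M. norm (c *\<^sub>R v t) \<le> 2 * l * penalty_weight * norm (c *\<^sub>R p)"
    using vb
  proof eventually_elim
    case (elim t)
    then show ?case using mult_left_mono[OF elim, of c] c by (simp add: mult_ac)
  qed
  moreover have "AE t in M. norm (u t - ub) \<le> e \<and> norm (y t - y0 t) \<le> l * e \<and>
        (c *\<^sub>R v t, - (c *\<^sub>R p)) \<in> regular_normal_cone (gph (\<Phi> t)) (u t, y t)"
    using uy
  proof eventually_elim
    case (elim t)
    then show ?case using regular_normal_cone_scaleR[of "(v t, - p)" _ _ c] c by simp
  qed
  moreover have "(c *\<^sub>R q, - (c *\<^sub>R p)) \<in> regular_normal_cone \<Gamma> z"
    using regular_normal_cone_scaleR[OF z(2) c(1)] by simp
  moreover have "norm (c *\<^sub>R q + (\<integral>t. c *\<^sub>R v t \<partial>M) - c *\<^sub>R w) \<le> e"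
  proof -
    have "norm (c *\<^sub>R q + (\<integral>t. c *\<^sub>R v t \<partial>M) - c *\<^sub>R w) = c * norm (q + integral\<^sup>L M v - w)"
      using c by (simp add: scaleR_add_right[symmetric] scaleR_diff_right[symmetric])
    also have "\<dots> \<le> 1 * norm (q + integral\<^sup>L M v - w)" using c by (intro mult_right_mono) auto
    finally show ?thesis using n by simp
  qed
  moreover have "(\<lambda>t. c *\<^sub>R v t) \<in> borel_measurable M" using v by measurable
  ultimately show ?thesis unfolding approximate_multiplier_def using z(1) by blast
qed

text \<open>Where the multipliers converge, \<open>v n\<close> is uniformly bounded and Fatou's lemma applies to it. Cluster
  points of \<open>v n t\<close> belong to the coderivative by the definition of limiting normals.\<close>

lemma approximate_multipliers_limit:
  assumes am: "\<And>n. approximate_multiplier \<Gamma> (w n) (e n) (p n) (q n) (v n)"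
    and lim: "e \<longlonglongrightarrow> 0" "w \<longlonglongrightarrow> w0" "p \<longlonglongrightarrow> p0"
  shows "\<exists>f q0. integrable M f \<and> (AE t in M. f t \<in> coderivative (\<Phi> t) ub (y0 t) p0) \<and>
    (q0, - p0) \<in> limiting_normal_cone \<Gamma> (ub, - yb) \<and> integral\<^sup>L M f + q0 = w0"
proof -
  obtain P where P: "\<And>n. norm (p n) \<le> P"
    using BseqE[OF convergent_imp_Bseq[OF convergentI[OF lim(3)]]] by blast
  define R where "R = 2 * l * penalty_weight * P"
  have v: "v n \<in> borel_measurable M" and n: "norm (q n + integral\<^sup>L M (v n) - w n) \<le> e n"
    and vb: "AE t in M. norm (v n t) \<le> 2 * l * penalty_weight * norm (p n)" for n
    using am[of n] by (auto simp: approximate_multiplier_def)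
  have "\<forall>n. \<exists>u y. AE t in M. norm (u t - ub) \<le> e n \<and> norm (y t - y0 t) \<le> l * e n \<and>
        (v n t, - p n) \<in> regular_normal_cone (gph (\<Phi> t)) (u t, y t)"
    using am unfolding approximate_multiplier_def by blast
  from choice[OF this] obtain u where "\<forall>n. \<exists>y. AE t in M. norm (u n t - ub) \<le> e n \<and> norm (y t - y0 t) \<le> l * e n \<and>
        (v n t, - p n) \<in> regular_normal_cone (gph (\<Phi> t)) (u n t, y t)" by blast
  from choice[OF this] obtain y where uy: "\<And>n. AE t in M. norm (u n t - ub) \<le> e n \<and> norm (y n t - y0 t) \<le> l * e n \<and>
        (v n t, - p n) \<in> regular_normal_cone (gph (\<Phi> t)) (u n t, y n t)" by blast
  have "\<forall>n. \<exists>z. dist z (ub, - yb) \<le> e n \<and> (q n, - p n) \<in> regular_normal_cone \<Gamma> z"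
    using am unfolding approximate_multiplier_def by blast
  from choice[OF this] obtain z where z: "\<And>n. dist (z n) (ub, - yb) \<le> e n"
    "\<And>n. (q n, - p n) \<in> regular_normal_cone \<Gamma> (z n)" by blast
  have vR: "AE t in M. norm (v n t) \<le> R" for n
    using vb[of n]
  proof eventually_elim
    case (elim t)
    have "2 * l * penalty_weight * norm (p n) \<le> R"
      unfolding R_def using P[of n] l penalty_weight_ge1 by (intro mult_left_mono) auto
    then show ?case using elim by linarith
  qed
  have R0: "0 \<le> R" using order_trans[OF norm_ge_zero P[of 0]] l penalty_weight_ge1 by (simp add: R_def)
  \<comment> \<open>The bound on \<open>v n\<close> holds almost everywhere only; the truncation makes it hold at every point.\<close>
  define v' where "v' n t = (if norm (v n t) \<le> R then v n t else 0)" for n t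
  have v': "v' n \<in> borel_measurable M" for n unfolding v'_def using v[of n] by measurable
  have v'R: "norm (v' n t) \<le> R" for n t using R0 by (simp add: v'_def)
  have v'v: "AE t in M. v' n t = v n t" for n using vR[of n] by eventually_elim (simp add: v'_def)
  have v'int: "integrable M (v' n)" for n
    by (rule integrable_const_bound[of _ R]) (use v' v'R in auto)
  have Iv: "integral\<^sup>L M (v' n) = integral\<^sup>L M (v n)" for n by (rule integral_cong_AE[OF v' v v'v])
  have "norm (integral\<^sup>L M (v' n)) \<le> R * measure M (space M)" for n
  proof -
    have "norm (integral\<^sup>L M (v' n)) \<le> (\<integral>t. norm (v' n t) \<partial>M)" by (rule integral_norm_bound)
    also have "\<dots> \<le> (\<integral>t. R \<partial>M)" by (rule integral_mono) (use v'int v'R in auto)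
    finally show ?thesis by (simp add: mult.commute)
  qed
  then have "\<forall>n. integral\<^sup>L M (v' n) \<in> cball 0 (R * measure M (space M))" by simp
  then obtain I \<sigma> where \<sigma>: "strict_mono (\<sigma> :: nat \<Rightarrow> nat)" "((\<lambda>n. integral\<^sup>L M (v' n)) \<circ> \<sigma>) \<longlonglongrightarrow> I"
    using compact_cball[of "0 :: 'u" "R * measure M (space M)"] unfolding compact_def by meson
  have Ilim: "(\<lambda>n. integral\<^sup>L M (v' (\<sigma> n))) \<longlonglongrightarrow> I" using \<sigma>(2) by (simp add: o_def)
  obtain f where f: "f \<in> borel_measurable M" "\<forall>t\<in>space M. f t \<in> cluster_set (\<lambda>n. v' (\<sigma> n) t)" "integral\<^sup>L M f = I"
    using selection_of_cluster_sets[of "\<lambda>n. v' (\<sigma> n)", OF v' v'R Ilim] by blast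
  have f_int: "integrable M f"
  proof (rule integrable_const_bound[of _ R])
    show "AE t in M. norm (f t) \<le> R"
      using f(2) cluster_set_norm_le[of "\<lambda>n. v' (\<sigma> n) _", OF v'R] by (intro AE_I2) blast
  qed (rule f)
  have e\<sigma>: "(\<lambda>n. e (\<sigma> n)) \<longlonglongrightarrow> 0" and w\<sigma>: "(\<lambda>n. w (\<sigma> n)) \<longlonglongrightarrow> w0" and p\<sigma>: "(\<lambda>n. p (\<sigma> n)) \<longlonglongrightarrow> p0"
    using LIMSEQ_subseq_LIMSEQ[OF lim(1) \<sigma>(1)] LIMSEQ_subseq_LIMSEQ[OF lim(2) \<sigma>(1)]
      LIMSEQ_subseq_LIMSEQ[OF lim(3) \<sigma>(1)] by (simp_all add: o_def)
  have "AE t in M. \<forall>n. v' n t = v n t \<and> norm (u n t - ub) \<le> e n \<and> norm (y n t - y0 t) \<le> l * e n \<and>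
        (v n t, - p n) \<in> regular_normal_cone (gph (\<Phi> t)) (u n t, y n t)"
    using v'v uy by (simp add: AE_all_countable)
  then have fco: "AE t in M. f t \<in> coderivative (\<Phi> t) ub (y0 t) p0"
    using AE_space
  proof eventually_elim
    case (elim t)
    from bspec[OF f(2) elim(2)]
    obtain \<tau> where \<tau>: "strict_mono (\<tau> :: nat \<Rightarrow> nat)" "(\<lambda>j. v' (\<sigma> (\<tau> j)) t) \<longlonglongrightarrow> f t"
      by (rule cluster_setE)
    define \<kappa> where "\<kappa> j = \<sigma> (\<tau> j)" for j
    have e\<kappa>: "(\<lambda>j. e (\<kappa> j)) \<longlonglongrightarrow> 0" and p\<kappa>: "(\<lambda>j. p (\<kappa> j)) \<longlonglongrightarrow> p0"
      using LIMSEQ_subseq_LIMSEQ[OF e\<sigma> \<tau>(1)] LIMSEQ_subseq_LIMSEQ[OF p\<sigma> \<tau>(1)] by (simp_all add: o_def \<kappa>_def)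
    have ulim: "(\<lambda>j. u (\<kappa> j) t) \<longlonglongrightarrow> ub"
      by (rule LIM_zero_cancel, rule Lim_null_comparison[OF _ e\<kappa>]) (use elim(1) in auto)
    have ylim: "(\<lambda>j. y (\<kappa> j) t) \<longlonglongrightarrow> y0 t"
      by (rule LIM_zero_cancel, rule Lim_null_comparison[OF _ tendsto_mult_right_zero[OF e\<kappa>, of l]])
        (use elim(1) in auto)
    have "(\<lambda>j. v (\<kappa> j) t) \<longlonglongrightarrow> f t" using \<tau>(2) elim(1) by (simp add: \<kappa>_def)
    then have "(\<lambda>j. (v (\<kappa> j) t, - p (\<kappa> j))) \<longlonglongrightarrow> (f t, - p0)"
      by (intro tendsto_Pair tendsto_minus p\<kappa>)
    moreover have "(\<lambda>j. (u (\<kappa> j) t, y (\<kappa> j) t)) \<longlonglongrightarrow> (ub, y0 t)" by (intro tendsto_Pair ulim ylim)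
    ultimately have "(f t, - p0) \<in> limiting_normal_cone (gph (\<Phi> t)) (ub, y0 t)"
      by (intro limiting_normal_coneI[where Xs="\<lambda>j. (v (\<kappa> j) t, - p (\<kappa> j))"
            and X="\<lambda>j. (u (\<kappa> j) t, y (\<kappa> j) t)"]) (use elim(1) in auto)
    then show ?case by (simp add: coderivative_def)
  qed
  have "(\<lambda>n. q (\<sigma> n) + integral\<^sup>L M (v (\<sigma> n)) - w (\<sigma> n)) \<longlonglongrightarrow> 0"
    by (rule Lim_null_comparison[OF _ e\<sigma>]) (use n in auto)
  then have "(\<lambda>n. (q (\<sigma> n) + integral\<^sup>L M (v (\<sigma> n)) - w (\<sigma> n)) + w (\<sigma> n) - integral\<^sup>L M (v' (\<sigma> n))) \<longlonglongrightarrow> 0 + w0 - I"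
    by (intro tendsto_intros w\<sigma> Ilim)
  then have qlim: "(\<lambda>n. q (\<sigma> n)) \<longlonglongrightarrow> w0 - I" by (simp add: Iv)
  have "(\<lambda>n. (q (\<sigma> n), - p (\<sigma> n))) \<longlonglongrightarrow> (w0 - I, - p0)"
    by (intro tendsto_Pair tendsto_minus qlim p\<sigma>)
  moreover have "(\<lambda>n. z (\<sigma> n)) \<longlonglongrightarrow> (ub, - yb)"
  proof (rule metric_tendsto_imp_tendsto[OF e\<sigma>], intro always_eventually allI)
    fix n
    show "dist (z (\<sigma> n)) (ub, - yb) \<le> dist (e (\<sigma> n)) 0"
      using z(1)[of "\<sigma> n"] abs_ge_self[of "e (\<sigma> n)"] by simp
  qed
  ultimately have "(w0 - I, - p0) \<in> limiting_normal_cone \<Gamma> (ub, - yb)"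
    by (intro limiting_normal_coneI[where Xs="\<lambda>n. (q (\<sigma> n), - p (\<sigma> n))" and X="\<lambda>n. z (\<sigma> n)"] z(2))
  then show ?thesis using f_int fco f(3) by (intro exI[of _ f] exI[of _ "w0 - I"]) simp
qed

text \<open>With \<open>c n = 1 / (1 + |p n|)\<close> the scaled multipliers always have a convergent subsequence. If \<open>c n\<close> tends to
  zero, the scaled limit is a unit vector that solves the adjoint equation for \<open>0\<close>. Otherwise the
  multipliers themselves converge along the subsequence.\<close>

theorem multiplier_exists:
  fixes \<Gamma> :: "('u \<times> 'v) set"
  assumes \<Gamma>: "closed \<Gamma>" "(ub, - yb) \<in> \<Gamma>"
    and w: "w \<in> regular_normal_cone (feasible_set \<Gamma>) ub"
    and qualification: "\<And>f q p. integrable M f \<Longrightarrow> (AE t in M. f t \<in> coderivative (\<Phi> t) ub (y0 t) p) \<Longrightarrow>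
      (q, - p) \<in> limiting_normal_cone \<Gamma> (ub, - yb) \<Longrightarrow> integral\<^sup>L M f + q = 0 \<Longrightarrow> p = 0"
  shows "\<exists>p f q. integrable M f \<and> (AE t in M. f t \<in> coderivative (\<Phi> t) ub (y0 t) p) \<and>
    (q, - p) \<in> limiting_normal_cone \<Gamma> (ub, - yb) \<and> integral\<^sup>L M f + q = w"
proof -
  define e where "e n = 1 / real (Suc n)" for n
  have e0: "e \<longlonglongrightarrow> 0" using LIMSEQ_inverse_real_of_nat by (simp add: e_def[abs_def] inverse_eq_divide)
  have "\<forall>n. \<exists>p q v. approximate_multiplier \<Gamma> w (e n) p q v"
    using approximate_multiplier_exists[OF \<Gamma> w] by (simp add: e_def)
  then obtain p q v where am: "\<And>n. approximate_multiplier \<Gamma> w (e n) (p n) (q n) (v n)" by metis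
  define c where "c n = 1 / (1 + norm (p n))" for n
  have c: "0 < c n" "c n \<le> 1" for n
    by (simp_all add: c_def add_pos_nonneg)
  have cp: "norm (c n *\<^sub>R p n) = 1 - c n" for n
  proof -
    have "1 + norm (p n) > 0" by (simp add: add_pos_nonneg)
    then have "norm (c n *\<^sub>R p n) = norm (p n) / (1 + norm (p n))" by (simp add: c_def)
    also have "\<dots> = 1 - 1 / (1 + norm (p n))" using \<open>1 + norm (p n) > 0\<close> by (simp add: divide_simps)
    finally show ?thesis by (simp add: c_def)
  qed
  have "\<forall>n. (c n, c n *\<^sub>R p n) \<in> {0..1} \<times> cball 0 1"
    using c cp by (auto simp: less_imp_le)
  moreover have "compact ({0..1 :: real} \<times> cball (0 :: 'v) 1)" by (intro compact_Times compact_Icc compact_cball)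
  ultimately obtain x \<sigma> where \<sigma>: "strict_mono (\<sigma> :: nat \<Rightarrow> nat)" "((\<lambda>n. (c n, c n *\<^sub>R p n)) \<circ> \<sigma>) \<longlonglongrightarrow> x"
    unfolding compact_def by meson
  have clim: "(\<lambda>n. c (\<sigma> n)) \<longlonglongrightarrow> fst x" and cplim: "(\<lambda>n. c (\<sigma> n) *\<^sub>R p (\<sigma> n)) \<longlonglongrightarrow> snd x"
    using tendsto_fst[OF \<sigma>(2)] tendsto_snd[OF \<sigma>(2)] by (simp_all add: o_def)
  have elim: "(\<lambda>n. e (\<sigma> n)) \<longlonglongrightarrow> 0" using LIMSEQ_subseq_LIMSEQ[OF e0 \<sigma>(1)] by (simp add: o_def)
  have "fst x \<noteq> 0"
  proof
    assume 0: "fst x = 0"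
    have "(\<lambda>n. norm (c (\<sigma> n) *\<^sub>R p (\<sigma> n))) \<longlonglongrightarrow> norm (snd x)" by (intro tendsto_intros cplim)
    moreover have "(\<lambda>n. 1 - c (\<sigma> n)) \<longlonglongrightarrow> 1 - 0" using clim 0 by (intro tendsto_intros) simp
    ultimately have "norm (snd x) = 1" unfolding cp using LIMSEQ_unique by fastforce
    have "(\<lambda>n. c (\<sigma> n) *\<^sub>R w) \<longlonglongrightarrow> 0 *\<^sub>R w" using clim 0 by (intro tendsto_intros) simp
    then have wlim: "(\<lambda>n. c (\<sigma> n) *\<^sub>R w) \<longlonglongrightarrow> 0" by simp
    obtain f q0 where "integrable M f" "AE t in M. f t \<in> coderivative (\<Phi> t) ub (y0 t) (snd x)"
      "(q0, - snd x) \<in> limiting_normal_cone \<Gamma> (ub, - yb)" "integral\<^sup>L M f + q0 = 0"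
      using approximate_multipliers_limit[OF approximate_multiplier_scaleR[OF am c] elim wlim cplim] by blast
    then have "snd x = 0" by (rule qualification)
    then show False using \<open>norm (snd x) = 1\<close> by simp
  qed
  then have "(\<lambda>n. (1 / c (\<sigma> n)) *\<^sub>R (c (\<sigma> n) *\<^sub>R p (\<sigma> n))) \<longlonglongrightarrow> (1 / fst x) *\<^sub>R snd x"
    by (intro tendsto_intros clim cplim)
  moreover have "(1 / c n) *\<^sub>R (c n *\<^sub>R p n) = p n" for n using c(1)[of n] by simp
  ultimately have plim: "(\<lambda>n. p (\<sigma> n)) \<longlonglongrightarrow> (1 / fst x) *\<^sub>R snd x" by simp
  show ?thesis
    using approximate_multipliers_limit[OF am elim tendsto_const plim] by blast
qed

end

section \<open>The coderivative of the solution map\<close>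

lemma gph_solution_map:
  fixes \<Phi> :: "'t \<Rightarrow> 'a \<times> 'b \<Rightarrow> 'c::euclidean_space set"
  shows "gph (solution_map M \<Phi> G) =
     {r. \<exists>y. integrable M y \<and> (AE t in M. y t \<in> \<Phi> t r) \<and> (r, - integral\<^sup>L M y) \<in> gph G}"
  (is "_ = ?S")
proof (rule set_eqI)
  fix r :: "'a \<times> 'b"
  have "0 = a + b \<longleftrightarrow> b = - a" for a b :: 'c
    using add_eq_0_iff by metis
  then have "r \<in> gph (solution_map M \<Phi> G) \<longleftrightarrow> (\<exists>a\<in>expected_map M \<Phi> r. - a \<in> G r)"
    by (cases r) (auto simp: gph_def solution_map_def set_plus_def)
  then show "r \<in> gph (solution_map M \<Phi> G) \<longleftrightarrow> r \<in> ?S"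
    by (auto simp: expected_map_def aumann_integral_def gph_def)
qed

theorem theorem6p2:
  fixes M :: "'t measure"
    and \<Phi> :: "'t \<Rightarrow> (real ^ 'n) \<times> (real ^ 'q) \<Rightarrow> (real ^ 'm) set"
    and G :: "(real ^ 'n) \<times> (real ^ 'q) \<Rightarrow> (real ^ 'm) set"
    and xbar :: "real ^ 'n" and zbar :: "real ^ 'q"
    and yfun :: "'t \<Rightarrow> real ^ 'm" and ybar :: "real ^ 'm"
  assumes "finite_measure M"
    and "complete_measure M"
    and "normal_integrand M \<Phi>"
    and "closed (gph G)"
    and "(xbar, zbar) \<in> gph (solution_map M \<Phi> G)"
    and "normally_regular (gph (solution_map M \<Phi> G)) (xbar, zbar)"
    and "\<exists>\<rho>>0. \<forall>u\<in>cball (xbar, zbar) \<rho>. \<forall>t\<in>space M. convex (\<Phi> t u)"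
    and "\<forall>t\<in>space M. \<Phi> t (xbar, zbar) = {yfun t}"
    and "integrably_Lipschitz_like M \<Phi> (xbar, zbar) yfun"
    and "ybar \<in> uminus ` G (xbar, zbar) \<inter> expected_map M \<Phi> (xbar, zbar)"
    and "\<forall>ys. 0 \<in> aumann_integral M (\<lambda>t. coderivative (\<Phi> t) (xbar, zbar) (yfun t) ys)
                   + coderivative G (xbar, zbar) (- ybar) ys \<longrightarrow> ys = 0"
  shows "\<forall>zs. \<forall>xs\<in>coderivative (solution_map M \<Phi> G) xbar zbar zs.
           \<exists>ys. (xs, - zs) \<in> aumann_integral M (\<lambda>t. coderivative (\<Phi> t) (xbar, zbar) (yfun t) ys)
                   + coderivative G (xbar, zbar) (- ybar) ys"
proof -
  interpret complete_finite_measure M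
    using assms(1,2) by (simp add: complete_finite_measure_def)
  define ub where "ub = (xbar, zbar)"
  note single = assms(8)[folded ub_def]
  obtain \<rho> where \<rho>: "\<rho> > 0" "\<And>u t. u \<in> cball ub \<rho> \<Longrightarrow> t \<in> space M \<Longrightarrow> convex (\<Phi> t u)"
    using assms(7) unfolding ub_def by blast
  obtain l \<eta>0 \<gamma> T' where l: "l > 0" and \<eta>0: "\<eta>0 > 0" and \<gamma>: "\<gamma> > 0"
    and T': "T' \<in> sets M" "emeasure M (space M - T') = 0"
    and Lip: "\<And>t u u'. t \<in> T' \<Longrightarrow> u \<in> cball ub \<eta>0 \<Longrightarrow> u' \<in> cball ub \<eta>0 \<Longrightarrow>
      \<Phi> t u \<inter> cball (yfun t) \<gamma> \<subseteq> \<Phi> t u' + (\<lambda>b. (l * norm (u - u')) *\<^sub>R b) ` cball 0 1"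
  proof -
    have "\<exists>l \<eta> \<gamma>. l > 0 \<and> \<eta> > 0 \<and> \<gamma> > 0 \<and>
       (\<exists>T'\<in>sets M. emeasure M (space M - T') = 0 \<and>
         (\<forall>t\<in>T'. \<forall>u\<in>cball ub \<eta>. \<forall>u'\<in>cball ub \<eta>.
            \<Phi> t u \<inter> cball (yfun t) \<gamma> \<subseteq> \<Phi> t u' + (\<lambda>b. (l * norm (u - u')) *\<^sub>R b) ` cball 0 1))"
      using assms(9) by (simp only: integrably_Lipschitz_like_def ub_def)
    then obtain l \<eta> \<gamma> T' where *: "l > 0" "\<eta> > 0" "\<gamma> > 0" "T' \<in> sets M" "emeasure M (space M - T') = 0"
      "\<forall>t\<in>T'. \<forall>u\<in>cball ub \<eta>. \<forall>u'\<in>cball ub \<eta>.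
         \<Phi> t u \<inter> cball (yfun t) \<gamma> \<subseteq> \<Phi> t u' + (\<lambda>b. (l * norm (u - u')) *\<^sub>R b) ` cball 0 1"
      by blast
    show thesis by (rule that[OF *(1-5)]) (rule *(6)[rule_format])
  qed
  \<comment> \<open>The bound \<open>\<gamma> / (2 * l)\<close> keeps \<open>l * |u - ub|\<close> below \<open>\<gamma> / 2\<close>.\<close>
  define \<eta> where "\<eta> = min \<eta>0 (min \<rho> (\<gamma> / (2 * l)))"
  have \<eta>: "\<eta> > 0" "\<eta> \<le> \<eta>0" "\<eta> \<le> \<rho>" "2 * l * \<eta> \<le> \<gamma>"
  proof -
    have "\<eta> \<le> \<gamma> / (2 * l)" by (simp add: \<eta>_def)
    then show "2 * l * \<eta> \<le> \<gamma>" using l by (simp add: pos_le_divide_eq mult_ac)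
  qed (use \<eta>0 \<rho> \<gamma> l in \<open>auto simp: \<eta>_def\<close>)
  obtain f where f: "integrable M f" "AE t in M. f t \<in> \<Phi> t ub" "integral\<^sup>L M f = ybar"
    using assms(10) by (auto simp: expected_map_def aumann_integral_def ub_def)
  obtain N where N: "{t\<in>space M. \<not> f t \<in> \<Phi> t ub} \<subseteq> N" "emeasure M N = 0" "N \<in> sets M"
    using f(2) by (rule AE_E)
  define T0 where "T0 = T' - N"
  have T0: "T0 \<in> sets M" using T' N by (simp add: T0_def)
  have T0sp: "T0 \<subseteq> space M" using T0 by (rule sets.sets_into_space)
  have "AE t in M. t \<notin> space M - T' \<and> t \<notin> N"
    using T' N by (intro AE_conjI AE_not_in null_setsI) auto
  then have AE0: "AE t in M. t \<in> T0"
    using AE_space by eventually_elim (auto simp: T0_def)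
  have fT0: "f t = yfun t" if "t \<in> T0" for t
  proof -
    have "t \<in> space M" "f t \<in> \<Phi> t ub" using that T0sp N(1) by (auto simp: T0_def)
    then show ?thesis using single by auto
  qed
  \<comment> \<open>Outside a set of full measure the data are replaced by the zero map.\<close>
  define y0 where "y0 t = (if t \<in> T0 then f t else 0)" for t
  define \<Psi> where "\<Psi> t u = (if t \<in> T0 then \<Phi> t u else {0})" for t u
  have y0_int: "integrable M y0"
  proof -
    have "integrable M (\<lambda>t. indicat_real T0 t *\<^sub>R f t)" by (rule integrable_mult_indicator[OF T0 f(1)])
    moreover have "(\<lambda>t. indicat_real T0 t *\<^sub>R f t) = y0" by (auto simp: y0_def)
    ultimately show ?thesis by simp
  qed
  have "AE t in M. y0 t = f t" using AE0 by eventually_elim (simp add: y0_def)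
  then have y0I: "integral\<^sup>L M y0 = ybar"
    using integral_cong_AE[of y0 M f] y0_int f by (auto dest: borel_measurable_integrable)
  have AE\<Psi>: "AE t in M. \<Psi> t = \<Phi> t \<and> y0 t = yfun t"
    using AE0 by eventually_elim (auto simp: \<Psi>_def y0_def fT0)
  have gph\<Psi>: "gph (\<Psi> t) = (if t \<in> T0 then gph (\<Phi> t) else UNIV \<times> {0})" for t
    by (auto simp: gph_def \<Psi>_def)
  have regular: "norm (y - y0 t) \<le> l * norm (u - ub) \<and>
      (\<forall>u'\<in>cball ub \<eta>. \<exists>y'\<in>\<Psi> t u'. norm (y' - y) \<le> l * norm (u' - u))"
    if "t \<in> space M" "u \<in> cball ub \<eta>" "y \<in> \<Psi> t u" for t u y
  proof (cases "t \<in> T0")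
    case True
    have "norm (y - yfun t) \<le> l * norm (u - ub) \<and>
      (\<forall>u'\<in>cball ub \<eta>. \<exists>y'\<in>\<Phi> t u'. norm (y' - y) \<le> l * norm (u' - u))"
    proof (rule convex_Lipschitz_like_imp_Lipschitz[where \<gamma>=\<gamma>, OF l \<gamma>])
      show "\<Phi> t a \<inter> cball (yfun t) \<gamma> \<subseteq> \<Phi> t b + (\<lambda>x. (l * norm (a - b)) *\<^sub>R x) ` cball 0 1"
        if "a \<in> cball ub \<eta>" "b \<in> cball ub \<eta>" for a b
        using Lip[of t a b] True that \<eta>(2) by (simp add: T0_def)
      show "convex (\<Phi> t a)" if "a \<in> cball ub \<eta>" for a using \<rho>(2)[of a t] that \<eta>(3) \<open>t \<in> space M\<close> by simp
      show "\<Phi> t ub = {yfun t}" using single \<open>t \<in> space M\<close> by blast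
      show "y \<in> \<Phi> t u" using that True by (simp add: \<Psi>_def)
    qed (use \<eta> that in auto)
    then show ?thesis using True by (simp add: y0_def fT0 \<Psi>_def)
  next
    case False
    then show ?thesis using that l by (simp add: \<Psi>_def y0_def)
  qed
  interpret \<Psi>: Lipschitz_integrand M \<Psi> ub y0 l \<eta>
  proof unfold_locales
    have graph\<Phi>: "measurable_graph M (\<lambda>t. gph (\<Phi> t))"
    proof -
      have "{w\<in>space (M \<Otimes>\<^sub>M borel). snd w \<in> gph (\<Phi> (fst w))} = {(t, w). t \<in> space M \<and> w \<in> gph (\<Phi> t)}"
        by (auto simp: space_pair_measure)
      then show ?thesis
        using assms(3) by (simp add: measurable_graph_def pred_def normal_integrand_def)
    qed
    have "Measurable.pred (M \<Otimes>\<^sub>M (borel :: (((real ^ 'n) \<times> (real ^ 'q)) \<times> (real ^ 'm)) measure)) (\<lambda>w. fst w \<in> T0)"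
      by (rule pred_sets2[OF T0 measurable_fst])
    moreover have "Measurable.pred (M \<Otimes>\<^sub>M (borel :: (((real ^ 'n) \<times> (real ^ 'q)) \<times> (real ^ 'm)) measure)) (\<lambda>w. snd w \<in> UNIV \<times> {0})"
      by (rule pred_sets2[OF _ measurable_snd]) (intro borel_closed closed_Times closed_UNIV closed_singleton)
    moreover note graph\<Phi>[unfolded measurable_graph_def]
    ultimately have "Measurable.pred (M \<Otimes>\<^sub>M borel) (\<lambda>w. fst w \<in> T0 \<and> snd w \<in> gph (\<Phi> (fst w)) \<or> \<not> fst w \<in> T0 \<and> snd w \<in> UNIV \<times> {0})"
      by (intro pred_intros_logic)
    moreover have "snd w \<in> gph (\<Psi> (fst w)) \<longleftrightarrow>
        fst w \<in> T0 \<and> snd w \<in> gph (\<Phi> (fst w)) \<or> \<not> fst w \<in> T0 \<and> snd w \<in> UNIV \<times> {0}" for w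
      by (simp add: gph\<Psi>)
    ultimately show "measurable_graph M (\<lambda>t. gph (\<Psi> t))" by (simp only: measurable_graph_def)
    show "closed (gph (\<Psi> t))" if "t \<in> space M" for t
      unfolding gph\<Psi> using assms(3) that by (auto simp: normal_integrand_def intro!: closed_Times)
    show "y0 t \<in> \<Psi> t ub" if "t \<in> space M" for t
      using that single by (auto simp: \<Psi>_def y0_def fT0)
  qed (use l \<eta> y0_int regular in blast)+
  have aumann: "h \<in> aumann_integral M (\<lambda>t. coderivative (\<Phi> t) ub (yfun t) p) + coderivative G ub (- ybar) p"
    if "integrable M g" "AE t in M. g t \<in> coderivative (\<Psi> t) ub (y0 t) p"
      "(q, - p) \<in> limiting_normal_cone (gph G) (ub, - integral\<^sup>L M y0)" "integral\<^sup>L M g + q = h"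
    for g q p h
  proof -
    have "AE t in M. g t \<in> coderivative (\<Phi> t) ub (yfun t) p"
      using that(2) AE\<Psi> by eventually_elim simp
    then have "integral\<^sup>L M g \<in> aumann_integral M (\<lambda>t. coderivative (\<Phi> t) ub (yfun t) p)"
      using that(1) by (auto simp: aumann_integral_def)
    moreover have "q \<in> coderivative G ub (- ybar) p" using that(3) by (simp add: coderivative_def y0I)
    ultimately show ?thesis using that(4) by (auto simp: set_plus_def)
  qed
  have S: "gph (solution_map M \<Phi> G) =
      {r. \<exists>y. integrable M y \<and> (AE t in M. y t \<in> \<Psi> t r) \<and> (r, - integral\<^sup>L M y) \<in> gph G}"
  proof -
    have "(AE t in M. y t \<in> \<Phi> t r) \<longleftrightarrow> (AE t in M. y t \<in> \<Psi> t r)" for y r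
    proof (rule eventually_cong)
      show "AE t in M. \<Psi> t = \<Phi> t" using AE\<Psi> by eventually_elim simp
    qed simp
    then show ?thesis unfolding gph_solution_map by simp
  qed
  show ?thesis
  proof (intro allI ballI)
    fix zs xs assume "xs \<in> coderivative (solution_map M \<Phi> G) xbar zbar zs"
    then have "(xs, - zs) \<in> limiting_normal_cone (gph (solution_map M \<Phi> G)) ub"
      by (simp add: coderivative_def ub_def)
    then have w: "(xs, - zs) \<in> regular_normal_cone (gph (solution_map M \<Phi> G)) ub"
      using assms(6) by (simp add: normally_regular_def ub_def)
    have base: "(ub, - integral\<^sup>L M y0) \<in> gph G"
      using assms(10) by (auto simp: y0I gph_def ub_def)
    have "\<exists>p g q. integrable M g \<and> (AE t in M. g t \<in> coderivative (\<Psi> t) ub (y0 t) p) \<and>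
      (q, - p) \<in> limiting_normal_cone (gph G) (ub, - integral\<^sup>L M y0) \<and> integral\<^sup>L M g + q = (xs, - zs)"
    proof (rule \<Psi>.multiplier_exists[OF assms(4) base w[unfolded S, folded \<Psi>.feasible_set_def]])
      show "p = 0" if "integrable M g" "AE t in M. g t \<in> coderivative (\<Psi> t) ub (y0 t) p"
        "(q, - p) \<in> limiting_normal_cone (gph G) (ub, - integral\<^sup>L M y0)" "integral\<^sup>L M g + q = 0" for g q p
        using aumann[OF that] assms(11) by (simp add: ub_def)
    qed
    then show "\<exists>ys. (xs, - zs) \<in> aumann_integral M (\<lambda>t. coderivative (\<Phi> t) (xbar, zbar) (yfun t) ys)
                   + coderivative G (xbar, zbar) (- ybar) ys"
      using aumann unfolding ub_def by blast
  qed
qed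

end
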